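(* Let $\Gamma$ be a CH2O type environment, $\delta$ a CH2O function environment, $f$ a function name and $s$ a CH2O core C statement. Suppose that for every core C big-step store $\sigma_h$, $\mathrm{CHcorrect}(0,s,\sigma_h)$ holds. Then $s$ is correct as the body of the parameterless function $f$ in the CH2O core C small-step semantics, i.e. $\mathrm{SScorrect}(\Gamma,\delta,f,s)$ holds: for every execution state $S$, if $\Gamma$ is valid, $\delta$ is valid with respect to $\Gamma$ and the empty memory typing, $s$ has statement type $(\mathrm{true},\mathrm{Some}\ \text{signed int})$ in $\Gamma$ with empty memory typing and no local variables, and $$\Gamma,\delta,[\,]\vdash \mathbf{S}\big([\mathrm{CParams}\ f\ [\,]],\ (\searrow,s),\ \emptyset\big)\Rightarrow^{*}S,$$ then either $S$ can take a further step of $\Gamma,\delta,[\,]\vdash\cdot\Rightarrow\cdot$, or there are a memory $m$ and an integer $z$ with $S=\mathbf{S}\big([\,],\ \mathrm{Return}\ f\ (\mathrm{int}_{\text{signed int}}\,z),\ m\big)$.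
   Context: The setting is core C, the kernel language of Krebbers' CH2O formalization of C11 (R. Krebbers, "The C standard formalized in Coq", PhD thesis 2015, and its Coq development), for the LP64 data model. Syntax, typing, validity, memory and the ($\rho$-extended) small-step relation are those of CH2O; their parts relevant for the constructs below are recalled. Write sint for signed int; "in range" means lying in $[-2^{31},2^{31}-1]$. $l\,!!\,i$ is partial list lookup (0-based). **Syntax (de Bruijn indices for locals).** Relevant expressions: values (with a set $\Omega$ of locked addresses attached), in particular the literal $\#\,\mathrm{int}\,z$ of type sint; $\mathrm{var}\,i$ (an lvalue); $\mathrm{load}\,e$; unary $\mathrm{op}\,e$; binary $e_1\,\mathrm{op}\,e_2$; assignment $e_1::=e_2$; $\mathrm{cast}_\tau e$. Relevant statements: $\mathrm{skip}$, $s_1;;s_2$, $\mathrm{local}_\tau\,s$ (declares an uninitialised local of type $\tau$, which becomes index 0), $!e$ (expression statement; $e_1::=e_2$ used as a statement means $!(e_1::=e_2)$), $\mathrm{if}\{e\}\,s_1\,\mathrm{else}\,s_2$, $\mathrm{throw}\,n$, $\mathrm{catch}\,s$, $\mathrm{loop}\,s$, $\mathrm{ret}\,e$. Full core C also has pointers, aggregates, calls, allocation, comma and conditional expressions, goto/labels and switch/case. **Big-step semantics.** A store is a list of elements of $\mathrm{option}\,\mathbb Z$. $\mathrm{eval}\,\sigma\,e\,z$ is inductively defined: $\mathrm{eval}\,\sigma\,(\#\,\mathrm{int}\,z)\,z$ if $z$ in range; $\mathrm{eval}\,\sigma\,(\mathrm{load}(\mathrm{var}\,i))\,z$ if $\sigma\,!!\,i=\mathrm{Some}(\mathrm{Some}\,z)$;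 for logical not, if $\mathrm{eval}\,\sigma\,e\,z$ then $\mathrm{eval}\,\sigma\,(\mathrm{not}\,e)\,z'$ with $z'=1$ if $z=0$ and $0$ otherwise; for binary $+,-,/,<,\le,==$, if $\mathrm{eval}\,\sigma\,e_j\,z_j$ ($j=1,2$), the divisor is nonzero for $/$, and the result $r$ (truncated quotient for $/$; $1$/$0$ for true/false comparisons) is in range, then $\mathrm{eval}\,\sigma\,(e_1\,\mathrm{op}\,e_2)\,r$. Outcomes: $\mathrm{ONormal}\,\sigma'$, $\mathrm{OReturn}\,z$, $\mathrm{OThrow}\,n\,\sigma'$. "Abnormal" = not $\mathrm{ONormal}$; "nothrown" = not $\mathrm{OThrow}$. $\mathrm{exec}\,\sigma\,s\,O$ is inductively defined by: - $\mathrm{exec}\,\sigma\,\mathrm{skip}\,(\mathrm{ONormal}\,\sigma)$. - $\mathrm{exec}\,\sigma\,(s_1;;s_2)\,O$ if $\mathrm{exec}\,\sigma\,s_1\,(\mathrm{ONormal}\,\sigma')$ and $\mathrm{exec}\,\sigma'\,s_2\,O$; or if $O$ is abnormal and $\mathrm{exec}\,\sigma\,s_1\,O$. - If $\mathrm{exec}\,(\mathrm{None}::\sigma)\,s\,O'$ then $\mathrm{exec}\,\sigma\,(\mathrm{local}_{\mathrm{sint}}\,s)\,O$, where $(O',O)$ is one of $(\mathrm{ONormal}(mv::\sigma'),\mathrm{ONormal}\,\sigma')$, $(\mathrm{OReturn}\,z,\mathrm{OReturn}\,z)$, $(\mathrm{OThrow}\,n\,(mv::\sigma'),\mathrm{OThrow}\,n\,\sigma')$.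 - If $i<\mathrm{length}\,\sigma$ and $\mathrm{eval}\,\sigma\,e\,z$ then both $\mathrm{var}\,i::=\mathrm{cast}_{\mathrm{sint}}e$ and $!(\mathrm{cast}_{\mathrm{void}}(\mathrm{var}\,i::=e))$ execute from $\sigma$ with outcome $\mathrm{ONormal}(\sigma[i:=\mathrm{Some}\,z])$. - If $\mathrm{eval}\,\sigma\,e\,z$ and $\mathrm{exec}\,\sigma\,s'\,O$ with $s'=s_2$ if $z=0$ and $s'=s_1$ otherwise, then $\mathrm{exec}\,\sigma\,(\mathrm{if}\{e\}\,s_1\,\mathrm{else}\,s_2)\,O$. - $\mathrm{exec}\,\sigma\,(\mathrm{throw}\,n)\,(\mathrm{OThrow}\,n\,\sigma)$. - $\mathrm{exec}\,\sigma\,(\mathrm{catch}\,s)\,(\mathrm{ONormal}\,\sigma')$ if $\mathrm{exec}\,\sigma\,s\,(\mathrm{OThrow}\,0\,\sigma')$; $\mathrm{exec}\,\sigma\,(\mathrm{catch}\,s)\,(\mathrm{OThrow}\,n\,\sigma')$ if $\mathrm{exec}\,\sigma\,s\,(\mathrm{OThrow}\,(n+1)\,\sigma')$; $\mathrm{exec}\,\sigma\,(\mathrm{catch}\,s)\,O$ if $O$ is nothrown and $\mathrm{exec}\,\sigma\,s\,O$. - For abnormal $O$: $\mathrm{exec}\,\sigma\,(\mathrm{loop}\,s)\,O$ if $\mathrm{exec}\,\sigma\,s\,O$, or if $\mathrm{exec}\,\sigma\,s\,(\mathrm{ONormal}\,\sigma')$ and $\mathrm{exec}\,\sigma'\,(\mathrm{loop}\,s)\,O$.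 - $\mathrm{exec}\,\sigma\,(\mathrm{ret}(\mathrm{cast}_{\mathrm{sint}}e))\,(\mathrm{OReturn}\,z)$ if $\mathrm{eval}\,\sigma\,e\,z$. $\mathrm{execinf}\,\sigma\,s$ (divergence) is coinductively defined by: $s_1;;s_2$ diverges from $\sigma$ if $\mathrm{execinf}\,\sigma\,s_1$, or $\mathrm{exec}\,\sigma\,s_1\,(\mathrm{ONormal}\,\sigma')$ and $\mathrm{execinf}\,\sigma'\,s_2$; $\mathrm{local}_{\mathrm{sint}}\,s$ if $\mathrm{execinf}\,(\mathrm{None}::\sigma)\,s$; $\mathrm{if}\{e\}\,s_1\,\mathrm{else}\,s_2$ if $\mathrm{eval}\,\sigma\,e\,z$ and the selected branch ($s_2$ if $z=0$, else $s_1$) diverges from $\sigma$; $\mathrm{catch}\,s$ if $\mathrm{execinf}\,\sigma\,s$; $\mathrm{loop}\,s$ if $\mathrm{execinf}\,\sigma\,s$, or $\mathrm{exec}\,\sigma\,s\,(\mathrm{ONormal}\,\sigma')$ and $\mathrm{execinf}\,\sigma'\,(\mathrm{loop}\,s)$. $\mathrm{CHcorrect}(n,s,\sigma)$ means: if $\mathrm{length}\,\sigma=n$ and every integer stored in $\sigma$ is in range, then $(\exists z,\ \mathrm{exec}\,\sigma\,s\,(\mathrm{OReturn}\,z))$ or $\mathrm{execinf}\,\sigma\,s$. **Environments and typing.** A type environment $\Gamma$ gives the field types of structs/unions and the types of functions; it is valid if all these types are well-formed (no ill-founded recursion). A function environment (program) $\delta$ maps function names to bodies; it is valid w.r.t.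 $\Gamma$ and a memory typing if its functions are exactly those declared in $\Gamma$ and each body is well-typed with the declared parameters as locals and the declared return type, all its gotos have targets and all its throws are caught. A statement type is a pair $(c,\tau^?)$: $c=\mathrm{true}$ records that the statement never finishes normally (control does not fall through), $\tau^?$ is the optional type of returned values. E.g. $\mathrm{skip}$ and $!e$ ($e$ well-typed) have type $(\mathrm{false},\mathrm{None})$; $\mathrm{throw}\,n$ has $(\mathrm{true},\mathrm{None})$; $\mathrm{ret}\,e$ has $(\mathrm{true},\mathrm{Some}\,\tau)$ for $e$ an rvalue of type $\tau$; $\mathrm{local}_\tau s$ has the type of $s$ with $\tau$ prepended to the local types; $\mathrm{catch}\,s$ has $(\mathrm{false},\tau^?)$ and $\mathrm{loop}\,s$ has $(\mathrm{true},\tau^?)$ if $s$ has $(c,\tau^?)$; $s_1;;s_2$ has flag $c_2$ and $\mathrm{if}$ has flag $c_1\wedge c_2$, with the return types of the two parts required to be compatible and merged. **States.** A state $\mathbf S(k,\phi,m)$ has a program context $k$ (a list of items: $\mathrm{CStmt}\,E$ for a one-hole statement context $E$ such as $\Box;;s_2$, $s_1;;\Box$, $\mathrm{catch}\,\Box$, $\mathrm{loop}\,\Box$, $\mathrm{if}\{e\}\Box\,\mathrm{else}\,s_2$, $\mathrm{if}\{e\}s_1\,\mathrm{else}\,\Box$; $\mathrm{CLocal}\,o\,\tau$ for a local stored at object identifier $o$; $\mathrm{CExpr}\,e\,E$ for an expression $e$ under evaluation inside a statement context $E\in\{!\Box,\mathrm{ret}\,\Box,\mathrm{if}\{\Box\}s_1\,\mathrm{else}\,s_2,\dots\}$;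 $\mathrm{CFun}$ for a calling expression context; $\mathrm{CParams}\,f\,\overline{(o,\tau)}$ for the parameters of the running function $f$), a focus $\phi$ (a statement with direction $(d,s)$, $d\in\{\searrow,\nearrow,\uparrow n\text{ (throw)},\uparrow\uparrow v\text{ (return)},\text{goto, switch}\}$; an expression; a call; $\mathrm{Return}\,f\,v$; or $\mathrm{Undef}$, denoting undefined behaviour) and a memory $m$ ($\emptyset$ = empty memory). $\mathrm{locals}(k)$ is the list of $(o,\tau)$ for the $\mathrm{CLocal}$ items from the top of $k$ up to the nearest $\mathrm{CParams}$, followed by the parameters in that item. The memory maps object identifiers to typed objects whose (sub)addresses may be locked; a new sint object is indeterminate. **Small steps** $\Gamma,\delta,\rho\vdash S_1\Rightarrow S_2$ (the list $\rho$ of (object, type) pairs is appended to $\mathrm{locals}(k)$ when resolving variables; here $\rho=[\,]$; memory unchanged unless stated): - $(\searrow,\mathrm{skip})$ steps to $(\nearrow,\mathrm{skip})$; $(\searrow,\mathrm{throw}\,n)$ to $(\uparrow n,\mathrm{throw}\,n)$. - $(\searrow,E[e])$ in $k$ steps to expression focus $e$ in $\mathrm{CExpr}\,e\,E::k$. When the expression has become a value with lock set $\Omega$, the addresses in $\Omega$ are unlocked and: for $!\Box$ go to $(\nearrow,!e)$; for $\mathrm{ret}\,\Box$ with value $v$ go to $(\uparrow\uparrow v,\mathrm{ret}\,e)$; for $\mathrm{if}$ enter ($\searrow$) $s_1$ if the value is nonzero, $s_2$ if zero, pushing the corresponding $\mathrm{CStmt}$ item, and go to $\mathrm{Undef}$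 if the value cannot be branched on (e.g. indeterminate). - Entering $(\searrow)$ $s_1;;s_2$, $\mathrm{catch}\,s$, $\mathrm{loop}\,s$ pushes the context item and enters $s_1$, resp. $s$. Leaving $(\nearrow)$: from $s_1$ in $\Box;;s_2$ enter $s_2$ in $s_1;;\Box$; from $s_2$ in $s_1;;\Box$, from the body of $\mathrm{catch}$, and from a branch of $\mathrm{if}$ pop the item with direction $\nearrow$; from the body of $\mathrm{loop}\,\Box$ pop to $(\searrow,\mathrm{loop}\,s)$. - $(\uparrow 0,s)$ under $\mathrm{catch}\,\Box$ steps to $(\nearrow,\mathrm{catch}\,s)$, $(\uparrow(n+1),s)$ under $\mathrm{catch}\,\Box$ to $(\uparrow n,\mathrm{catch}\,s)$; under any other statement context item $E$, $(\uparrow n,s)$ steps to $(\uparrow n,E[s])$; under any statement context item, $(\uparrow\uparrow v,s)$ steps to $(\uparrow\uparrow v,E[s])$. - $(\searrow,\mathrm{local}_\tau s)$ pushes $\mathrm{CLocal}\,o\,\tau$ for any fresh $o$, allocating a new indeterminate object of type $\tau$ at $o$, and enters $s$; a focus on $s$ with outgoing direction ($\nearrow$, $\uparrow n$, $\uparrow\uparrow v$) under $\mathrm{CLocal}\,o\,\tau$ pops it, frees $o$, and keeps the direction on $\mathrm{local}_\tau s$. - Under $\mathrm{CParams}\,f\,\overline{(o,\tau)}::k$: $(\uparrow\uparrow v,s)$ steps to focus $\mathrm{Return}\,f\,v$ in $k$, $(\nearrow,s)$ steps to $\mathrm{Return}\,f$ with the void value in $k$, freeing the parameters. $\mathrm{Return}\,f\,v$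 under a $\mathrm{CFun}$ item resumes the caller; with empty context it does not step. - Expression focus: any redex in any expression evaluation context (evaluation order is nondeterministic) may be head-reduced: $\mathrm{var}\,i$ to the address of the $i$-th entry of the locals; $\mathrm{load}$ of an address to the stored value if readable and not locked; $a::=v$ to the value $v$ converted to the type of $a$, storing it at $a$ and locking $a$ (adding $a$ to the value's lock set), if $a$ is writable and not locked and the conversion is defined; unary/binary operations and casts on values to their C results, if defined (no signed overflow, no division by zero, no indeterminate operands, casts of in-range ints to sint being the identity and casts to void giving the void value). If a redex has no head reduction (and is not a call), the state steps to $\mathrm{Undef}$. An $\mathrm{Undef}$ state does not step. - The remaining rules (calls, goto, switch, etc.) are as in CH2O. $\Rightarrow^*$ is the reflexive-transitive closure. $\mathrm{SScorrect}(\Gamma,\delta,f,s)$ is the property spelled out in the claim. *)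

theory Defs
  imports Complex_Main "HOL-Library.Finite_Map" "HOL-Library.Signed_Division"
begin

text \<open>
  Core C of the CH2O formalization (R. Krebbers, The C standard formalized in Coq), instantiated
  to an LP64 implementation: 8-bit bytes, two's complement, little endian, naturally aligned
  types.  The parameters that the data model leaves open are fixed as follows: casts of
  out-of-range integers to signed types and right shifts of negative integers are undefined,
  and allocation may fail.
\<close>


section \<open>Types\<close>

type_synonym tag = string
type_synonym funname = string
type_synonym labelname = string
type_synonym index = nat

datatype signedness = Signed | Unsigned

datatype irank = CharRank | ShortRank | IntRank | LongRank | LongLongRank | PtrRank

datatype itype = IntType (isign: signedness) (irank: irank)

datatype compound_kind = Struct_kind | Union_kind

datatype ctype = TBase btype | TArray ctype nat | TCompound compound_kind tag
  and ptype = TType ctype | TAny | TFun "ctype list" ctype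
  and btype = TVoid | TInt itype | TPtr ptype

abbreviation sint_it :: itype where "sint_it \<equiv> IntType Signed IntRank"
abbreviation uint_it :: itype where "uint_it \<equiv> IntType Unsigned IntRank"
abbreviation uchar_it :: itype where "uchar_it \<equiv> IntType Unsigned CharRank"
abbreviation sptr_it :: itype where "sptr_it \<equiv> IntType Signed PtrRank"
abbreviation sint :: ctype where "sint \<equiv> TBase (TInt sint_it)"
abbreviation uchar :: ctype where "uchar \<equiv> TBase (TInt uchar_it)"
abbreviation voidT :: ctype where "voidT \<equiv> TBase TVoid"

datatype env = Env (env_c: "(tag, ctype list) fmap") (env_f: "(funname, ctype list \<times> ctype) fmap")

abbreviation fields :: "env \<Rightarrow> tag \<Rightarrow> ctype list option" where
  "fields \<Gamma> t \<equiv> fmlookup (env_c \<Gamma>) t"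

inductive ctype_valid :: "env \<Rightarrow> ctype \<Rightarrow> bool"
  and ptype_valid :: "env \<Rightarrow> ptype \<Rightarrow> bool"
  and btype_valid :: "env \<Rightarrow> btype \<Rightarrow> bool" for \<Gamma> :: env where
  TBase_valid: "btype_valid \<Gamma> \<tau>b \<Longrightarrow> ctype_valid \<Gamma> (TBase \<tau>b)"
| TArray_valid: "ctype_valid \<Gamma> \<tau> \<Longrightarrow> n \<noteq> 0 \<Longrightarrow> ctype_valid \<Gamma> (TArray \<tau> n)"
| TCompound_valid: "fields \<Gamma> t \<noteq> None \<Longrightarrow> ctype_valid \<Gamma> (TCompound c t)"
| TAny_ptr_valid: "ptype_valid \<Gamma> TAny"
| TBase_ptr_valid: "btype_valid \<Gamma> \<tau>b \<Longrightarrow> ptype_valid \<Gamma> (TType (TBase \<tau>b))"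
| TArray_ptr_valid: "ctype_valid \<Gamma> \<tau> \<Longrightarrow> n \<noteq> 0 \<Longrightarrow> ptype_valid \<Gamma> (TType (TArray \<tau> n))"
| TCompound_ptr_valid: "ptype_valid \<Gamma> (TType (TCompound c t))"
| TFun_ptr_valid: "(\<And>\<tau>. \<tau> \<in> set \<tau>s \<Longrightarrow> ptype_valid \<Gamma> (TType \<tau>)) \<Longrightarrow> ptype_valid \<Gamma> (TType \<sigma>) \<Longrightarrow>
    ptype_valid \<Gamma> (TFun \<tau>s \<sigma>)"
| TVoid_valid: "btype_valid \<Gamma> TVoid"
| TInt_valid: "btype_valid \<Gamma> (TInt \<tau>i)"
| TPtr_valid: "ptype_valid \<Gamma> \<tau>p \<Longrightarrow> btype_valid \<Gamma> (TPtr \<tau>p)"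

fun type_complete :: "env \<Rightarrow> ctype \<Rightarrow> bool" where
  "type_complete \<Gamma> (TCompound c t) = (fields \<Gamma> t \<noteq> None)"
| "type_complete \<Gamma> (TBase \<tau>b) = True"
| "type_complete \<Gamma> (TArray \<tau> n) = True"

text \<open>Compound types are declared one after the other and contain only earlier ones by value.\<close>

inductive env_c_valid :: "(tag, ctype list) fmap \<Rightarrow> bool" where
  env_empty_valid: "env_c_valid fmempty"
| env_add_valid: "env_c_valid C \<Longrightarrow> \<forall>\<tau>\<in>set \<tau>s. ctype_valid (Env C fmempty) \<tau> \<Longrightarrow> \<tau>s \<noteq> [] \<Longrightarrow>
    fmlookup C t = None \<Longrightarrow> env_c_valid (fmupd t \<tau>s C)"

definition env_valid :: "env \<Rightarrow> bool" where
  "env_valid \<Gamma> \<longleftrightarrow> env_c_valid (env_c \<Gamma>) \<and>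
    (\<forall>f \<tau>s \<tau>. fmlookup (env_f \<Gamma>) f = Some (\<tau>s, \<tau>) \<longrightarrow>
      (\<forall>\<sigma>\<in>set \<tau>s. ptype_valid \<Gamma> (TType \<sigma>)) \<and> ptype_valid \<Gamma> (TType \<tau>))"


section \<open>Integers\<close>

definition char_bits :: nat where "char_bits = 8"

fun rank_size :: "irank \<Rightarrow> nat" where
  "rank_size CharRank = 1"
| "rank_size ShortRank = 2"
| "rank_size IntRank = 4"
| "rank_size LongRank = 8"
| "rank_size LongLongRank = 8"
| "rank_size PtrRank = 8"

fun rank_pos :: "irank \<Rightarrow> nat" where
  "rank_pos CharRank = 0"
| "rank_pos ShortRank = 1"
| "rank_pos IntRank = 2"
| "rank_pos LongRank = 3"
| "rank_pos LongLongRank = 4"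
| "rank_pos PtrRank = 5"

definition rank_le :: "irank \<Rightarrow> irank \<Rightarrow> bool" where
  "rank_le k1 k2 \<longleftrightarrow> rank_pos k1 \<le> rank_pos k2"

definition int_width :: "itype \<Rightarrow> nat" where
  "int_width \<tau>i = rank_size (irank \<tau>i) * char_bits"

definition int_lower :: "itype \<Rightarrow> int" where
  "int_lower \<tau>i = (case isign \<tau>i of Signed \<Rightarrow> - (2 ^ (int_width \<tau>i - 1)) | Unsigned \<Rightarrow> 0)"

text \<open>The upper bound is exclusive.\<close>

definition int_upper :: "itype \<Rightarrow> int" where
  "int_upper \<tau>i = (case isign \<tau>i of Signed \<Rightarrow> 2 ^ (int_width \<tau>i - 1) | Unsigned \<Rightarrow> 2 ^ int_width \<tau>i)"

definition int_typed :: "int \<Rightarrow> itype \<Rightarrow> bool" where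
  "int_typed x \<tau>i \<longleftrightarrow> int_lower \<tau>i \<le> x \<and> x < int_upper \<tau>i"

definition int_promote :: "itype \<Rightarrow> itype" where
  "int_promote \<tau>i =
    (if rank_le (irank \<tau>i) IntRank
     then if int_upper \<tau>i \<le> int_upper sint_it then sint_it else uint_it
     else \<tau>i)"

text \<open>The usual arithmetic conversions, for promoted operand types.\<close>

definition int_union :: "itype \<Rightarrow> itype \<Rightarrow> itype" where
  "int_union \<tau>1 \<tau>2 =
    (let k1 = irank \<tau>1; k2 = irank \<tau>2; k = (if rank_le k1 k2 then k2 else k1);
         mixed = (\<lambda>ks ku. if rank_le ks ku then IntType Unsigned ku
                    else if rank_size ku < rank_size ks then IntType Signed ks
                    else IntType Unsigned ks)
     in case (isign \<tau>1, isign \<tau>2) of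
          (Signed, Signed) \<Rightarrow> IntType Signed k
        | (Unsigned, Unsigned) \<Rightarrow> IntType Unsigned k
        | (Signed, Unsigned) \<Rightarrow> mixed k1 k2
        | (Unsigned, Signed) \<Rightarrow> mixed k2 k1)"

definition int_to_bits :: "itype \<Rightarrow> int \<Rightarrow> bool list" where
  "int_to_bits \<tau>i x = map (bit x) [0..<int_width \<tau>i]"

definition int_of_bits :: "itype \<Rightarrow> bool list \<Rightarrow> int" where
  "int_of_bits \<tau>i \<beta>s =
    (let x = horner_sum of_bool 2 \<beta>s
     in case isign \<tau>i of Signed \<Rightarrow> signed_take_bit (int_width \<tau>i - 1) x | Unsigned \<Rightarrow> x)"

datatype compop = EqOp | LtOp | LeOp
datatype arithop = PlusOp | MinusOp | MultOp | DivOp | ModOp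
datatype shiftop = ShiftLOp | ShiftROp
datatype bitop = AndOp | OrOp | XorOp
datatype binop = CompOp compop | ArithOp arithop | ShiftOp shiftop | BitOp bitop
datatype unop = NegOp | ComplOp | NotOp

definition int_cast_ok :: "itype \<Rightarrow> int \<Rightarrow> bool" where
  "int_cast_ok \<tau>i x \<longleftrightarrow> (case isign \<tau>i of Signed \<Rightarrow> int_typed x \<tau>i | Unsigned \<Rightarrow> True)"

definition int_cast :: "itype \<Rightarrow> int \<Rightarrow> int" where
  "int_cast \<tau>i x = (case isign \<tau>i of Signed \<Rightarrow> x | Unsigned \<Rightarrow> x mod int_upper \<tau>i)"

fun arith_exact :: "arithop \<Rightarrow> int \<Rightarrow> int \<Rightarrow> int" where
  "arith_exact PlusOp x y = x + y"
| "arith_exact MinusOp x y = x - y"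
| "arith_exact MultOp x y = x * y"
| "arith_exact DivOp x y = x sdiv y"
| "arith_exact ModOp x y = x smod y"

text \<open>The signed remainder is undefined when the quotient overflows.\<close>

definition int_pre_arithop_ok :: "arithop \<Rightarrow> int \<Rightarrow> int \<Rightarrow> itype \<Rightarrow> bool" where
  "int_pre_arithop_ok op x y \<tau>i \<longleftrightarrow>
    (op \<in> {DivOp, ModOp} \<longrightarrow> y \<noteq> 0) \<and>
    (isign \<tau>i = Signed \<longrightarrow> int_typed (arith_exact (if op = ModOp then DivOp else op) x y) \<tau>i)"

definition int_pre_arithop :: "arithop \<Rightarrow> int \<Rightarrow> int \<Rightarrow> itype \<Rightarrow> int" where
  "int_pre_arithop op x y \<tau>i =
    (case isign \<tau>i of Signed \<Rightarrow> arith_exact op x y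
     | Unsigned \<Rightarrow> arith_exact op x y mod int_upper \<tau>i)"

definition int_arithop_ok :: "arithop \<Rightarrow> int \<Rightarrow> itype \<Rightarrow> int \<Rightarrow> itype \<Rightarrow> bool" where
  "int_arithop_ok op x \<tau>1 y \<tau>2 \<longleftrightarrow>
    (let \<tau>i = int_union (int_promote \<tau>1) (int_promote \<tau>2)
     in int_pre_arithop_ok op (int_cast \<tau>i x) (int_cast \<tau>i y) \<tau>i)"

definition int_arithop :: "arithop \<Rightarrow> int \<Rightarrow> itype \<Rightarrow> int \<Rightarrow> itype \<Rightarrow> int" where
  "int_arithop op x \<tau>1 y \<tau>2 =
    (let \<tau>i = int_union (int_promote \<tau>1) (int_promote \<tau>2)
     in int_pre_arithop op (int_cast \<tau>i x) (int_cast \<tau>i y) \<tau>i)"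

definition int_shiftop_ok :: "shiftop \<Rightarrow> int \<Rightarrow> itype \<Rightarrow> int \<Rightarrow> itype \<Rightarrow> bool" where
  "int_shiftop_ok op x \<tau>1 y \<tau>2 \<longleftrightarrow>
    (let \<tau>i = int_promote \<tau>1
     in 0 \<le> y \<and> y < int (int_width \<tau>i) \<and>
        (isign \<tau>i = Signed \<longrightarrow> 0 \<le> x \<and> (op = ShiftLOp \<longrightarrow> x * 2 ^ nat y < int_upper \<tau>i)))"

definition int_shiftop :: "shiftop \<Rightarrow> int \<Rightarrow> itype \<Rightarrow> int \<Rightarrow> itype \<Rightarrow> int" where
  "int_shiftop op x \<tau>1 y \<tau>2 =
    (let \<tau>i = int_promote \<tau>1
     in case op of ShiftLOp \<Rightarrow> int_cast \<tau>i (x * 2 ^ nat y) | ShiftROp \<Rightarrow> x div 2 ^ nat y)"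

fun compop_sem :: "compop \<Rightarrow> int \<Rightarrow> int \<Rightarrow> bool" where
  "compop_sem EqOp x y \<longleftrightarrow> x = y"
| "compop_sem LtOp x y \<longleftrightarrow> x < y"
| "compop_sem LeOp x y \<longleftrightarrow> x \<le> y"

fun bitop_sem :: "bitop \<Rightarrow> bool \<Rightarrow> bool \<Rightarrow> bool" where
  "bitop_sem AndOp a b \<longleftrightarrow> a \<and> b"
| "bitop_sem OrOp a b \<longleftrightarrow> a \<or> b"
| "bitop_sem XorOp a b \<longleftrightarrow> a \<noteq> b"


section \<open>Sizes and layout\<close>

text \<open>
  Recursion through compound types is bounded by fuel; for valid environments the number of
  declared compound types suffices.
\<close>

definition env_fuel :: "env \<Rightarrow> nat" where
  "env_fuel \<Gamma> = Suc (card (fmdom' (env_c \<Gamma>)))"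

definition the_fields :: "env \<Rightarrow> tag \<Rightarrow> ctype list" where
  "the_fields \<Gamma> t = (case fields \<Gamma> t of Some \<tau>s \<Rightarrow> \<tau>s | None \<Rightarrow> [])"

fun base_size :: "btype \<Rightarrow> nat" where
  "base_size TVoid = 1"
| "base_size (TInt \<tau>i) = rank_size (irank \<tau>i)"
| "base_size (TPtr \<tau>p) = rank_size PtrRank"

fun align_of_fuel :: "env \<Rightarrow> nat \<Rightarrow> ctype \<Rightarrow> nat" where
  "align_of_fuel \<Gamma> k (TBase \<tau>b) = base_size \<tau>b"
| "align_of_fuel \<Gamma> k (TArray \<tau> n) = align_of_fuel \<Gamma> k \<tau>"
| "align_of_fuel \<Gamma> 0 (TCompound c t) = 1"
| "align_of_fuel \<Gamma> (Suc k) (TCompound c t) = foldr lcm (map (align_of_fuel \<Gamma> k) (the_fields \<Gamma> t)) 1"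

definition padding :: "nat \<Rightarrow> nat \<Rightarrow> nat" where
  "padding pos al = (if pos mod al = 0 then 0 else al - pos mod al)"

text \<open>
  Field sizes include the padding up to the next field (for the last field, up to the end of the
  struct); the list consists of the sizes and alignments of the fields.
\<close>

fun natural_field_sizes :: "nat \<Rightarrow> nat \<Rightarrow> (nat \<times> nat) list \<Rightarrow> nat list" where
  "natural_field_sizes al pos [] = []"
| "natural_field_sizes al pos [(sz, _)] = [sz + padding (pos + sz) al]"
| "natural_field_sizes al pos ((sz, _) # (sz', al') # fs) =
    (let psz = sz + padding (pos + sz) al'
     in psz # natural_field_sizes al (pos + psz) ((sz', al') # fs))"

fun size_of_fuel :: "env \<Rightarrow> nat \<Rightarrow> ctype \<Rightarrow> nat" where
  "size_of_fuel \<Gamma> k (TBase \<tau>b) = base_size \<tau>b"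
| "size_of_fuel \<Gamma> k (TArray \<tau> n) = n * size_of_fuel \<Gamma> k \<tau>"
| "size_of_fuel \<Gamma> 0 (TCompound c t) = 0"
| "size_of_fuel \<Gamma> (Suc k) (TCompound c t) =
    (let al = align_of_fuel \<Gamma> (Suc k) (TCompound c t);
         fs = map (\<lambda>\<tau>. (size_of_fuel \<Gamma> k \<tau>, align_of_fuel \<Gamma> k \<tau>)) (the_fields \<Gamma> t);
         sz = foldr max (map fst fs) 0
     in case c of Struct_kind \<Rightarrow> sum_list (natural_field_sizes al 0 fs)
        | Union_kind \<Rightarrow> sz + padding sz al)"

definition align_of :: "env \<Rightarrow> ctype \<Rightarrow> nat" where
  "align_of \<Gamma> = align_of_fuel \<Gamma> (env_fuel \<Gamma>)"

definition size_of :: "env \<Rightarrow> ctype \<Rightarrow> nat" where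
  "size_of \<Gamma> = size_of_fuel \<Gamma> (env_fuel \<Gamma>)"

definition bit_size_of :: "env \<Rightarrow> ctype \<Rightarrow> nat" where
  "bit_size_of \<Gamma> \<tau> = size_of \<Gamma> \<tau> * char_bits"

definition ptr_size_of :: "env \<Rightarrow> ptype \<Rightarrow> nat" where
  "ptr_size_of \<Gamma> \<tau>p = (case \<tau>p of TType \<tau> \<Rightarrow> size_of \<Gamma> \<tau> | _ \<Rightarrow> 1)"

definition field_bit_sizes :: "env \<Rightarrow> ctype list \<Rightarrow> nat list" where
  "field_bit_sizes \<Gamma> \<tau>s =
    map (\<lambda>n. n * char_bits)
      (natural_field_sizes (foldr lcm (map (align_of \<Gamma>) \<tau>s) 1) 0
        (map (\<lambda>\<tau>. (size_of \<Gamma> \<tau>, align_of \<Gamma> \<tau>)) \<tau>s))"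

definition field_bit_padding :: "env \<Rightarrow> ctype list \<Rightarrow> nat list" where
  "field_bit_padding \<Gamma> \<tau>s = map2 (\<lambda>sz \<tau>. sz - bit_size_of \<Gamma> \<tau>) (field_bit_sizes \<Gamma> \<tau>s) \<tau>s"

definition bit_offset_of :: "env \<Rightarrow> ctype list \<Rightarrow> nat \<Rightarrow> nat" where
  "bit_offset_of \<Gamma> \<tau>s i = sum_list (take i (field_bit_sizes \<Gamma> \<tau>s))"


section \<open>References, addresses and pointers\<close>

text \<open>
  The flag of a union segment is \<open>False\<close> if the reference may be used for type punning; freezing a
  reference sets all its flags.  References are stored with the innermost segment first.
\<close>

datatype ref_seg = RArray nat ctype nat | RStruct nat tag | RUnion nat tag bool

type_synonym cref = "ref_seg list"

fun type_lookup_seg :: "env \<Rightarrow> ref_seg \<Rightarrow> ctype \<Rightarrow> ctype option" where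
  "type_lookup_seg \<Gamma> (RArray i \<tau> n) \<sigma> = (if \<sigma> = TArray \<tau> n \<and> i < n then Some \<tau> else None)"
| "type_lookup_seg \<Gamma> (RStruct i t) \<sigma> =
    (let \<tau>s = the_fields \<Gamma> t
     in if \<sigma> = TCompound Struct_kind t \<and> i < length \<tau>s then Some (\<tau>s ! i) else None)"
| "type_lookup_seg \<Gamma> (RUnion i t q) \<sigma> =
    (let \<tau>s = the_fields \<Gamma> t
     in if \<sigma> = TCompound Union_kind t \<and> i < length \<tau>s then Some (\<tau>s ! i) else None)"

fun type_lookup :: "env \<Rightarrow> cref \<Rightarrow> ctype \<Rightarrow> ctype option" where
  "type_lookup \<Gamma> [] \<tau> = Some \<tau>"
| "type_lookup \<Gamma> (rs # r) \<tau> = Option.bind (type_lookup \<Gamma> r \<tau>) (type_lookup_seg \<Gamma> rs)"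

fun freeze_seg :: "bool \<Rightarrow> ref_seg \<Rightarrow> ref_seg" where
  "freeze_seg q (RArray i \<tau> n) = RArray i \<tau> n"
| "freeze_seg q (RStruct i t) = RStruct i t"
| "freeze_seg q (RUnion i t q') = RUnion i t q"

fun ref_set_offset :: "nat \<Rightarrow> cref \<Rightarrow> cref" where
  "ref_set_offset i (RArray j \<tau> n # r) = RArray i \<tau> n # r"
| "ref_set_offset i r = r"

fun ref_offset :: "cref \<Rightarrow> nat" where
  "ref_offset (RArray i \<tau> n # r) = i"
| "ref_offset r = 0"

fun ref_size :: "cref \<Rightarrow> nat" where
  "ref_size (RArray i \<tau> n # r) = n"
| "ref_size r = 1"

fun ref_seg_object_offset :: "env \<Rightarrow> ref_seg \<Rightarrow> nat" where
  "ref_seg_object_offset \<Gamma> (RArray i \<tau> n) = i * bit_size_of \<Gamma> \<tau>"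
| "ref_seg_object_offset \<Gamma> (RStruct i t) = bit_offset_of \<Gamma> (the_fields \<Gamma> t) i"
| "ref_seg_object_offset \<Gamma> (RUnion i t q) = 0"

definition ref_object_offset :: "env \<Rightarrow> cref \<Rightarrow> nat" where
  "ref_object_offset \<Gamma> r = sum_list (map (ref_seg_object_offset \<Gamma>) r)"

text \<open>
  In an address, the reference leads to the first element of the innermost array (or to a
  non-array subobject), and the byte offset is relative to that element.  The three types are
  those of the entire object, of the referenced subobject, and of the address itself; the last
  two differ for pointers to bytes and for void pointers.
\<close>

datatype addr = Addr (addr_index: index) (addr_ref_base: cref) (addr_byte: nat)
  (addr_type_object: ctype) (addr_type_base: ctype) (addr_type: ptype)

datatype ptr = NULL ptype | Ptr addr | FunPtr funname "ctype list" ctype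

type_synonym memenv = "(index, ctype \<times> bool) fmap"

definition memenv_alive :: "memenv \<Rightarrow> index \<Rightarrow> bool" where
  "memenv_alive \<Delta> x \<longleftrightarrow> (\<exists>\<tau>. fmlookup \<Delta> x = Some (\<tau>, False))"

definition castable :: "ctype \<Rightarrow> ptype \<Rightarrow> bool" where
  "castable \<tau> \<sigma>p \<longleftrightarrow> \<sigma>p \<in> {TAny, TType uchar, TType \<tau>}"

definition addr_typed :: "env \<Rightarrow> memenv \<Rightarrow> addr \<Rightarrow> ptype \<Rightarrow> bool" where
  "addr_typed \<Gamma> \<Delta> a \<sigma>p \<longleftrightarrow>
    (\<exists>x r i \<tau> \<sigma> \<beta>. a = Addr x r i \<tau> \<sigma> \<sigma>p \<and> fmlookup \<Delta> x = Some (\<tau>, \<beta>) \<and> ctype_valid \<Gamma> \<tau> \<and>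
      type_lookup \<Gamma> r \<tau> = Some \<sigma> \<and> ref_offset r = 0 \<and> i \<le> size_of \<Gamma> \<sigma> * ref_size r \<and>
      ptr_size_of \<Gamma> \<sigma>p dvd i \<and> castable \<sigma> \<sigma>p)"

definition addr_strict :: "env \<Rightarrow> addr \<Rightarrow> bool" where
  "addr_strict \<Gamma> a \<longleftrightarrow> addr_byte a < size_of \<Gamma> (addr_type_base a) * ref_size (addr_ref_base a)"

definition addr_is_obj :: "addr \<Rightarrow> bool" where
  "addr_is_obj a \<longleftrightarrow> addr_type a = TType (addr_type_base a)"

definition addr_ref :: "env \<Rightarrow> addr \<Rightarrow> cref" where
  "addr_ref \<Gamma> a = ref_set_offset (addr_byte a div size_of \<Gamma> (addr_type_base a)) (addr_ref_base a)"

definition addr_ref_byte :: "env \<Rightarrow> addr \<Rightarrow> nat" where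
  "addr_ref_byte \<Gamma> a = addr_byte a mod size_of \<Gamma> (addr_type_base a)"

definition addr_object_offset :: "env \<Rightarrow> addr \<Rightarrow> nat" where
  "addr_object_offset \<Gamma> a = ref_object_offset \<Gamma> (addr_ref_base a) + addr_byte a * char_bits"

definition addr_top :: "index \<Rightarrow> ctype \<Rightarrow> addr" where
  "addr_top x \<tau> = Addr x [] 0 \<tau> \<tau> (TType \<tau>)"

definition addr_top_array :: "index \<Rightarrow> ctype \<Rightarrow> nat \<Rightarrow> addr" where
  "addr_top_array x \<tau> n = Addr x [RArray 0 \<tau> n] 0 (TArray \<tau> n) \<tau> (TType \<tau>)"

definition addr_elt :: "env \<Rightarrow> ref_seg \<Rightarrow> addr \<Rightarrow> addr" where
  "addr_elt \<Gamma> rs a =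
    (case type_lookup_seg \<Gamma> rs (addr_type_base a) of
       None \<Rightarrow> a
     | Some \<sigma> \<Rightarrow>
         Addr (addr_index a) (ref_set_offset 0 (rs # addr_ref \<Gamma> a)) (ref_offset [rs] * size_of \<Gamma> \<sigma>)
           (addr_type_object a) \<sigma> (TType \<sigma>))"

definition addr_plus :: "env \<Rightarrow> int \<Rightarrow> addr \<Rightarrow> addr" where
  "addr_plus \<Gamma> j a =
    (case a of Addr x r i \<tau> \<sigma> \<sigma>p \<Rightarrow> Addr x r (nat (int i + j * int (ptr_size_of \<Gamma> \<sigma>p))) \<tau> \<sigma> \<sigma>p)"

definition addr_minus :: "env \<Rightarrow> addr \<Rightarrow> addr \<Rightarrow> int" where
  "addr_minus \<Gamma> a1 a2 = (int (addr_byte a1) - int (addr_byte a2)) div int (ptr_size_of \<Gamma> (addr_type a1))"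

definition addr_cast :: "ptype \<Rightarrow> addr \<Rightarrow> addr" where
  "addr_cast \<sigma>p a = (case a of Addr x r i \<tau> \<sigma> _ \<Rightarrow> Addr x r i \<tau> \<sigma> \<sigma>p)"

definition freeze_addr :: "bool \<Rightarrow> addr \<Rightarrow> addr" where
  "freeze_addr q a = (case a of Addr x r i \<tau> \<sigma> \<sigma>p \<Rightarrow> Addr x (map (freeze_seg q) r) i \<tau> \<sigma> \<sigma>p)"

fun freeze_ptr :: "bool \<Rightarrow> ptr \<Rightarrow> ptr" where
  "freeze_ptr q (Ptr a) = Ptr (freeze_addr q a)"
| "freeze_ptr q (NULL \<tau>p) = NULL \<tau>p"
| "freeze_ptr q (FunPtr f \<tau>s \<tau>) = FunPtr f \<tau>s \<tau>"

fun ptr_type :: "ptr \<Rightarrow> ptype" where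
  "ptr_type (NULL \<tau>p) = \<tau>p"
| "ptr_type (Ptr a) = addr_type a"
| "ptr_type (FunPtr f \<tau>s \<tau>) = TFun \<tau>s \<tau>"

fun ptr_typed :: "env \<Rightarrow> memenv \<Rightarrow> ptr \<Rightarrow> ptype \<Rightarrow> bool" where
  "ptr_typed \<Gamma> \<Delta> (NULL \<tau>p) \<sigma>p \<longleftrightarrow> \<sigma>p = \<tau>p \<and> ptype_valid \<Gamma> \<tau>p"
| "ptr_typed \<Gamma> \<Delta> (Ptr a) \<sigma>p \<longleftrightarrow> addr_typed \<Gamma> \<Delta> a \<sigma>p"
| "ptr_typed \<Gamma> \<Delta> (FunPtr f \<tau>s \<tau>) \<sigma>p \<longleftrightarrow> \<sigma>p = TFun \<tau>s \<tau> \<and> fmlookup (env_f \<Gamma>) f = Some (\<tau>s, \<tau>)"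


section \<open>Bits and values\<close>

datatype bit = BIndet | BBit bool | BPtr ptr nat

datatype base_val = VIndet btype | VVoid | VInt itype int | VPtr ptr | VByte "bit list"

datatype cval = VBase base_val | VArray ctype "cval list" | VStruct tag "cval list"
  | VUnion tag nat cval | VUnionAll tag "cval list"

abbreviation intV :: "itype \<Rightarrow> int \<Rightarrow> cval" where "intV \<tau>i x \<equiv> VBase (VInt \<tau>i x)"
abbreviation ptrV :: "ptr \<Rightarrow> cval" where "ptrV p \<equiv> VBase (VPtr p)"
abbreviation voidV :: cval where "voidV \<equiv> VBase VVoid"

fun base_val_type :: "base_val \<Rightarrow> btype" where
  "base_val_type (VIndet \<tau>b) = \<tau>b"
| "base_val_type VVoid = TVoid"
| "base_val_type (VInt \<tau>i x) = TInt \<tau>i"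
| "base_val_type (VPtr p) = TPtr (ptr_type p)"
| "base_val_type (VByte bs) = TInt uchar_it"

fun val_type :: "cval \<Rightarrow> ctype" where
  "val_type (VBase vb) = TBase (base_val_type vb)"
| "val_type (VArray \<tau> vs) = TArray \<tau> (length vs)"
| "val_type (VStruct t vs) = TCompound Struct_kind t"
| "val_type (VUnion t i v) = TCompound Union_kind t"
| "val_type (VUnionAll t vs) = TCompound Union_kind t"

definition ptr_to_bits :: "env \<Rightarrow> ptr \<Rightarrow> bit list" where
  "ptr_to_bits \<Gamma> p = map (BPtr (freeze_ptr True p)) [0..<bit_size_of \<Gamma> (TBase (TPtr (ptr_type p)))]"

definition ptr_of_bits :: "env \<Rightarrow> ptype \<Rightarrow> bit list \<Rightarrow> ptr option" where
  "ptr_of_bits \<Gamma> \<tau>p bs =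
    (case bs of BPtr p _ # _ \<Rightarrow> if ptr_type p = \<tau>p \<and> bs = ptr_to_bits \<Gamma> p then Some p else None
     | _ \<Rightarrow> None)"

fun base_val_flatten :: "env \<Rightarrow> base_val \<Rightarrow> bit list" where
  "base_val_flatten \<Gamma> (VIndet \<tau>b) = replicate (bit_size_of \<Gamma> (TBase \<tau>b)) BIndet"
| "base_val_flatten \<Gamma> VVoid = replicate (bit_size_of \<Gamma> voidT) BIndet"
| "base_val_flatten \<Gamma> (VInt \<tau>i x) = map BBit (int_to_bits \<tau>i x)"
| "base_val_flatten \<Gamma> (VPtr p) = ptr_to_bits \<Gamma> p"
| "base_val_flatten \<Gamma> (VByte bs) = bs"

definition is_BBit :: "bit \<Rightarrow> bool" where
  "is_BBit b \<longleftrightarrow> (case b of BBit _ \<Rightarrow> True | _ \<Rightarrow> False)"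

fun base_val_unflatten :: "env \<Rightarrow> btype \<Rightarrow> bit list \<Rightarrow> base_val" where
  "base_val_unflatten \<Gamma> TVoid bs = VVoid"
| "base_val_unflatten \<Gamma> (TInt \<tau>i) bs =
    (if list_all is_BBit bs then VInt \<tau>i (int_of_bits \<tau>i (map (\<lambda>b. b = BBit True) bs))
     else if \<tau>i = uchar_it \<and> \<not> list_all ((=) BIndet) bs then VByte bs
     else VIndet (TInt \<tau>i))"
| "base_val_unflatten \<Gamma> (TPtr \<tau>p) bs =
    (case ptr_of_bits \<Gamma> \<tau>p bs of Some p \<Rightarrow> VPtr p | None \<Rightarrow> VIndet (TPtr \<tau>p))"

definition resize_bits :: "nat \<Rightarrow> bit list \<Rightarrow> bit list" where
  "resize_bits n bs = take n bs @ replicate (n - length bs) BIndet"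

definition sublist :: "nat \<Rightarrow> nat \<Rightarrow> 'a list \<Rightarrow> 'a list" where
  "sublist i n xs = take n (drop i xs)"

fun val_unflatten_fuel :: "env \<Rightarrow> nat \<Rightarrow> ctype \<Rightarrow> bit list \<Rightarrow> cval" where
  "val_unflatten_fuel \<Gamma> k (TBase \<tau>b) bs = VBase (base_val_unflatten \<Gamma> \<tau>b bs)"
| "val_unflatten_fuel \<Gamma> k (TArray \<tau> n) bs =
    (let sz = bit_size_of \<Gamma> \<tau>
     in VArray \<tau> (map (\<lambda>i. val_unflatten_fuel \<Gamma> k \<tau> (sublist (i * sz) sz bs)) [0..<n]))"
| "val_unflatten_fuel \<Gamma> 0 (TCompound c t) bs = VUnionAll t []"
| "val_unflatten_fuel \<Gamma> (Suc k) (TCompound c t) bs =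
    (let \<tau>s = the_fields \<Gamma> t
     in case c of
          Struct_kind \<Rightarrow>
            VStruct t (map (\<lambda>i. val_unflatten_fuel \<Gamma> k (\<tau>s ! i)
              (sublist (bit_offset_of \<Gamma> \<tau>s i) (bit_size_of \<Gamma> (\<tau>s ! i)) bs)) [0..<length \<tau>s])
        | Union_kind \<Rightarrow>
            VUnionAll t (map (\<lambda>\<tau>. val_unflatten_fuel \<Gamma> k \<tau> (take (bit_size_of \<Gamma> \<tau>) bs)) \<tau>s))"

definition val_unflatten :: "env \<Rightarrow> ctype \<Rightarrow> bit list \<Rightarrow> cval" where
  "val_unflatten \<Gamma> = val_unflatten_fuel \<Gamma> (env_fuel \<Gamma>)"

fun bit_join :: "bit \<Rightarrow> bit \<Rightarrow> bit option" where
  "bit_join BIndet b = Some b"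
| "bit_join b BIndet = Some b"
| "bit_join b b' = (if b = b' then Some b else None)"

definition bits_join :: "bit list \<Rightarrow> bit list \<Rightarrow> bit list option" where
  "bits_join bs bs' = those (map2 bit_join bs bs')"

definition bits_list_join :: "nat \<Rightarrow> bit list list \<Rightarrow> bit list option" where
  "bits_list_join n bss =
    foldr (\<lambda>bs acc. Option.bind acc (bits_join (resize_bits n bs))) bss (Some (replicate n BIndet))"

fun val_flatten :: "env \<Rightarrow> cval \<Rightarrow> bit list" where
  "val_flatten \<Gamma> (VBase vb) = base_val_flatten \<Gamma> vb"
| "val_flatten \<Gamma> (VArray \<tau> vs) = concat (map (val_flatten \<Gamma>) vs)"
| "val_flatten \<Gamma> (VStruct t vs) =
    concat (map2 resize_bits (field_bit_sizes \<Gamma> (the_fields \<Gamma> t)) (map (val_flatten \<Gamma>) vs))"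
| "val_flatten \<Gamma> (VUnion t i v) =
    resize_bits (bit_size_of \<Gamma> (TCompound Union_kind t)) (val_flatten \<Gamma> v)"
| "val_flatten \<Gamma> (VUnionAll t vs) =
    (case bits_list_join (bit_size_of \<Gamma> (TCompound Union_kind t)) (map (val_flatten \<Gamma>) vs) of
       Some bs \<Rightarrow> bs | None \<Rightarrow> [])"

fun val_new_fuel :: "env \<Rightarrow> nat \<Rightarrow> ctype \<Rightarrow> cval" where
  "val_new_fuel \<Gamma> k (TBase \<tau>b) = VBase (if \<tau>b = TVoid then VVoid else VIndet \<tau>b)"
| "val_new_fuel \<Gamma> k (TArray \<tau> n) = VArray \<tau> (replicate n (val_new_fuel \<Gamma> k \<tau>))"
| "val_new_fuel \<Gamma> 0 (TCompound c t) = VUnionAll t []"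
| "val_new_fuel \<Gamma> (Suc k) (TCompound c t) =
    (case c of Struct_kind \<Rightarrow> VStruct t (map (val_new_fuel \<Gamma> k) (the_fields \<Gamma> t))
     | Union_kind \<Rightarrow> VUnionAll t (map (val_new_fuel \<Gamma> k) (the_fields \<Gamma> t)))"

definition val_new :: "env \<Rightarrow> ctype \<Rightarrow> cval" where
  "val_new \<Gamma> = val_new_fuel \<Gamma> (env_fuel \<Gamma>)"

fun bit_valid :: "env \<Rightarrow> memenv \<Rightarrow> bit \<Rightarrow> bool" where
  "bit_valid \<Gamma> \<Delta> BIndet \<longleftrightarrow> True"
| "bit_valid \<Gamma> \<Delta> (BBit \<beta>) \<longleftrightarrow> True"
| "bit_valid \<Gamma> \<Delta> (BPtr p i) \<longleftrightarrow> (\<exists>\<tau>p. ptr_typed \<Gamma> \<Delta> p \<tau>p \<and> freeze_ptr True p = p \<and>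
    i < bit_size_of \<Gamma> (TBase (TPtr \<tau>p)))"

fun base_val_typed :: "env \<Rightarrow> memenv \<Rightarrow> base_val \<Rightarrow> btype \<Rightarrow> bool" where
  "base_val_typed \<Gamma> \<Delta> (VIndet \<tau>b) \<sigma>b \<longleftrightarrow> \<sigma>b = \<tau>b \<and> btype_valid \<Gamma> \<tau>b \<and> \<tau>b \<noteq> TVoid"
| "base_val_typed \<Gamma> \<Delta> VVoid \<sigma>b \<longleftrightarrow> \<sigma>b = TVoid"
| "base_val_typed \<Gamma> \<Delta> (VInt \<tau>i x) \<sigma>b \<longleftrightarrow> \<sigma>b = TInt \<tau>i \<and> int_typed x \<tau>i"
| "base_val_typed \<Gamma> \<Delta> (VPtr p) \<sigma>b \<longleftrightarrow> (\<exists>\<tau>p. \<sigma>b = TPtr \<tau>p \<and> ptr_typed \<Gamma> \<Delta> p \<tau>p)"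
| "base_val_typed \<Gamma> \<Delta> (VByte bs) \<sigma>b \<longleftrightarrow> \<sigma>b = TInt uchar_it \<and> length bs = char_bits \<and>
    list_all (bit_valid \<Gamma> \<Delta>) bs \<and> \<not> list_all ((=) BIndet) bs \<and> \<not> list_all is_BBit bs"

inductive val_typed :: "env \<Rightarrow> memenv \<Rightarrow> cval \<Rightarrow> ctype \<Rightarrow> bool" for \<Gamma> \<Delta> where
  VBase_typed: "base_val_typed \<Gamma> \<Delta> vb \<tau>b \<Longrightarrow> val_typed \<Gamma> \<Delta> (VBase vb) (TBase \<tau>b)"
| VArray_typed: "(\<And>v. v \<in> set vs \<Longrightarrow> val_typed \<Gamma> \<Delta> v \<tau>) \<Longrightarrow> n = length vs \<Longrightarrow> n \<noteq> 0 \<Longrightarrow>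
    val_typed \<Gamma> \<Delta> (VArray \<tau> vs) (TArray \<tau> n)"
| VStruct_typed: "fields \<Gamma> t = Some \<tau>s \<Longrightarrow> length vs = length \<tau>s \<Longrightarrow>
    (\<And>i. i < length \<tau>s \<Longrightarrow> val_typed \<Gamma> \<Delta> (vs ! i) (\<tau>s ! i)) \<Longrightarrow>
    val_typed \<Gamma> \<Delta> (VStruct t vs) (TCompound Struct_kind t)"
| VUnion_typed: "fields \<Gamma> t = Some \<tau>s \<Longrightarrow> i < length \<tau>s \<Longrightarrow> val_typed \<Gamma> \<Delta> v (\<tau>s ! i) \<Longrightarrow>
    val_typed \<Gamma> \<Delta> (VUnion t i v) (TCompound Union_kind t)"
| VUnionAll_typed: "fields \<Gamma> t = Some \<tau>s \<Longrightarrow> length vs = length \<tau>s \<Longrightarrow>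
    (\<And>i. i < length \<tau>s \<Longrightarrow> val_typed \<Gamma> \<Delta> (vs ! i) (\<tau>s ! i)) \<Longrightarrow>
    list_all (bit_valid \<Gamma> \<Delta>) bs \<Longrightarrow> length bs = bit_size_of \<Gamma> (TCompound Union_kind t) \<Longrightarrow>
    vs = map (\<lambda>\<tau>. val_unflatten \<Gamma> \<tau> (take (bit_size_of \<Gamma> \<tau>) bs)) \<tau>s \<Longrightarrow>
    val_typed \<Gamma> \<Delta> (VUnionAll t vs) (TCompound Union_kind t)"

definition val_lookup_seg :: "env \<Rightarrow> ref_seg \<Rightarrow> cval \<Rightarrow> cval option" where
  "val_lookup_seg \<Gamma> rs v =
    (case (rs, v) of
       (RArray i \<tau> n, VArray \<tau>' vs) \<Rightarrow>
         if n = length vs \<and> \<tau> = \<tau>' \<and> i < length vs then Some (vs ! i) else None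
     | (RStruct i t, VStruct t' vs) \<Rightarrow> if t = t' \<and> i < length vs then Some (vs ! i) else None
     | (RUnion i t q, VUnion t' j w) \<Rightarrow>
         if t \<noteq> t' then None
         else if i = j then Some w
         else if \<not> q \<and> i < length (the_fields \<Gamma> t) then
           (let \<tau> = the_fields \<Gamma> t ! i
            in Some (val_unflatten \<Gamma> \<tau> (resize_bits (bit_size_of \<Gamma> \<tau>) (val_flatten \<Gamma> w))))
         else None
     | (RUnion i t q, VUnionAll t' vs) \<Rightarrow> if t = t' \<and> i < length vs then Some (vs ! i) else None
     | _ \<Rightarrow> None)"

fun val_lookup :: "env \<Rightarrow> cref \<Rightarrow> cval \<Rightarrow> cval option" where
  "val_lookup \<Gamma> [] v = Some v"
| "val_lookup \<Gamma> (rs # r) v = Option.bind (val_lookup \<Gamma> r v) (val_lookup_seg \<Gamma> rs)"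

definition alter_nth :: "('a \<Rightarrow> 'a) \<Rightarrow> nat \<Rightarrow> 'a list \<Rightarrow> 'a list" where
  "alter_nth g i xs = (if i < length xs then xs[i := g (xs ! i)] else xs)"

definition val_alter_seg :: "env \<Rightarrow> (cval \<Rightarrow> cval) \<Rightarrow> ref_seg \<Rightarrow> cval \<Rightarrow> cval" where
  "val_alter_seg \<Gamma> g rs v =
    (case (rs, v) of
       (RArray i _ _, VArray \<tau> vs) \<Rightarrow> VArray \<tau> (alter_nth g i vs)
     | (RStruct i _, VStruct t vs) \<Rightarrow> VStruct t (alter_nth g i vs)
     | (RUnion i _ _, VUnion t j w) \<Rightarrow>
         if i = j then VUnion t i (g w)
         else if i < length (the_fields \<Gamma> t) then
           (let \<tau> = the_fields \<Gamma> t ! i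
            in VUnion t i (g (val_unflatten \<Gamma> \<tau> (resize_bits (bit_size_of \<Gamma> \<tau>) (val_flatten \<Gamma> w)))))
         else v
     | (RUnion i _ _, VUnionAll t vs) \<Rightarrow> if i < length vs then VUnion t i (g (vs ! i)) else v
     | _ \<Rightarrow> v)"

fun val_alter :: "env \<Rightarrow> (cval \<Rightarrow> cval) \<Rightarrow> cref \<Rightarrow> cval \<Rightarrow> cval" where
  "val_alter \<Gamma> g [] = g"
| "val_alter \<Gamma> g (rs # r) = val_alter \<Gamma> (val_alter_seg \<Gamma> g rs) r"


section \<open>Permissions and memory\<close>

text \<open>
  The permission algebra of CH2O: a lockable pair of a counter and a fraction, or a fraction of a
  read-only permission.
\<close>

datatype perm = PUnlocked rat rat | PLocked rat rat | PReadOnly rat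

datatype pkind = Existing | Locked | Readable | Writable

fun perm_kind :: "perm \<Rightarrow> pkind option" where
  "perm_kind (PUnlocked c x) =
    (if x = 0 then (if c = 0 then None else Some Existing)
     else if x = 1 then Some Writable else Some Readable)"
| "perm_kind (PLocked c x) = Some Locked"
| "perm_kind (PReadOnly x) = (if x = 0 then None else Some Readable)"

fun perm_unshared :: "perm \<Rightarrow> bool" where
  "perm_unshared (PUnlocked c x) \<longleftrightarrow> x = 1"
| "perm_unshared (PLocked c x) \<longleftrightarrow> True"
| "perm_unshared (PReadOnly x) \<longleftrightarrow> x = 1"

fun perm_lock :: "perm \<Rightarrow> perm" where
  "perm_lock (PUnlocked c x) = PLocked c x"
| "perm_lock \<gamma> = \<gamma>"

fun perm_unlock :: "perm \<Rightarrow> perm" where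
  "perm_unlock (PLocked c x) = PUnlocked c x"
| "perm_unlock \<gamma> = \<gamma>"

definition perm_full :: perm where "perm_full = PUnlocked 0 1"

datatype pbit = PBit (pbit_perm: perm) (pbit_bit: bit)

definition pbit_readable :: "pbit \<Rightarrow> bool" where
  "pbit_readable xb \<longleftrightarrow> perm_kind (pbit_perm xb) \<in> {Some Readable, Some Writable}"

definition pbit_writable :: "pbit \<Rightarrow> bool" where
  "pbit_writable xb \<longleftrightarrow> perm_kind (pbit_perm xb) = Some Writable"

definition pbit_unshared :: "pbit \<Rightarrow> bool" where
  "pbit_unshared xb \<longleftrightarrow> perm_unshared (pbit_perm xb)"

definition pbit_indetify :: "pbit \<Rightarrow> pbit" where
  "pbit_indetify xb = PBit (pbit_perm xb) BIndet"

definition pbit_lock :: "pbit \<Rightarrow> pbit" where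
  "pbit_lock xb = PBit (perm_lock (pbit_perm xb)) (pbit_bit xb)"

definition pbit_unlock :: "pbit \<Rightarrow> pbit" where
  "pbit_unlock xb = PBit (perm_unlock (pbit_perm xb)) (pbit_bit xb)"

text \<open>
  The bit list next to a struct field or a union variant is its padding.  A union is tagged with
  its current variant; MUnionAll is a union whose variant is not determined.
\<close>

datatype mtree = MBase btype "pbit list" | MArray ctype "mtree list"
  | MStruct tag "(mtree \<times> pbit list) list"
  | MUnion tag nat mtree "pbit list" | MUnionAll tag "pbit list"

fun mtree_type :: "mtree \<Rightarrow> ctype" where
  "mtree_type (MBase \<tau>b xbs) = TBase \<tau>b"
| "mtree_type (MArray \<tau> ws) = TArray \<tau> (length ws)"
| "mtree_type (MStruct t wxbss) = TCompound Struct_kind t"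
| "mtree_type (MUnion t i w xbs) = TCompound Union_kind t"
| "mtree_type (MUnionAll t xbs) = TCompound Union_kind t"

fun mtree_flatten :: "mtree \<Rightarrow> pbit list" where
  "mtree_flatten (MBase \<tau>b xbs) = xbs"
| "mtree_flatten (MArray \<tau> ws) = concat (map mtree_flatten ws)"
| "mtree_flatten (MStruct t wxbss) = concat (map (\<lambda>(w, xbs). mtree_flatten w @ xbs) wxbss)"
| "mtree_flatten (MUnion t i w xbs) = mtree_flatten w @ xbs"
| "mtree_flatten (MUnionAll t xbs) = xbs"

fun mtree_unflatten_fuel :: "env \<Rightarrow> nat \<Rightarrow> ctype \<Rightarrow> pbit list \<Rightarrow> mtree" where
  "mtree_unflatten_fuel \<Gamma> k (TBase \<tau>b) xbs = MBase \<tau>b xbs"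
| "mtree_unflatten_fuel \<Gamma> k (TArray \<tau> n) xbs =
    (let sz = bit_size_of \<Gamma> \<tau>
     in MArray \<tau> (map (\<lambda>i. mtree_unflatten_fuel \<Gamma> k \<tau> (sublist (i * sz) sz xbs)) [0..<n]))"
| "mtree_unflatten_fuel \<Gamma> 0 (TCompound c t) xbs = MUnionAll t xbs"
| "mtree_unflatten_fuel \<Gamma> (Suc k) (TCompound c t) xbs =
    (let \<tau>s = the_fields \<Gamma> t; szs = field_bit_sizes \<Gamma> \<tau>s
     in case c of
          Struct_kind \<Rightarrow>
            MStruct t (map (\<lambda>i.
              let \<tau> = \<tau>s ! i; ys = sublist (bit_offset_of \<Gamma> \<tau>s i) (szs ! i) xbs; sz = bit_size_of \<Gamma> \<tau>
              in (mtree_unflatten_fuel \<Gamma> k \<tau> (take sz ys), map pbit_indetify (drop sz ys)))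
              [0..<length \<tau>s])
        | Union_kind \<Rightarrow> MUnionAll t xbs)"

definition mtree_unflatten :: "env \<Rightarrow> ctype \<Rightarrow> pbit list \<Rightarrow> mtree" where
  "mtree_unflatten \<Gamma> = mtree_unflatten_fuel \<Gamma> (env_fuel \<Gamma>)"

fun mtree_imap :: "(nat \<Rightarrow> pbit \<Rightarrow> pbit) \<Rightarrow> nat \<Rightarrow> mtree \<Rightarrow> mtree"
  and mtrees_imap :: "(nat \<Rightarrow> pbit \<Rightarrow> pbit) \<Rightarrow> nat \<Rightarrow> mtree list \<Rightarrow> mtree list"
  and mfields_imap :: "(nat \<Rightarrow> pbit \<Rightarrow> pbit) \<Rightarrow> nat \<Rightarrow> (mtree \<times> pbit list) list \<Rightarrow> (mtree \<times> pbit list) list"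
  where
  "mtree_imap g i (MBase \<tau>b xbs) = MBase \<tau>b (map2 g [i..<i + length xbs] xbs)"
| "mtree_imap g i (MArray \<tau> ws) = MArray \<tau> (mtrees_imap g i ws)"
| "mtree_imap g i (MStruct t wxbss) = MStruct t (mfields_imap g i wxbss)"
| "mtree_imap g i (MUnion t j w xbs) =
    (let i' = i + length (mtree_flatten w)
     in MUnion t j (mtree_imap g i w) (map2 g [i'..<i' + length xbs] xbs))"
| "mtree_imap g i (MUnionAll t xbs) = MUnionAll t (map2 g [i..<i + length xbs] xbs)"
| "mtrees_imap g i [] = []"
| "mtrees_imap g i (w # ws) = mtree_imap g i w # mtrees_imap g (i + length (mtree_flatten w)) ws"
| "mfields_imap g i [] = []"
| "mfields_imap g i ((w, xbs) # wxbss) =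
    (let i' = i + length (mtree_flatten w)
     in (mtree_imap g i w, map2 g [i'..<i' + length xbs] xbs) # mfields_imap g (i' + length xbs) wxbss)"

definition mtree_forall :: "(pbit \<Rightarrow> bool) \<Rightarrow> mtree \<Rightarrow> bool" where
  "mtree_forall P w \<longleftrightarrow> list_all P (mtree_flatten w)"

definition mtree_lookup_seg :: "env \<Rightarrow> ref_seg \<Rightarrow> mtree \<Rightarrow> mtree option" where
  "mtree_lookup_seg \<Gamma> rs w =
    (case (rs, w) of
       (RArray i \<tau> n, MArray \<tau>' ws) \<Rightarrow>
         if n = length ws \<and> \<tau> = \<tau>' \<and> i < length ws then Some (ws ! i) else None
     | (RStruct i t, MStruct t' wxbss) \<Rightarrow>
         if t = t' \<and> i < length wxbss then Some (fst (wxbss ! i)) else None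
     | (RUnion i t q, MUnion t' j w' xbs) \<Rightarrow>
         if t \<noteq> t' then None
         else if i = j then Some w'
         else if \<not> q \<and> i < length (the_fields \<Gamma> t) \<and>
             list_all pbit_unshared (mtree_flatten w' @ xbs) then
           (let \<tau> = the_fields \<Gamma> t ! i
            in Some (mtree_unflatten \<Gamma> \<tau> (take (bit_size_of \<Gamma> \<tau>) (mtree_flatten w' @ xbs))))
         else None
     | (RUnion i t q, MUnionAll t' xbs) \<Rightarrow>
         if t = t' \<and> i < length (the_fields \<Gamma> t) \<and> list_all pbit_unshared xbs then
           (let \<tau> = the_fields \<Gamma> t ! i
            in Some (mtree_unflatten \<Gamma> \<tau> (take (bit_size_of \<Gamma> \<tau>) xbs)))
         else None
     | _ \<Rightarrow> None)"

fun mtree_lookup :: "env \<Rightarrow> cref \<Rightarrow> mtree \<Rightarrow> mtree option" where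
  "mtree_lookup \<Gamma> [] w = Some w"
| "mtree_lookup \<Gamma> (rs # r) w = Option.bind (mtree_lookup \<Gamma> r w) (mtree_lookup_seg \<Gamma> rs)"

text \<open>Altering another variant of a union than the current one switches to that variant.\<close>

definition mtree_alter_seg :: "env \<Rightarrow> (mtree \<Rightarrow> mtree) \<Rightarrow> ref_seg \<Rightarrow> mtree \<Rightarrow> mtree" where
  "mtree_alter_seg \<Gamma> g rs w =
    (let switch = (\<lambda>t i xbs.
           if i < length (the_fields \<Gamma> t) then
             (let \<tau> = the_fields \<Gamma> t ! i; sz = bit_size_of \<Gamma> \<tau>
              in MUnion t i (g (mtree_unflatten \<Gamma> \<tau> (take sz xbs))) (map pbit_indetify (drop sz xbs)))
           else w)
     in case (rs, w) of
          (RArray i _ _, MArray \<tau> ws) \<Rightarrow> MArray \<tau> (alter_nth g i ws)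
        | (RStruct i _, MStruct t wxbss) \<Rightarrow> MStruct t (alter_nth (map_prod g id) i wxbss)
        | (RUnion i _ _, MUnion t j w' xbs) \<Rightarrow>
            if i = j then MUnion t i (g w') xbs else switch t i (mtree_flatten w' @ xbs)
        | (RUnion i _ _, MUnionAll t xbs) \<Rightarrow> switch t i xbs
        | _ \<Rightarrow> w)"

fun mtree_alter :: "env \<Rightarrow> (mtree \<Rightarrow> mtree) \<Rightarrow> cref \<Rightarrow> mtree \<Rightarrow> mtree" where
  "mtree_alter \<Gamma> g [] = g"
| "mtree_alter \<Gamma> g (rs # r) = mtree_alter \<Gamma> (mtree_alter_seg \<Gamma> g rs) r"

definition mtree_lookup_byte :: "env \<Rightarrow> nat \<Rightarrow> mtree \<Rightarrow> mtree option" where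
  "mtree_lookup_byte \<Gamma> i w =
    (let xbs = mtree_flatten w
     in if mtree_forall pbit_unshared w \<and> (i + 1) * char_bits \<le> length xbs
        then Some (mtree_unflatten \<Gamma> uchar (sublist (i * char_bits) char_bits xbs)) else None)"

definition mtree_alter_byte :: "env \<Rightarrow> (mtree \<Rightarrow> mtree) \<Rightarrow> nat \<Rightarrow> mtree \<Rightarrow> mtree" where
  "mtree_alter_byte \<Gamma> g i w =
    (let xbs = mtree_flatten w; j = i * char_bits
     in mtree_unflatten \<Gamma> (mtree_type w)
          (take j xbs @ mtree_flatten (g (mtree_unflatten \<Gamma> uchar (sublist j char_bits xbs))) @
           drop (j + char_bits) xbs))"

fun to_val :: "env \<Rightarrow> mtree \<Rightarrow> cval" where
  "to_val \<Gamma> (MBase \<tau>b xbs) = VBase (base_val_unflatten \<Gamma> \<tau>b (map pbit_bit xbs))"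
| "to_val \<Gamma> (MArray \<tau> ws) = VArray \<tau> (map (to_val \<Gamma>) ws)"
| "to_val \<Gamma> (MStruct t wxbss) = VStruct t (map (\<lambda>(w, xbs). to_val \<Gamma> w) wxbss)"
| "to_val \<Gamma> (MUnion t i w xbs) = VUnion t i (to_val \<Gamma> w)"
| "to_val \<Gamma> (MUnionAll t xbs) = val_unflatten \<Gamma> (TCompound Union_kind t) (map pbit_bit xbs)"

fun of_val :: "env \<Rightarrow> perm list \<Rightarrow> cval \<Rightarrow> mtree"
  and of_vals :: "env \<Rightarrow> perm list \<Rightarrow> cval list \<Rightarrow> mtree list"
  and of_fields :: "env \<Rightarrow> perm list \<Rightarrow> nat list \<Rightarrow> cval list \<Rightarrow> (mtree \<times> pbit list) list" where
  "of_val \<Gamma> \<gamma>s (VBase vb) = MBase (base_val_type vb) (map2 PBit \<gamma>s (base_val_flatten \<Gamma> vb))"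
| "of_val \<Gamma> \<gamma>s (VArray \<tau> vs) = MArray \<tau> (of_vals \<Gamma> \<gamma>s vs)"
| "of_val \<Gamma> \<gamma>s (VStruct t vs) = MStruct t (of_fields \<Gamma> \<gamma>s (field_bit_padding \<Gamma> (the_fields \<Gamma> t)) vs)"
| "of_val \<Gamma> \<gamma>s (VUnion t i v) =
    (let sz = bit_size_of \<Gamma> (val_type v)
     in MUnion t i (of_val \<Gamma> (take sz \<gamma>s) v) (map (\<lambda>\<gamma>. PBit \<gamma> BIndet) (drop sz \<gamma>s)))"
| "of_val \<Gamma> \<gamma>s (VUnionAll t vs) = MUnionAll t (map2 PBit \<gamma>s (val_flatten \<Gamma> (VUnionAll t vs)))"
| "of_vals \<Gamma> \<gamma>s [] = []"
| "of_vals \<Gamma> \<gamma>s (v # vs) =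
    (let sz = bit_size_of \<Gamma> (val_type v) in of_val \<Gamma> (take sz \<gamma>s) v # of_vals \<Gamma> (drop sz \<gamma>s) vs)"
| "of_fields \<Gamma> \<gamma>s (p # ps) (v # vs) =
    (let sz = bit_size_of \<Gamma> (val_type v)
     in (of_val \<Gamma> (take sz \<gamma>s) v, map (\<lambda>\<gamma>. PBit \<gamma> BIndet) (sublist sz p \<gamma>s)) #
        of_fields \<Gamma> (drop (sz + p) \<gamma>s) ps vs)"
| "of_fields \<Gamma> \<gamma>s _ _ = []"

text \<open>The flag of an object records whether it was allocated dynamically.\<close>

datatype mobj = Freed ctype | Obj mtree bool

type_synonym mem = "(index, mobj) fmap"

text \<open>A lock set contains pairs of an object identifier and a bit offset.\<close>

type_synonym lockset = "(index \<times> nat) set"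

definition mem_alive :: "mem \<Rightarrow> index \<Rightarrow> bool" where
  "mem_alive m x \<longleftrightarrow> (\<exists>w \<mu>. fmlookup m x = Some (Obj w \<mu>))"

definition cmap_lookup :: "env \<Rightarrow> addr \<Rightarrow> mem \<Rightarrow> mtree option" where
  "cmap_lookup \<Gamma> a m =
    (if \<not> addr_strict \<Gamma> a then None
     else case fmlookup m (addr_index a) of
       Some (Obj w \<mu>) \<Rightarrow>
         (case mtree_lookup \<Gamma> (addr_ref \<Gamma> a) w of
            Some w' \<Rightarrow>
              if addr_is_obj a then Some w' else mtree_lookup_byte \<Gamma> (addr_ref_byte \<Gamma> a) w'
          | None \<Rightarrow> None)
     | _ \<Rightarrow> None)"

definition cmap_alter :: "env \<Rightarrow> (mtree \<Rightarrow> mtree) \<Rightarrow> addr \<Rightarrow> mem \<Rightarrow> mem" where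
  "cmap_alter \<Gamma> g a m =
    (case fmlookup m (addr_index a) of
       Some (Obj w \<mu>) \<Rightarrow>
         (let g' = (if addr_is_obj a then g else mtree_alter_byte \<Gamma> g (addr_ref_byte \<Gamma> a))
          in fmupd (addr_index a) (Obj (mtree_alter \<Gamma> g' (addr_ref \<Gamma> a) w) \<mu>) m)
     | _ \<Rightarrow> m)"

definition mem_lookup :: "env \<Rightarrow> addr \<Rightarrow> mem \<Rightarrow> cval option" where
  "mem_lookup \<Gamma> a m =
    (case cmap_lookup \<Gamma> a m of
       Some w \<Rightarrow> if mtree_forall pbit_readable w then Some (to_val \<Gamma> w) else None
     | None \<Rightarrow> None)"

text \<open>Reading a union member makes it the current variant.\<close>

definition mem_force :: "env \<Rightarrow> addr \<Rightarrow> mem \<Rightarrow> mem" where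
  "mem_force \<Gamma> a m = cmap_alter \<Gamma> (\<lambda>w. w) a m"

definition mem_writable :: "env \<Rightarrow> addr \<Rightarrow> mem \<Rightarrow> bool" where
  "mem_writable \<Gamma> a m \<longleftrightarrow> (\<exists>w. cmap_lookup \<Gamma> a m = Some w \<and> mtree_forall pbit_writable w)"

definition mem_insert :: "env \<Rightarrow> addr \<Rightarrow> cval \<Rightarrow> mem \<Rightarrow> mem" where
  "mem_insert \<Gamma> a v m = cmap_alter \<Gamma> (\<lambda>w. of_val \<Gamma> (map pbit_perm (mtree_flatten w)) v) a m"

definition mem_allocable :: "index \<Rightarrow> mem \<Rightarrow> bool" where
  "mem_allocable x m \<longleftrightarrow> fmlookup m x = None"

definition mem_alloc :: "env \<Rightarrow> index \<Rightarrow> bool \<Rightarrow> perm \<Rightarrow> cval \<Rightarrow> mem \<Rightarrow> mem" where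
  "mem_alloc \<Gamma> x \<mu> \<gamma> v m =
    fmupd x (Obj (of_val \<Gamma> (replicate (bit_size_of \<Gamma> (val_type v)) \<gamma>) v) \<mu>) m"

definition mem_allocable_list :: "mem \<Rightarrow> index list \<Rightarrow> bool" where
  "mem_allocable_list m xs \<longleftrightarrow> distinct xs \<and> (\<forall>x\<in>set xs. mem_allocable x m)"

definition mem_alloc_list :: "env \<Rightarrow> index list \<Rightarrow> cval list \<Rightarrow> mem \<Rightarrow> mem" where
  "mem_alloc_list \<Gamma> xs vs m = foldr (\<lambda>(x, v). mem_alloc \<Gamma> x False perm_full v) (zip xs vs) m"

definition mem_free :: "index \<Rightarrow> mem \<Rightarrow> mem" where
  "mem_free x m =
    (case fmlookup m x of Some (Obj w \<mu>) \<Rightarrow> fmupd x (Freed (mtree_type w)) m | _ \<Rightarrow> m)"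

definition mem_freeable :: "addr \<Rightarrow> mem \<Rightarrow> bool" where
  "mem_freeable a m \<longleftrightarrow>
    (\<exists>\<tau> n w. addr_ref_base a = [RArray 0 \<tau> n] \<and> addr_byte a = 0 \<and>
      fmlookup m (addr_index a) = Some (Obj w True) \<and> mtree_forall (\<lambda>xb. pbit_perm xb = perm_full) w)"

definition mem_lock :: "env \<Rightarrow> addr \<Rightarrow> mem \<Rightarrow> mem" where
  "mem_lock \<Gamma> a m = cmap_alter \<Gamma> (mtree_imap (\<lambda>_. pbit_lock) 0) a m"

definition lock_singleton :: "env \<Rightarrow> addr \<Rightarrow> lockset" where
  "lock_singleton \<Gamma> a =
    (let i = addr_object_offset \<Gamma> a
     in {addr_index a} \<times> {i..<i + ptr_size_of \<Gamma> (addr_type a) * char_bits})"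

definition mem_unlock :: "lockset \<Rightarrow> mem \<Rightarrow> mem" where
  "mem_unlock \<Omega> m =
    fmmap_keys (\<lambda>x obj. case obj of
        Obj w \<mu> \<Rightarrow> Obj (mtree_imap (\<lambda>i xb. if (x, i) \<in> \<Omega> then pbit_unlock xb else xb) 0 w) \<mu>
      | Freed \<tau> \<Rightarrow> Freed \<tau>) m"

definition lockset_valid :: "env \<Rightarrow> memenv \<Rightarrow> lockset \<Rightarrow> bool" where
  "lockset_valid \<Gamma> \<Delta> \<Omega> \<longleftrightarrow>
    (\<forall>(x, i)\<in>\<Omega>. \<exists>\<tau>. fmlookup \<Delta> x = Some (\<tau>, False) \<and> i < bit_size_of \<Gamma> \<tau>)"


section \<open>Operations on values\<close>

definition addr_plus_ok :: "env \<Rightarrow> mem \<Rightarrow> int \<Rightarrow> addr \<Rightarrow> bool" where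
  "addr_plus_ok \<Gamma> m j a \<longleftrightarrow> mem_alive m (addr_index a) \<and>
    (let i = int (addr_byte a) + j * int (ptr_size_of \<Gamma> (addr_type a))
     in 0 \<le> i \<and> i \<le> int (size_of \<Gamma> (addr_type_base a) * ref_size (addr_ref_base a)))"

definition addr_minus_ok :: "mem \<Rightarrow> addr \<Rightarrow> addr \<Rightarrow> bool" where
  "addr_minus_ok m a1 a2 \<longleftrightarrow> mem_alive m (addr_index a1) \<and> addr_index a1 = addr_index a2 \<and>
    map (freeze_seg True) (addr_ref_base a1) = map (freeze_seg True) (addr_ref_base a2)"

definition addr_cast_ok :: "env \<Rightarrow> mem \<Rightarrow> ptype \<Rightarrow> addr \<Rightarrow> bool" where
  "addr_cast_ok \<Gamma> m \<sigma>p a \<longleftrightarrow> mem_alive m (addr_index a) \<and> castable (addr_type_base a) \<sigma>p \<and>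
    ptr_size_of \<Gamma> \<sigma>p dvd addr_byte a"

definition addr_compare_ok :: "env \<Rightarrow> mem \<Rightarrow> compop \<Rightarrow> addr \<Rightarrow> addr \<Rightarrow> bool" where
  "addr_compare_ok \<Gamma> m c a1 a2 \<longleftrightarrow> mem_alive m (addr_index a1) \<and> mem_alive m (addr_index a2) \<and>
    (addr_index a1 \<noteq> addr_index a2 \<longrightarrow> c = EqOp \<and> addr_strict \<Gamma> a1 \<and> addr_strict \<Gamma> a2)"

definition addr_compare :: "env \<Rightarrow> compop \<Rightarrow> addr \<Rightarrow> addr \<Rightarrow> bool" where
  "addr_compare \<Gamma> c a1 a2 \<longleftrightarrow> addr_index a1 = addr_index a2 \<and>
    compop_sem c (int (addr_object_offset \<Gamma> a1)) (int (addr_object_offset \<Gamma> a2))"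

fun ptr_alive :: "mem \<Rightarrow> ptr \<Rightarrow> bool" where
  "ptr_alive m (Ptr a) \<longleftrightarrow> mem_alive m (addr_index a)"
| "ptr_alive m (NULL \<tau>p) \<longleftrightarrow> True"
| "ptr_alive m (FunPtr f \<tau>s \<tau>) \<longleftrightarrow> True"

fun ptr_compare_ok :: "env \<Rightarrow> mem \<Rightarrow> compop \<Rightarrow> ptr \<Rightarrow> ptr \<Rightarrow> bool" where
  "ptr_compare_ok \<Gamma> m c (Ptr a1) (Ptr a2) \<longleftrightarrow> addr_compare_ok \<Gamma> m c a1 a2"
| "ptr_compare_ok \<Gamma> m c (NULL _) (NULL _) \<longleftrightarrow> True"
| "ptr_compare_ok \<Gamma> m c p1 p2 \<longleftrightarrow> c = EqOp \<and> ptr_alive m p1 \<and> ptr_alive m p2"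

fun ptr_compare :: "env \<Rightarrow> compop \<Rightarrow> ptr \<Rightarrow> ptr \<Rightarrow> bool" where
  "ptr_compare \<Gamma> c (Ptr a1) (Ptr a2) \<longleftrightarrow> addr_compare \<Gamma> c a1 a2"
| "ptr_compare \<Gamma> c (NULL _) (NULL _) \<longleftrightarrow> c \<noteq> LtOp"
| "ptr_compare \<Gamma> c (FunPtr f1 _ _) (FunPtr f2 _ _) \<longleftrightarrow> f1 = f2"
| "ptr_compare \<Gamma> c p1 p2 \<longleftrightarrow> False"

fun ptr_plus_ok :: "env \<Rightarrow> mem \<Rightarrow> int \<Rightarrow> ptr \<Rightarrow> bool" where
  "ptr_plus_ok \<Gamma> m j (NULL _) \<longleftrightarrow> j = 0"
| "ptr_plus_ok \<Gamma> m j (Ptr a) \<longleftrightarrow> addr_plus_ok \<Gamma> m j a"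
| "ptr_plus_ok \<Gamma> m j (FunPtr _ _ _) \<longleftrightarrow> False"

fun ptr_plus :: "env \<Rightarrow> int \<Rightarrow> ptr \<Rightarrow> ptr" where
  "ptr_plus \<Gamma> j (Ptr a) = Ptr (addr_plus \<Gamma> j a)"
| "ptr_plus \<Gamma> j (NULL \<tau>p) = NULL \<tau>p"
| "ptr_plus \<Gamma> j (FunPtr f \<tau>s \<tau>) = FunPtr f \<tau>s \<tau>"

fun ptr_minus_ok :: "mem \<Rightarrow> ptr \<Rightarrow> ptr \<Rightarrow> bool" where
  "ptr_minus_ok m (NULL _) (NULL _) \<longleftrightarrow> True"
| "ptr_minus_ok m (Ptr a1) (Ptr a2) \<longleftrightarrow> addr_minus_ok m a1 a2"
| "ptr_minus_ok m _ _ \<longleftrightarrow> False"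

fun ptr_minus :: "env \<Rightarrow> ptr \<Rightarrow> ptr \<Rightarrow> int" where
  "ptr_minus \<Gamma> (Ptr a1) (Ptr a2) = addr_minus \<Gamma> a1 a2"
| "ptr_minus \<Gamma> _ _ = 0"

fun ptr_cast_ok :: "env \<Rightarrow> mem \<Rightarrow> ptype \<Rightarrow> ptr \<Rightarrow> bool" where
  "ptr_cast_ok \<Gamma> m \<sigma>p (NULL _) \<longleftrightarrow> True"
| "ptr_cast_ok \<Gamma> m \<sigma>p (Ptr a) \<longleftrightarrow> addr_cast_ok \<Gamma> m \<sigma>p a"
| "ptr_cast_ok \<Gamma> m \<sigma>p (FunPtr f \<tau>s \<tau>) \<longleftrightarrow> \<sigma>p = TFun \<tau>s \<tau>"

fun ptr_cast :: "ptype \<Rightarrow> ptr \<Rightarrow> ptr" where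
  "ptr_cast \<sigma>p (NULL _) = NULL \<sigma>p"
| "ptr_cast \<sigma>p (Ptr a) = Ptr (addr_cast \<sigma>p a)"
| "ptr_cast \<sigma>p (FunPtr f \<tau>s \<tau>) = FunPtr f \<tau>s \<tau>"

fun base_val_branchable :: "mem \<Rightarrow> base_val \<Rightarrow> bool" where
  "base_val_branchable m (VInt \<tau>i x) \<longleftrightarrow> True"
| "base_val_branchable m (VPtr p) \<longleftrightarrow> ptr_alive m p"
| "base_val_branchable m (VIndet \<tau>b) \<longleftrightarrow> False"
| "base_val_branchable m VVoid \<longleftrightarrow> False"
| "base_val_branchable m (VByte bs) \<longleftrightarrow> False"

fun base_val_is_0 :: "base_val \<Rightarrow> bool" where
  "base_val_is_0 (VInt \<tau>i x) \<longleftrightarrow> x = 0"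
| "base_val_is_0 (VPtr (NULL \<tau>p)) \<longleftrightarrow> True"
| "base_val_is_0 _ \<longleftrightarrow> False"

definition val_branchable :: "mem \<Rightarrow> cval \<Rightarrow> bool" where
  "val_branchable m v \<longleftrightarrow> (\<exists>vb. v = VBase vb \<and> base_val_branchable m vb)"

definition val_true :: "mem \<Rightarrow> cval \<Rightarrow> bool" where
  "val_true m v \<longleftrightarrow> (\<exists>vb. v = VBase vb \<and> base_val_branchable m vb \<and> \<not> base_val_is_0 vb)"

definition val_false :: "mem \<Rightarrow> cval \<Rightarrow> bool" where
  "val_false m v \<longleftrightarrow> (\<exists>vb. v = VBase vb \<and> base_val_branchable m vb \<and> base_val_is_0 vb)"

inductive base_unop_typed :: "unop \<Rightarrow> btype \<Rightarrow> btype \<Rightarrow> bool" where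
  "base_unop_typed NegOp (TInt \<tau>i) (TInt (int_promote \<tau>i))"
| "base_unop_typed ComplOp (TInt \<tau>i) (TInt (int_promote \<tau>i))"
| "base_unop_typed NotOp (TInt \<tau>i) (TInt sint_it)"
| "base_unop_typed NotOp (TPtr \<tau>p) (TInt sint_it)"

definition val_unop_ok :: "mem \<Rightarrow> unop \<Rightarrow> cval \<Rightarrow> bool" where
  "val_unop_ok m op v \<longleftrightarrow>
    (case (op, v) of
       (NegOp, VBase (VInt \<tau>i x)) \<Rightarrow> int_arithop_ok MinusOp 0 \<tau>i x \<tau>i
     | (ComplOp, VBase (VInt \<tau>i x)) \<Rightarrow> True
     | (NotOp, VBase vb) \<Rightarrow> base_val_branchable m vb
     | _ \<Rightarrow> False)"

definition val_unop :: "unop \<Rightarrow> cval \<Rightarrow> cval" where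
  "val_unop op v =
    (case (op, v) of
       (NegOp, VBase (VInt \<tau>i x)) \<Rightarrow> intV (int_promote \<tau>i) (int_arithop MinusOp 0 \<tau>i x \<tau>i)
     | (ComplOp, VBase (VInt \<tau>i x)) \<Rightarrow>
         (let \<tau>i' = int_promote \<tau>i
          in intV \<tau>i' (int_of_bits \<tau>i' (map Not (int_to_bits \<tau>i' x))))
     | (NotOp, VBase vb) \<Rightarrow> intV sint_it (of_bool (base_val_is_0 vb))
     | _ \<Rightarrow> v)"

definition int_arith_type :: "itype \<Rightarrow> itype \<Rightarrow> itype" where
  "int_arith_type \<tau>1 \<tau>2 = int_union (int_promote \<tau>1) (int_promote \<tau>2)"

inductive base_binop_typed :: "env \<Rightarrow> binop \<Rightarrow> btype \<Rightarrow> btype \<Rightarrow> btype \<Rightarrow> bool" for \<Gamma> where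
  "base_binop_typed \<Gamma> (CompOp c) (TInt \<tau>1) (TInt \<tau>2) (TInt sint_it)"
| "base_binop_typed \<Gamma> (ArithOp aop) (TInt \<tau>1) (TInt \<tau>2) (TInt (int_arith_type \<tau>1 \<tau>2))"
| "base_binop_typed \<Gamma> (ShiftOp sop) (TInt \<tau>1) (TInt \<tau>2) (TInt (int_promote \<tau>1))"
| "base_binop_typed \<Gamma> (BitOp bop) (TInt \<tau>1) (TInt \<tau>2) (TInt (int_arith_type \<tau>1 \<tau>2))"
| "base_binop_typed \<Gamma> (CompOp c) (TPtr \<tau>p) (TPtr \<tau>p) (TInt sint_it)"
| "type_complete \<Gamma> \<tau> \<Longrightarrow>
    base_binop_typed \<Gamma> (ArithOp PlusOp) (TPtr (TType \<tau>)) (TInt \<sigma>i) (TPtr (TType \<tau>))"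
| "type_complete \<Gamma> \<tau> \<Longrightarrow>
    base_binop_typed \<Gamma> (ArithOp PlusOp) (TInt \<sigma>i) (TPtr (TType \<tau>)) (TPtr (TType \<tau>))"
| "type_complete \<Gamma> \<tau> \<Longrightarrow>
    base_binop_typed \<Gamma> (ArithOp MinusOp) (TPtr (TType \<tau>)) (TInt \<sigma>i) (TPtr (TType \<tau>))"
| "type_complete \<Gamma> \<tau> \<Longrightarrow>
    base_binop_typed \<Gamma> (ArithOp MinusOp) (TPtr (TType \<tau>)) (TPtr (TType \<tau>)) (TInt sptr_it)"

fun int_binop_ok :: "binop \<Rightarrow> int \<Rightarrow> itype \<Rightarrow> int \<Rightarrow> itype \<Rightarrow> bool" where
  "int_binop_ok (CompOp c) x \<tau>1 y \<tau>2 \<longleftrightarrow> True"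
| "int_binop_ok (ArithOp aop) x \<tau>1 y \<tau>2 \<longleftrightarrow> int_arithop_ok aop x \<tau>1 y \<tau>2"
| "int_binop_ok (ShiftOp sop) x \<tau>1 y \<tau>2 \<longleftrightarrow> int_shiftop_ok sop x \<tau>1 y \<tau>2"
| "int_binop_ok (BitOp bop) x \<tau>1 y \<tau>2 \<longleftrightarrow> True"

fun int_binop :: "binop \<Rightarrow> int \<Rightarrow> itype \<Rightarrow> int \<Rightarrow> itype \<Rightarrow> cval" where
  "int_binop (CompOp c) x \<tau>1 y \<tau>2 =
    (let \<tau>i = int_arith_type \<tau>1 \<tau>2
     in intV sint_it (of_bool (compop_sem c (int_cast \<tau>i x) (int_cast \<tau>i y))))"
| "int_binop (ArithOp aop) x \<tau>1 y \<tau>2 = intV (int_arith_type \<tau>1 \<tau>2) (int_arithop aop x \<tau>1 y \<tau>2)"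
| "int_binop (ShiftOp sop) x \<tau>1 y \<tau>2 = intV (int_promote \<tau>1) (int_shiftop sop x \<tau>1 y \<tau>2)"
| "int_binop (BitOp bop) x \<tau>1 y \<tau>2 =
    (let \<tau>i = int_arith_type \<tau>1 \<tau>2
     in intV \<tau>i (int_of_bits \<tau>i (map2 (bitop_sem bop)
          (int_to_bits \<tau>i (int_cast \<tau>i x)) (int_to_bits \<tau>i (int_cast \<tau>i y)))))"

definition val_binop_ok :: "env \<Rightarrow> mem \<Rightarrow> binop \<Rightarrow> cval \<Rightarrow> cval \<Rightarrow> bool" where
  "val_binop_ok \<Gamma> m op v1 v2 \<longleftrightarrow>
    (case (v1, v2) of
       (VBase (VInt \<tau>1 x), VBase (VInt \<tau>2 y)) \<Rightarrow> int_binop_ok op x \<tau>1 y \<tau>2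
     | (VBase (VPtr p), VBase (VInt \<tau>2 y)) \<Rightarrow>
         op = ArithOp PlusOp \<and> ptr_plus_ok \<Gamma> m y p \<or> op = ArithOp MinusOp \<and> ptr_plus_ok \<Gamma> m (- y) p
     | (VBase (VInt \<tau>1 x), VBase (VPtr p)) \<Rightarrow> op = ArithOp PlusOp \<and> ptr_plus_ok \<Gamma> m x p
     | (VBase (VPtr p1), VBase (VPtr p2)) \<Rightarrow>
         (case op of CompOp c \<Rightarrow> ptr_compare_ok \<Gamma> m c p1 p2
          | ArithOp MinusOp \<Rightarrow> ptr_minus_ok m p1 p2
          | _ \<Rightarrow> False)
     | _ \<Rightarrow> False)"

definition val_binop :: "env \<Rightarrow> binop \<Rightarrow> cval \<Rightarrow> cval \<Rightarrow> cval" where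
  "val_binop \<Gamma> op v1 v2 =
    (case (v1, v2) of
       (VBase (VInt \<tau>1 x), VBase (VInt \<tau>2 y)) \<Rightarrow> int_binop op x \<tau>1 y \<tau>2
     | (VBase (VPtr p), VBase (VInt \<tau>2 y)) \<Rightarrow>
         ptrV (ptr_plus \<Gamma> (if op = ArithOp PlusOp then y else - y) p)
     | (VBase (VInt \<tau>1 x), VBase (VPtr p)) \<Rightarrow> ptrV (ptr_plus \<Gamma> x p)
     | (VBase (VPtr p1), VBase (VPtr p2)) \<Rightarrow>
         (case op of CompOp c \<Rightarrow> intV sint_it (of_bool (ptr_compare \<Gamma> c p1 p2))
          | _ \<Rightarrow> intV sptr_it (ptr_minus \<Gamma> p1 p2))
     | _ \<Rightarrow> v1)"

inductive base_cast_typed :: "btype \<Rightarrow> btype \<Rightarrow> bool" where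
  "base_cast_typed \<tau>b TVoid"
| "base_cast_typed (TInt \<tau>1) (TInt \<tau>2)"
| "base_cast_typed (TPtr \<tau>p) (TPtr \<tau>p)"
| "base_cast_typed (TPtr (TType \<tau>)) (TPtr TAny)"
| "base_cast_typed (TPtr (TType \<tau>)) (TPtr (TType uchar))"
| "base_cast_typed (TPtr TAny) (TPtr (TType \<tau>))"
| "base_cast_typed (TPtr (TType uchar)) (TPtr (TType \<tau>))"

inductive cast_typed :: "ctype \<Rightarrow> ctype \<Rightarrow> bool" where
  "cast_typed \<tau> \<tau>"
| "cast_typed \<tau> voidT"
| "base_cast_typed \<tau>b \<sigma>b \<Longrightarrow> cast_typed (TBase \<tau>b) (TBase \<sigma>b)"

definition base_val_cast_ok :: "env \<Rightarrow> mem \<Rightarrow> btype \<Rightarrow> base_val \<Rightarrow> bool" where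
  "base_val_cast_ok \<Gamma> m \<tau>b vb \<longleftrightarrow>
    (case (\<tau>b, vb) of
       (TVoid, _) \<Rightarrow> True
     | (TInt \<tau>i, VInt _ x) \<Rightarrow> int_cast_ok \<tau>i x
     | (TPtr \<tau>p, VPtr p) \<Rightarrow> ptr_cast_ok \<Gamma> m \<tau>p p
     | (TInt \<tau>i, VByte _) \<Rightarrow> \<tau>i = uchar_it
     | (TInt \<tau>i, VIndet \<sigma>b) \<Rightarrow> \<tau>i = uchar_it \<and> \<sigma>b = TInt uchar_it
     | _ \<Rightarrow> False)"

definition base_val_cast :: "btype \<Rightarrow> base_val \<Rightarrow> base_val" where
  "base_val_cast \<tau>b vb =
    (case (\<tau>b, vb) of
       (TVoid, _) \<Rightarrow> VVoid
     | (TInt \<tau>i, VInt _ x) \<Rightarrow> VInt \<tau>i (int_cast \<tau>i x)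
     | (TPtr \<tau>p, VPtr p) \<Rightarrow> VPtr (ptr_cast \<tau>p p)
     | _ \<Rightarrow> vb)"

definition val_cast_ok :: "env \<Rightarrow> mem \<Rightarrow> ptype \<Rightarrow> cval \<Rightarrow> bool" where
  "val_cast_ok \<Gamma> m \<tau>p v \<longleftrightarrow>
    (case (\<tau>p, v) of (TType (TBase \<tau>b), VBase vb) \<Rightarrow> base_val_cast_ok \<Gamma> m \<tau>b vb | _ \<Rightarrow> True)"

definition val_cast :: "ptype \<Rightarrow> cval \<Rightarrow> cval" where
  "val_cast \<tau>p v =
    (case (\<tau>p, v) of
       (TType (TBase \<tau>b), VBase vb) \<Rightarrow> VBase (base_val_cast \<tau>b vb)
     | (TType (TBase TVoid), _) \<Rightarrow> voidV
     | _ \<Rightarrow> v)"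

fun unop_typed :: "unop \<Rightarrow> ctype \<Rightarrow> ctype \<Rightarrow> bool" where
  "unop_typed op (TBase \<tau>b) (TBase \<sigma>b) \<longleftrightarrow> base_unop_typed op \<tau>b \<sigma>b"
| "unop_typed op _ _ \<longleftrightarrow> False"

definition binop_typed :: "env \<Rightarrow> binop \<Rightarrow> ctype \<Rightarrow> ctype \<Rightarrow> ctype \<Rightarrow> bool" where
  "binop_typed \<Gamma> op \<tau>1 \<tau>2 \<sigma> \<longleftrightarrow>
    (\<exists>\<tau>b1 \<tau>b2 \<sigma>b. \<tau>1 = TBase \<tau>b1 \<and> \<tau>2 = TBase \<tau>b2 \<and> \<sigma> = TBase \<sigma>b \<and> base_binop_typed \<Gamma> op \<tau>b1 \<tau>b2 \<sigma>b)"


section \<open>Expressions and statements\<close>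

datatype assign = Assign | PreOp binop | PostOp binop

type_synonym lrval = "ptr + cval"
type_synonym lrtype = "ptype + ctype"

datatype expr =
    EVar nat
  | EVal lockset lrval
  | ERtoL expr
  | ELtoR expr
  | EAssign assign expr expr
  | ECall expr "expr list"
  | EAbort ctype
  | ELoad expr
  | EEltL expr ref_seg
  | EEltR expr ref_seg
  | EAlloc ctype expr
  | EFree expr
  | EUnOp unop expr
  | EBinOp binop expr expr
  | EIf expr expr expr
  | EComma expr expr
  | ECast ctype expr
  | EInsert cref expr expr

abbreviation ELVal :: "lockset \<Rightarrow> ptr \<Rightarrow> expr" where "ELVal \<Omega> p \<equiv> EVal \<Omega> (Inl p)"
abbreviation ERVal :: "lockset \<Rightarrow> cval \<Rightarrow> expr" where "ERVal \<Omega> v \<equiv> EVal \<Omega> (Inr v)"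

datatype stmt =
    SSkip
  | SDo expr
  | SGoto labelname
  | SThrow nat
  | SReturn expr
  | SCase "int option"
  | SLabel labelname
  | SLocal ctype stmt
  | SComp stmt stmt
  | SCatch stmt
  | SLoop stmt
  | SIf expr stmt stmt
  | SSwitch expr stmt

primrec locks :: "expr \<Rightarrow> lockset" where
  "locks (EVar i) = {}"
| "locks (EVal \<Omega> \<nu>) = \<Omega>"
| "locks (ERtoL e) = locks e"
| "locks (ELtoR e) = locks e"
| "locks (EAssign ass e1 e2) = locks e1 \<union> locks e2"
| "locks (ECall e es) = locks e \<union> \<Union> (set (map locks es))"
| "locks (EAbort \<tau>) = {}"
| "locks (ELoad e) = locks e"
| "locks (EEltL e rs) = locks e"
| "locks (EEltR e rs) = locks e"
| "locks (EAlloc \<tau> e) = locks e"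
| "locks (EFree e) = locks e"
| "locks (EUnOp op e) = locks e"
| "locks (EBinOp op e1 e2) = locks e1 \<union> locks e2"
| "locks (EIf e1 e2 e3) = locks e1 \<union> locks e2 \<union> locks e3"
| "locks (EComma e1 e2) = locks e1 \<union> locks e2"
| "locks (ECast \<tau> e) = locks e"
| "locks (EInsert r e1 e2) = locks e1 \<union> locks e2"

primrec labels :: "stmt \<Rightarrow> labelname set" where
  "labels SSkip = {}"
| "labels (SDo e) = {}"
| "labels (SGoto l) = {}"
| "labels (SThrow n) = {}"
| "labels (SReturn e) = {}"
| "labels (SCase mx) = {}"
| "labels (SLabel l) = {l}"
| "labels (SLocal \<tau> s) = labels s"
| "labels (SComp s1 s2) = labels s1 \<union> labels s2"
| "labels (SCatch s) = labels s"
| "labels (SLoop s) = labels s"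
| "labels (SIf e s1 s2) = labels s1 \<union> labels s2"
| "labels (SSwitch e s) = labels s"

primrec gotos :: "stmt \<Rightarrow> labelname set" where
  "gotos SSkip = {}"
| "gotos (SDo e) = {}"
| "gotos (SGoto l) = {l}"
| "gotos (SThrow n) = {}"
| "gotos (SReturn e) = {}"
| "gotos (SCase mx) = {}"
| "gotos (SLabel l) = {}"
| "gotos (SLocal \<tau> s) = gotos s"
| "gotos (SComp s1 s2) = gotos s1 \<union> gotos s2"
| "gotos (SCatch s) = gotos s"
| "gotos (SLoop s) = gotos s"
| "gotos (SIf e s1 s2) = gotos s1 \<union> gotos s2"
| "gotos (SSwitch e s) = gotos s"

text \<open>The case labels that belong to an enclosing switch; \<open>None\<close> is the default case.\<close>

primrec cases_of :: "stmt \<Rightarrow> int option set" where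
  "cases_of SSkip = {}"
| "cases_of (SDo e) = {}"
| "cases_of (SGoto l) = {}"
| "cases_of (SThrow n) = {}"
| "cases_of (SReturn e) = {}"
| "cases_of (SCase mx) = {mx}"
| "cases_of (SLabel l) = {}"
| "cases_of (SLocal \<tau> s) = cases_of s"
| "cases_of (SComp s1 s2) = cases_of s1 \<union> cases_of s2"
| "cases_of (SCatch s) = cases_of s"
| "cases_of (SLoop s) = cases_of s"
| "cases_of (SIf e s1 s2) = cases_of s1 \<union> cases_of s2"
| "cases_of (SSwitch e s) = {}"

primrec throws_valid :: "nat \<Rightarrow> stmt \<Rightarrow> bool" where
  "throws_valid n SSkip \<longleftrightarrow> True"
| "throws_valid n (SDo e) \<longleftrightarrow> True"
| "throws_valid n (SGoto l) \<longleftrightarrow> True"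
| "throws_valid n (SThrow i) \<longleftrightarrow> i < n"
| "throws_valid n (SReturn e) \<longleftrightarrow> True"
| "throws_valid n (SCase mx) \<longleftrightarrow> True"
| "throws_valid n (SLabel l) \<longleftrightarrow> True"
| "throws_valid n (SLocal \<tau> s) \<longleftrightarrow> throws_valid n s"
| "throws_valid n (SComp s1 s2) \<longleftrightarrow> throws_valid n s1 \<and> throws_valid n s2"
| "throws_valid n (SCatch s) \<longleftrightarrow> throws_valid (Suc n) s"
| "throws_valid n (SLoop s) \<longleftrightarrow> throws_valid n s"
| "throws_valid n (SIf e s1 s2) \<longleftrightarrow> throws_valid n s1 \<and> throws_valid n s2"
| "throws_valid n (SSwitch e s) \<longleftrightarrow> throws_valid n s"


section \<open>Typing\<close>

fun lrval_typed :: "env \<Rightarrow> memenv \<Rightarrow> lrval \<Rightarrow> lrtype \<Rightarrow> bool" where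
  "lrval_typed \<Gamma> \<Delta> (Inl p) (Inl \<tau>p) \<longleftrightarrow> ptr_typed \<Gamma> \<Delta> p \<tau>p"
| "lrval_typed \<Gamma> \<Delta> (Inr v) (Inr \<tau>) \<longleftrightarrow> val_typed \<Gamma> \<Delta> v \<tau>"
| "lrval_typed \<Gamma> \<Delta> _ _ \<longleftrightarrow> False"

fun assign_typed :: "env \<Rightarrow> ctype \<Rightarrow> ctype \<Rightarrow> assign \<Rightarrow> bool" where
  "assign_typed \<Gamma> \<tau>1 \<tau>2 Assign \<longleftrightarrow> cast_typed \<tau>2 \<tau>1"
| "assign_typed \<Gamma> \<tau>1 \<tau>2 (PreOp op) \<longleftrightarrow> (\<exists>\<sigma>. binop_typed \<Gamma> op \<tau>1 \<tau>2 \<sigma> \<and> cast_typed \<sigma> \<tau>1)"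
| "assign_typed \<Gamma> \<tau>1 \<tau>2 (PostOp op) \<longleftrightarrow> (\<exists>\<sigma>. binop_typed \<Gamma> op \<tau>1 \<tau>2 \<sigma> \<and> cast_typed \<sigma> \<tau>1)"

inductive expr_typed :: "env \<Rightarrow> memenv \<Rightarrow> ctype list \<Rightarrow> expr \<Rightarrow> lrtype \<Rightarrow> bool" for \<Gamma> \<Delta> \<tau>s where
  EVar_typed: "i < length \<tau>s \<Longrightarrow> expr_typed \<Gamma> \<Delta> \<tau>s (EVar i) (Inl (TType (\<tau>s ! i)))"
| EVal_typed: "lockset_valid \<Gamma> \<Delta> \<Omega> \<Longrightarrow> lrval_typed \<Gamma> \<Delta> \<nu> \<tau>lr \<Longrightarrow> expr_typed \<Gamma> \<Delta> \<tau>s (EVal \<Omega> \<nu>) \<tau>lr"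
| ERtoL_typed: "expr_typed \<Gamma> \<Delta> \<tau>s e (Inr (TBase (TPtr \<tau>p))) \<Longrightarrow>
    expr_typed \<Gamma> \<Delta> \<tau>s (ERtoL e) (Inl \<tau>p)"
| ELtoR_typed: "expr_typed \<Gamma> \<Delta> \<tau>s e (Inl \<tau>p) \<Longrightarrow>
    expr_typed \<Gamma> \<Delta> \<tau>s (ELtoR e) (Inr (TBase (TPtr \<tau>p)))"
| EAssign_typed: "type_complete \<Gamma> \<tau>1 \<Longrightarrow> expr_typed \<Gamma> \<Delta> \<tau>s e1 (Inl (TType \<tau>1)) \<Longrightarrow>
    expr_typed \<Gamma> \<Delta> \<tau>s e2 (Inr \<tau>2) \<Longrightarrow> assign_typed \<Gamma> \<tau>1 \<tau>2 ass \<Longrightarrow>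
    expr_typed \<Gamma> \<Delta> \<tau>s (EAssign ass e1 e2) (Inr \<tau>1)"
| ECall_typed: "expr_typed \<Gamma> \<Delta> \<tau>s e (Inl (TFun \<sigma>s \<sigma>)) \<Longrightarrow> length es = length \<sigma>s \<Longrightarrow>
    (\<And>i. i < length \<sigma>s \<Longrightarrow> expr_typed \<Gamma> \<Delta> \<tau>s (es ! i) (Inr (\<sigma>s ! i))) \<Longrightarrow> type_complete \<Gamma> \<sigma> \<Longrightarrow>
    expr_typed \<Gamma> \<Delta> \<tau>s (ECall e es) (Inr \<sigma>)"
| EAbort_typed: "ctype_valid \<Gamma> \<tau> \<Longrightarrow> expr_typed \<Gamma> \<Delta> \<tau>s (EAbort \<tau>) (Inr \<tau>)"
| ELoad_typed: "expr_typed \<Gamma> \<Delta> \<tau>s e (Inl (TType \<tau>)) \<Longrightarrow> type_complete \<Gamma> \<tau> \<Longrightarrow>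
    expr_typed \<Gamma> \<Delta> \<tau>s (ELoad e) (Inr \<tau>)"
| EEltL_typed: "expr_typed \<Gamma> \<Delta> \<tau>s e (Inl (TType \<tau>)) \<Longrightarrow> type_lookup_seg \<Gamma> rs \<tau> = Some \<sigma> \<Longrightarrow>
    expr_typed \<Gamma> \<Delta> \<tau>s (EEltL e rs) (Inl (TType \<sigma>))"
| EEltR_typed: "expr_typed \<Gamma> \<Delta> \<tau>s e (Inr \<tau>) \<Longrightarrow> type_lookup_seg \<Gamma> rs \<tau> = Some \<sigma> \<Longrightarrow>
    expr_typed \<Gamma> \<Delta> \<tau>s (EEltR e rs) (Inr \<sigma>)"
| EAlloc_typed: "ctype_valid \<Gamma> \<tau> \<Longrightarrow> expr_typed \<Gamma> \<Delta> \<tau>s e (Inr (TBase (TInt \<tau>i))) \<Longrightarrow>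
    expr_typed \<Gamma> \<Delta> \<tau>s (EAlloc \<tau> e) (Inr (TBase (TPtr (TType \<tau>))))"
| EFree_typed: "expr_typed \<Gamma> \<Delta> \<tau>s e (Inl (TType \<tau>)) \<Longrightarrow> expr_typed \<Gamma> \<Delta> \<tau>s (EFree e) (Inr voidT)"
| EUnOp_typed: "expr_typed \<Gamma> \<Delta> \<tau>s e (Inr \<tau>) \<Longrightarrow> unop_typed op \<tau> \<sigma> \<Longrightarrow>
    expr_typed \<Gamma> \<Delta> \<tau>s (EUnOp op e) (Inr \<sigma>)"
| EBinOp_typed: "expr_typed \<Gamma> \<Delta> \<tau>s e1 (Inr \<tau>1) \<Longrightarrow> expr_typed \<Gamma> \<Delta> \<tau>s e2 (Inr \<tau>2) \<Longrightarrow>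
    binop_typed \<Gamma> op \<tau>1 \<tau>2 \<sigma> \<Longrightarrow> expr_typed \<Gamma> \<Delta> \<tau>s (EBinOp op e1 e2) (Inr \<sigma>)"
| EIf_typed: "expr_typed \<Gamma> \<Delta> \<tau>s e1 (Inr (TBase \<tau>b)) \<Longrightarrow> \<tau>b \<noteq> TVoid \<Longrightarrow>
    expr_typed \<Gamma> \<Delta> \<tau>s e2 \<sigma>lr \<Longrightarrow> locks e2 = {} \<Longrightarrow> expr_typed \<Gamma> \<Delta> \<tau>s e3 \<sigma>lr \<Longrightarrow> locks e3 = {} \<Longrightarrow>
    expr_typed \<Gamma> \<Delta> \<tau>s (EIf e1 e2 e3) \<sigma>lr"
| EComma_typed: "expr_typed \<Gamma> \<Delta> \<tau>s e1 \<tau>lr \<Longrightarrow> expr_typed \<Gamma> \<Delta> \<tau>s e2 \<sigma>lr \<Longrightarrow> locks e2 = {} \<Longrightarrow>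
    expr_typed \<Gamma> \<Delta> \<tau>s (EComma e1 e2) \<sigma>lr"
| ECast_typed: "expr_typed \<Gamma> \<Delta> \<tau>s e (Inr \<tau>) \<Longrightarrow> cast_typed \<tau> \<sigma> \<Longrightarrow> ctype_valid \<Gamma> \<sigma> \<Longrightarrow>
    expr_typed \<Gamma> \<Delta> \<tau>s (ECast \<sigma> e) (Inr \<sigma>)"
| EInsert_typed: "type_lookup \<Gamma> r \<tau> = Some \<sigma> \<Longrightarrow> expr_typed \<Gamma> \<Delta> \<tau>s e1 (Inr \<sigma>) \<Longrightarrow>
    expr_typed \<Gamma> \<Delta> \<tau>s e2 (Inr \<tau>) \<Longrightarrow> expr_typed \<Gamma> \<Delta> \<tau>s (EInsert r e1 e2) (Inr \<tau>)"

type_synonym rettype = "bool \<times> ctype option"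

inductive rettype_union :: "ctype option \<Rightarrow> ctype option \<Rightarrow> ctype option \<Rightarrow> bool" where
  "rettype_union m\<sigma> m\<sigma> m\<sigma>"
| "rettype_union (Some \<sigma>) None (Some \<sigma>)"
| "rettype_union None (Some \<sigma>) (Some \<sigma>)"

fun rettype_match :: "rettype \<Rightarrow> ctype \<Rightarrow> bool" where
  "rettype_match (True, Some \<sigma>') \<sigma> \<longleftrightarrow> \<sigma>' = \<sigma>"
| "rettype_match (False, Some \<sigma>') \<sigma> \<longleftrightarrow> \<sigma>' = \<sigma> \<and> \<sigma> = voidT"
| "rettype_match (True, None) \<sigma> \<longleftrightarrow> True"
| "rettype_match (False, None) \<sigma> \<longleftrightarrow> \<sigma> = voidT"

inductive stmt_typed :: "env \<Rightarrow> memenv \<Rightarrow> ctype list \<Rightarrow> stmt \<Rightarrow> rettype \<Rightarrow> bool" for \<Gamma> \<Delta> where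
  SSkip_typed: "stmt_typed \<Gamma> \<Delta> \<tau>s SSkip (False, None)"
| SDo_typed: "expr_typed \<Gamma> \<Delta> \<tau>s e \<tau>lr \<Longrightarrow> locks e = {} \<Longrightarrow> stmt_typed \<Gamma> \<Delta> \<tau>s (SDo e) (False, None)"
| SGoto_typed: "stmt_typed \<Gamma> \<Delta> \<tau>s (SGoto l) (True, None)"
| SThrow_typed: "stmt_typed \<Gamma> \<Delta> \<tau>s (SThrow n) (True, None)"
| SReturn_typed: "expr_typed \<Gamma> \<Delta> \<tau>s e (Inr \<tau>) \<Longrightarrow> locks e = {} \<Longrightarrow>
    stmt_typed \<Gamma> \<Delta> \<tau>s (SReturn e) (True, Some \<tau>)"
| SCase_typed: "stmt_typed \<Gamma> \<Delta> \<tau>s (SCase mx) (False, None)"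
| SLabel_typed: "stmt_typed \<Gamma> \<Delta> \<tau>s (SLabel l) (False, None)"
| SLocal_typed: "ctype_valid \<Gamma> \<tau> \<Longrightarrow> stmt_typed \<Gamma> \<Delta> (\<tau> # \<tau>s) s (c, m\<sigma>) \<Longrightarrow>
    stmt_typed \<Gamma> \<Delta> \<tau>s (SLocal \<tau> s) (c, m\<sigma>)"
| SComp_typed: "stmt_typed \<Gamma> \<Delta> \<tau>s s1 (c1, m\<sigma>1) \<Longrightarrow> stmt_typed \<Gamma> \<Delta> \<tau>s s2 (c2, m\<sigma>2) \<Longrightarrow>
    rettype_union m\<sigma>1 m\<sigma>2 m\<sigma> \<Longrightarrow> stmt_typed \<Gamma> \<Delta> \<tau>s (SComp s1 s2) (c2, m\<sigma>)"
| SCatch_typed: "stmt_typed \<Gamma> \<Delta> \<tau>s s (c, m\<sigma>) \<Longrightarrow> stmt_typed \<Gamma> \<Delta> \<tau>s (SCatch s) (False, m\<sigma>)"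
| SLoop_typed: "stmt_typed \<Gamma> \<Delta> \<tau>s s (c, m\<sigma>) \<Longrightarrow> stmt_typed \<Gamma> \<Delta> \<tau>s (SLoop s) (True, m\<sigma>)"
| SIf_typed: "expr_typed \<Gamma> \<Delta> \<tau>s e (Inr (TBase \<tau>b)) \<Longrightarrow> \<tau>b \<noteq> TVoid \<Longrightarrow> locks e = {} \<Longrightarrow>
    stmt_typed \<Gamma> \<Delta> \<tau>s s1 (c1, m\<sigma>1) \<Longrightarrow> stmt_typed \<Gamma> \<Delta> \<tau>s s2 (c2, m\<sigma>2) \<Longrightarrow>
    rettype_union m\<sigma>1 m\<sigma>2 m\<sigma> \<Longrightarrow> stmt_typed \<Gamma> \<Delta> \<tau>s (SIf e s1 s2) (c1 \<and> c2, m\<sigma>)"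
| SSwitch_typed: "expr_typed \<Gamma> \<Delta> \<tau>s e (Inr (TBase (TInt \<tau>i))) \<Longrightarrow> locks e = {} \<Longrightarrow>
    stmt_typed \<Gamma> \<Delta> \<tau>s s (c, m\<sigma>) \<Longrightarrow> stmt_typed \<Gamma> \<Delta> \<tau>s (SSwitch e s) (False, m\<sigma>)"

type_synonym funenv = "(funname, stmt) fmap"

definition funenv_valid :: "env \<Rightarrow> memenv \<Rightarrow> funenv \<Rightarrow> bool" where
  "funenv_valid \<Gamma> \<Delta> \<delta> \<longleftrightarrow>
    (\<forall>f s. fmlookup \<delta> f = Some s \<longrightarrow>
      (\<exists>\<tau>s \<tau> cm\<tau>. fmlookup (env_f \<Gamma>) f = Some (\<tau>s, \<tau>) \<and> (\<forall>\<sigma>\<in>set \<tau>s. type_complete \<Gamma> \<sigma>) \<and>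
        stmt_typed \<Gamma> \<Delta> \<tau>s s cm\<tau> \<and> rettype_match cm\<tau> \<tau> \<and>
        gotos s \<subseteq> labels s \<and> throws_valid 0 s)) \<and>
    fmdom' (env_f \<Gamma>) \<subseteq> fmdom' \<delta>"


section \<open>Small-step semantics\<close>

text \<open>Expression evaluation contexts are lists of items with the innermost item first.\<close>

datatype ectx_item =
    CRtoL
  | CLtoR
  | CAssignL assign expr
  | CAssignR assign expr
  | CCallL "expr list"
  | CCallR expr "expr list" "expr list"
  | CLoad
  | CEltL ref_seg
  | CEltR ref_seg
  | CAlloc ctype
  | CFree
  | CUnOp unop
  | CBinOpL binop expr
  | CBinOpR binop expr
  | CIf expr expr
  | CComma expr
  | CCast ctype
  | CInsertL cref expr
  | CInsertR cref expr

type_synonym ectx = "ectx_item list"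

fun ectx_item_subst :: "ectx_item \<Rightarrow> expr \<Rightarrow> expr" where
  "ectx_item_subst CRtoL e = ERtoL e"
| "ectx_item_subst CLtoR e = ELtoR e"
| "ectx_item_subst (CAssignL ass e2) e = EAssign ass e e2"
| "ectx_item_subst (CAssignR ass e1) e = EAssign ass e1 e"
| "ectx_item_subst (CCallL es) e = ECall e es"
| "ectx_item_subst (CCallR e0 es1 es2) e = ECall e0 (es1 @ e # es2)"
| "ectx_item_subst CLoad e = ELoad e"
| "ectx_item_subst (CEltL rs) e = EEltL e rs"
| "ectx_item_subst (CEltR rs) e = EEltR e rs"
| "ectx_item_subst (CAlloc \<tau>) e = EAlloc \<tau> e"
| "ectx_item_subst CFree e = EFree e"
| "ectx_item_subst (CUnOp op) e = EUnOp op e"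
| "ectx_item_subst (CBinOpL op e2) e = EBinOp op e e2"
| "ectx_item_subst (CBinOpR op e1) e = EBinOp op e1 e"
| "ectx_item_subst (CIf e2 e3) e = EIf e e2 e3"
| "ectx_item_subst (CComma e2) e = EComma e e2"
| "ectx_item_subst (CCast \<tau>) e = ECast \<tau> e"
| "ectx_item_subst (CInsertL r e2) e = EInsert r e e2"
| "ectx_item_subst (CInsertR r e1) e = EInsert r e1 e"

definition ectx_subst :: "ectx \<Rightarrow> expr \<Rightarrow> expr" where
  "ectx_subst E e = fold ectx_item_subst E e"

definition is_nf :: "expr \<Rightarrow> bool" where
  "is_nf e \<longleftrightarrow> (\<exists>\<Omega> \<nu>. e = EVal \<Omega> \<nu>)"

fun is_redex :: "expr \<Rightarrow> bool" where
  "is_redex (EVar i) \<longleftrightarrow> True"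
| "is_redex (EVal \<Omega> \<nu>) \<longleftrightarrow> False"
| "is_redex (ERtoL e) \<longleftrightarrow> is_nf e"
| "is_redex (ELtoR e) \<longleftrightarrow> is_nf e"
| "is_redex (EAssign ass e1 e2) \<longleftrightarrow> is_nf e1 \<and> is_nf e2"
| "is_redex (ECall e es) \<longleftrightarrow> is_nf e \<and> list_all is_nf es"
| "is_redex (EAbort \<tau>) \<longleftrightarrow> True"
| "is_redex (ELoad e) \<longleftrightarrow> is_nf e"
| "is_redex (EEltL e rs) \<longleftrightarrow> is_nf e"
| "is_redex (EEltR e rs) \<longleftrightarrow> is_nf e"
| "is_redex (EAlloc \<tau> e) \<longleftrightarrow> is_nf e"
| "is_redex (EFree e) \<longleftrightarrow> is_nf e"
| "is_redex (EUnOp op e) \<longleftrightarrow> is_nf e"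
| "is_redex (EBinOp op e1 e2) \<longleftrightarrow> is_nf e1 \<and> is_nf e2"
| "is_redex (EIf e1 e2 e3) \<longleftrightarrow> is_nf e1"
| "is_redex (EComma e1 e2) \<longleftrightarrow> is_nf e1"
| "is_redex (ECast \<tau> e) \<longleftrightarrow> is_nf e"
| "is_redex (EInsert r e1 e2) \<longleftrightarrow> is_nf e1 \<and> is_nf e2"

text \<open>The last two arguments are the value of the assignment expression and the value stored.\<close>

inductive assign_sem :: "env \<Rightarrow> mem \<Rightarrow> addr \<Rightarrow> cval \<Rightarrow> assign \<Rightarrow> cval \<Rightarrow> cval \<Rightarrow> bool"
  for \<Gamma> m a v where
  Assign_sem: "val_cast_ok \<Gamma> m (addr_type a) v \<Longrightarrow> v' = val_cast (addr_type a) v \<Longrightarrow>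
    assign_sem \<Gamma> m a v Assign v' v'"
| PreOp_sem: "mem_lookup \<Gamma> a m = Some va \<Longrightarrow> val_binop_ok \<Gamma> m op va v \<Longrightarrow>
    val_cast_ok \<Gamma> m (addr_type a) (val_binop \<Gamma> op va v) \<Longrightarrow>
    v' = val_cast (addr_type a) (val_binop \<Gamma> op va v) \<Longrightarrow> assign_sem \<Gamma> m a v (PreOp op) v' v'"
| PostOp_sem: "mem_lookup \<Gamma> a m = Some va \<Longrightarrow> val_binop_ok \<Gamma> m op va v \<Longrightarrow>
    val_cast_ok \<Gamma> m (addr_type a) (val_binop \<Gamma> op va v) \<Longrightarrow>
    v' = val_cast (addr_type a) (val_binop \<Gamma> op va v) \<Longrightarrow> assign_sem \<Gamma> m a v (PostOp op) va v'"

type_synonym stack = "(index \<times> ctype) list"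

inductive ehstep :: "env \<Rightarrow> stack \<Rightarrow> expr \<Rightarrow> mem \<Rightarrow> expr \<Rightarrow> mem \<Rightarrow> bool" for \<Gamma> \<rho> where
  estep_var: "i < length \<rho> \<Longrightarrow> \<rho> ! i = (x, \<tau>) \<Longrightarrow>
    ehstep \<Gamma> \<rho> (EVar i) m (ELVal {} (Ptr (addr_top x \<tau>))) m"
| estep_rtol: "ehstep \<Gamma> \<rho> (ERtoL (ERVal \<Omega> (ptrV p))) m (ELVal \<Omega> p) m"
| estep_ltor: "ehstep \<Gamma> \<rho> (ELtoR (ELVal \<Omega> p)) m (ERVal \<Omega> (ptrV p)) m"
| estep_assign: "mem_writable \<Gamma> a m \<Longrightarrow> assign_sem \<Gamma> m a v ass v' va \<Longrightarrow>
    ehstep \<Gamma> \<rho> (EAssign ass (ELVal \<Omega>1 (Ptr a)) (ERVal \<Omega>2 v)) m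
      (ERVal (lock_singleton \<Gamma> a \<union> \<Omega>1 \<union> \<Omega>2) v') (mem_lock \<Gamma> a (mem_insert \<Gamma> a va m))"
| estep_load: "mem_lookup \<Gamma> a m = Some v \<Longrightarrow>
    ehstep \<Gamma> \<rho> (ELoad (ELVal \<Omega> (Ptr a))) m (ERVal \<Omega> v) (mem_force \<Gamma> a m)"
| estep_eltl: "addr_strict \<Gamma> a \<Longrightarrow>
    ehstep \<Gamma> \<rho> (EEltL (ELVal \<Omega> (Ptr a)) rs) m (ELVal \<Omega> (Ptr (addr_elt \<Gamma> rs a))) m"
| estep_eltr: "val_lookup_seg \<Gamma> rs v = Some v' \<Longrightarrow>
    ehstep \<Gamma> \<rho> (EEltR (ERVal \<Omega> v) rs) m (ERVal \<Omega> v') m"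
| estep_alloc_NULL: "ehstep \<Gamma> \<rho> (EAlloc \<tau> (ERVal \<Omega> (intV \<tau>i n))) m (ERVal \<Omega> (ptrV (NULL (TType \<tau>)))) m"
| estep_alloc: "mem_allocable x m \<Longrightarrow> 0 < n \<Longrightarrow> int_typed (n * int (size_of \<Gamma> \<tau>)) sptr_it \<Longrightarrow>
    ehstep \<Gamma> \<rho> (EAlloc \<tau> (ERVal \<Omega> (intV \<tau>i n))) m
      (ERVal \<Omega> (ptrV (Ptr (addr_top_array x \<tau> (nat n)))))
      (mem_alloc \<Gamma> x True perm_full (val_new \<Gamma> (TArray \<tau> (nat n))) m)"
| estep_free: "mem_freeable a m \<Longrightarrow>
    ehstep \<Gamma> \<rho> (EFree (ELVal \<Omega> (Ptr a))) m (ERVal \<Omega> voidV) (mem_free (addr_index a) m)"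
| estep_unop: "val_unop_ok m op v \<Longrightarrow>
    ehstep \<Gamma> \<rho> (EUnOp op (ERVal \<Omega> v)) m (ERVal \<Omega> (val_unop op v)) m"
| estep_binop: "val_binop_ok \<Gamma> m op v1 v2 \<Longrightarrow>
    ehstep \<Gamma> \<rho> (EBinOp op (ERVal \<Omega>1 v1) (ERVal \<Omega>2 v2)) m
      (ERVal (\<Omega>1 \<union> \<Omega>2) (val_binop \<Gamma> op v1 v2)) m"
| estep_if_true: "val_true m v \<Longrightarrow> ehstep \<Gamma> \<rho> (EIf (ERVal \<Omega> v) e1 e2) m e1 (mem_unlock \<Omega> m)"
| estep_if_false: "val_false m v \<Longrightarrow> ehstep \<Gamma> \<rho> (EIf (ERVal \<Omega> v) e1 e2) m e2 (mem_unlock \<Omega> m)"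
| estep_comma: "ehstep \<Gamma> \<rho> (EComma (EVal \<Omega> \<nu>) e) m e (mem_unlock \<Omega> m)"
| estep_cast: "val_cast_ok \<Gamma> m (TType \<tau>) v \<Longrightarrow>
    ehstep \<Gamma> \<rho> (ECast \<tau> (ERVal \<Omega> v)) m (ERVal \<Omega> (val_cast (TType \<tau>) v)) m"
| estep_insert: "val_lookup \<Gamma> r v2 \<noteq> None \<Longrightarrow>
    ehstep \<Gamma> \<rho> (EInsert r (ERVal \<Omega>1 v1) (ERVal \<Omega>2 v2)) m
      (ERVal (\<Omega>1 \<union> \<Omega>2) (val_alter \<Gamma> (\<lambda>_. v1) r v2)) m"

definition call_expr :: "lockset \<Rightarrow> funname \<Rightarrow> ctype list \<Rightarrow> ctype \<Rightarrow> (lockset \<times> cval) list \<Rightarrow> expr" where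
  "call_expr \<Omega> f \<tau>s \<tau> \<Omega>vs = ECall (ELVal \<Omega> (FunPtr f \<tau>s \<tau>)) (map (\<lambda>(\<Omega>', v). ERVal \<Omega>' v) \<Omega>vs)"

inductive ehsafe :: "env \<Rightarrow> stack \<Rightarrow> expr \<Rightarrow> mem \<Rightarrow> bool" for \<Gamma> \<rho> where
  ehsafe_call: "ehsafe \<Gamma> \<rho> (call_expr \<Omega> f \<tau>s \<tau> \<Omega>vs) m"
| ehsafe_step: "ehstep \<Gamma> \<rho> e1 m1 e2 m2 \<Longrightarrow> ehsafe \<Gamma> \<rho> e1 m1"

datatype sctx_item =
    CCompL stmt
  | CCompR stmt
  | CCatch
  | CLoop
  | CIfL expr stmt
  | CIfR expr stmt
  | CSwitch expr

fun sctx_item_subst :: "sctx_item \<Rightarrow> stmt \<Rightarrow> stmt" where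
  "sctx_item_subst (CCompL s2) s = SComp s s2"
| "sctx_item_subst (CCompR s1) s = SComp s1 s"
| "sctx_item_subst CCatch s = SCatch s"
| "sctx_item_subst CLoop s = SLoop s"
| "sctx_item_subst (CIfL e s2) s = SIf e s s2"
| "sctx_item_subst (CIfR e s1) s = SIf e s1 s"
| "sctx_item_subst (CSwitch e) s = SSwitch e s"

datatype esctx_item = CDoE | CReturnE | CIfE stmt stmt | CSwitchE stmt

fun esctx_item_subst :: "esctx_item \<Rightarrow> expr \<Rightarrow> stmt" where
  "esctx_item_subst CDoE e = SDo e"
| "esctx_item_subst CReturnE e = SReturn e"
| "esctx_item_subst (CIfE s1 s2) e = SIf e s1 s2"
| "esctx_item_subst (CSwitchE s) e = SSwitch e s"

datatype ctx_item =
    CStmt sctx_item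
  | CLocal index ctype
  | CExpr expr esctx_item
  | CFun ectx
  | CParams funname stack

type_synonym ctx = "ctx_item list"

fun locals :: "ctx \<Rightarrow> stack" where
  "locals [] = []"
| "locals (CStmt _ # k) = locals k"
| "locals (CExpr _ _ # k) = locals k"
| "locals (CLocal x \<tau> # k) = (x, \<tau>) # locals k"
| "locals (CParams _ x\<tau>s # k) = x\<tau>s"
| "locals (CFun _ # k) = []"

datatype direction = Down | Up | Goto labelname | Throw nat | Top cval | Switch "int option"

fun direction_in :: "direction \<Rightarrow> stmt \<Rightarrow> bool" where
  "direction_in Down s \<longleftrightarrow> True"
| "direction_in (Goto l) s \<longleftrightarrow> l \<in> labels s"
| "direction_in (Switch mx) s \<longleftrightarrow> mx \<in> cases_of s"
| "direction_in _ s \<longleftrightarrow> False"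

fun direction_out :: "direction \<Rightarrow> stmt \<Rightarrow> bool" where
  "direction_out Up s \<longleftrightarrow> True"
| "direction_out (Goto l) s \<longleftrightarrow> l \<notin> labels s"
| "direction_out (Throw n) s \<longleftrightarrow> True"
| "direction_out (Top v) s \<longleftrightarrow> True"
| "direction_out _ s \<longleftrightarrow> False"

datatype undef_state = UndefExpr ectx expr | UndefBranch expr esctx_item lockset cval

datatype focus =
    Stmt direction stmt
  | Expr expr
  | Call funname "cval list"
  | Return funname cval
  | Undef undef_state

datatype state = State ctx focus mem

inductive cstep :: "env \<Rightarrow> funenv \<Rightarrow> stack \<Rightarrow> state \<Rightarrow> state \<Rightarrow> bool" for \<Gamma> \<delta> \<rho> where
  cstep_skip: "cstep \<Gamma> \<delta> \<rho> (State k (Stmt Down SSkip) m) (State k (Stmt Up SSkip) m)"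
| cstep_goto: "cstep \<Gamma> \<delta> \<rho> (State k (Stmt Down (SGoto l)) m) (State k (Stmt (Goto l) (SGoto l)) m)"
| cstep_throw: "cstep \<Gamma> \<delta> \<rho> (State k (Stmt Down (SThrow n)) m) (State k (Stmt (Throw n) (SThrow n)) m)"
| cstep_in_label: "cstep \<Gamma> \<delta> \<rho> (State k (Stmt Down (SLabel l)) m) (State k (Stmt Up (SLabel l)) m)"
| cstep_in_case: "cstep \<Gamma> \<delta> \<rho> (State k (Stmt Down (SCase mx)) m) (State k (Stmt Up (SCase mx)) m)"
| cstep_in_expr: "cstep \<Gamma> \<delta> \<rho> (State k (Stmt Down (esctx_item_subst E e)) m)
    (State (CExpr e E # k) (Expr e) m)"

| cstep_expr_head: "ehstep \<Gamma> (locals k @ \<rho>) e1 m1 e2 m2 \<Longrightarrow>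
    cstep \<Gamma> \<delta> \<rho> (State k (Expr (ectx_subst E e1)) m1) (State k (Expr (ectx_subst E e2)) m2)"
| cstep_expr_call: "cstep \<Gamma> \<delta> \<rho> (State k (Expr (ectx_subst E (call_expr \<Omega> f \<tau>s \<tau> \<Omega>vs))) m)
    (State (CFun E # k) (Call f (map snd \<Omega>vs)) (mem_unlock (\<Omega> \<union> \<Union> (set (map fst \<Omega>vs))) m))"
| cstep_expr_undef: "is_redex e \<Longrightarrow> \<not> ehsafe \<Gamma> (locals k @ \<rho>) e m \<Longrightarrow>
    cstep \<Gamma> \<delta> \<rho> (State k (Expr (ectx_subst E e)) m) (State k (Undef (UndefExpr E e)) m)"

| cstep_expr_do: "cstep \<Gamma> \<delta> \<rho> (State (CExpr e CDoE # k) (Expr (EVal \<Omega> \<nu>)) m)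
    (State k (Stmt Up (SDo e)) (mem_unlock \<Omega> m))"
| cstep_expr_ret: "cstep \<Gamma> \<delta> \<rho> (State (CExpr e CReturnE # k) (Expr (ERVal \<Omega> v)) m)
    (State k (Stmt (Top v) (SReturn e)) (mem_unlock \<Omega> m))"
| cstep_expr_if_true: "val_true m v \<Longrightarrow>
    cstep \<Gamma> \<delta> \<rho> (State (CExpr e (CIfE s1 s2) # k) (Expr (ERVal \<Omega> v)) m)
      (State (CStmt (CIfL e s2) # k) (Stmt Down s1) (mem_unlock \<Omega> m))"
| cstep_expr_if_false: "val_false m v \<Longrightarrow>
    cstep \<Gamma> \<delta> \<rho> (State (CExpr e (CIfE s1 s2) # k) (Expr (ERVal \<Omega> v)) m)
      (State (CStmt (CIfR e s1) # k) (Stmt Down s2) (mem_unlock \<Omega> m))"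
| cstep_expr_if_indet: "\<not> val_branchable m v \<Longrightarrow>
    cstep \<Gamma> \<delta> \<rho> (State (CExpr e (CIfE s1 s2) # k) (Expr (ERVal \<Omega> v)) m)
      (State k (Undef (UndefBranch e (CIfE s1 s2) \<Omega> v)) m)"
| cstep_expr_switch_case: "Some x \<in> cases_of s \<Longrightarrow>
    cstep \<Gamma> \<delta> \<rho> (State (CExpr e (CSwitchE s) # k) (Expr (ERVal \<Omega> (intV \<tau>i x))) m)
      (State (CStmt (CSwitch e) # k) (Stmt (Switch (Some x)) s) (mem_unlock \<Omega> m))"
| cstep_expr_switch_default: "Some x \<notin> cases_of s \<Longrightarrow> None \<in> cases_of s \<Longrightarrow>
    cstep \<Gamma> \<delta> \<rho> (State (CExpr e (CSwitchE s) # k) (Expr (ERVal \<Omega> (intV \<tau>i x))) m)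
      (State (CStmt (CSwitch e) # k) (Stmt (Switch None) s) (mem_unlock \<Omega> m))"
| cstep_expr_switch_out: "Some x \<notin> cases_of s \<Longrightarrow> None \<notin> cases_of s \<Longrightarrow>
    cstep \<Gamma> \<delta> \<rho> (State (CExpr e (CSwitchE s) # k) (Expr (ERVal \<Omega> (intV \<tau>i x))) m)
      (State k (Stmt Up (SSwitch e s)) (mem_unlock \<Omega> m))"
| cstep_expr_switch_indet: "\<not> val_branchable m v \<Longrightarrow>
    cstep \<Gamma> \<delta> \<rho> (State (CExpr e (CSwitchE s) # k) (Expr (ERVal \<Omega> v)) m)
      (State k (Undef (UndefBranch e (CSwitchE s) \<Omega> v)) m)"

| cstep_in_comp: "cstep \<Gamma> \<delta> \<rho> (State k (Stmt Down (SComp s1 s2)) m)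
    (State (CStmt (CCompL s2) # k) (Stmt Down s1) m)"
| cstep_out_comp1: "cstep \<Gamma> \<delta> \<rho> (State (CStmt (CCompL s2) # k) (Stmt Up s1) m)
    (State (CStmt (CCompR s1) # k) (Stmt Down s2) m)"
| cstep_out_comp2: "cstep \<Gamma> \<delta> \<rho> (State (CStmt (CCompR s1) # k) (Stmt Up s2) m)
    (State k (Stmt Up (SComp s1 s2)) m)"
| cstep_in_catch: "cstep \<Gamma> \<delta> \<rho> (State k (Stmt Down (SCatch s)) m)
    (State (CStmt CCatch # k) (Stmt Down s) m)"
| cstep_out_catch: "cstep \<Gamma> \<delta> \<rho> (State (CStmt CCatch # k) (Stmt Up s) m)
    (State k (Stmt Up (SCatch s)) m)"
| cstep_in_loop: "cstep \<Gamma> \<delta> \<rho> (State k (Stmt Down (SLoop s)) m)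
    (State (CStmt CLoop # k) (Stmt Down s) m)"
| cstep_out_loop: "cstep \<Gamma> \<delta> \<rho> (State (CStmt CLoop # k) (Stmt Up s) m)
    (State k (Stmt Down (SLoop s)) m)"
| cstep_out_if1: "cstep \<Gamma> \<delta> \<rho> (State (CStmt (CIfL e s2) # k) (Stmt Up s1) m)
    (State k (Stmt Up (SIf e s1 s2)) m)"
| cstep_out_if2: "cstep \<Gamma> \<delta> \<rho> (State (CStmt (CIfR e s1) # k) (Stmt Up s2) m)
    (State k (Stmt Up (SIf e s1 s2)) m)"
| cstep_out_switch: "cstep \<Gamma> \<delta> \<rho> (State (CStmt (CSwitch e) # k) (Stmt Up s) m)
    (State k (Stmt Up (SSwitch e s)) m)"

| cstep_call: "fmlookup \<delta> f = Some s \<Longrightarrow> mem_allocable_list m xs \<Longrightarrow> length xs = length vs \<Longrightarrow>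
    cstep \<Gamma> \<delta> \<rho> (State k (Call f vs) m)
      (State (CParams f (zip xs (map val_type vs)) # k) (Stmt Down s) (mem_alloc_list \<Gamma> xs vs m))"
| cstep_free_params: "cstep \<Gamma> \<delta> \<rho> (State (CParams f x\<tau>s # k) (Stmt Up s) m)
    (State k (Return f voidV) (foldr mem_free (map fst x\<tau>s) m))"
| cstep_free_params_top: "cstep \<Gamma> \<delta> \<rho> (State (CParams f x\<tau>s # k) (Stmt (Top v) s) m)
    (State k (Return f v) (foldr mem_free (map fst x\<tau>s) m))"
| cstep_return: "cstep \<Gamma> \<delta> \<rho> (State (CFun E # k) (Return f v) m)
    (State k (Expr (ectx_subst E (ERVal {} v))) m)"

| cstep_label_here: "cstep \<Gamma> \<delta> \<rho> (State k (Stmt (Goto l) (SLabel l)) m) (State k (Stmt Up (SLabel l)) m)"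
| cstep_case_here: "cstep \<Gamma> \<delta> \<rho> (State k (Stmt (Switch mx) (SCase mx)) m) (State k (Stmt Up (SCase mx)) m)"
| cstep_throw_here: "cstep \<Gamma> \<delta> \<rho> (State (CStmt CCatch # k) (Stmt (Throw 0) s) m)
    (State k (Stmt Up (SCatch s)) m)"
| cstep_throw_further: "cstep \<Gamma> \<delta> \<rho> (State (CStmt CCatch # k) (Stmt (Throw (Suc n)) s) m)
    (State k (Stmt (Throw n) (SCatch s)) m)"
| cstep_goto_in: "l \<in> labels s \<Longrightarrow>
    cstep \<Gamma> \<delta> \<rho> (State k (Stmt (Goto l) (sctx_item_subst E s)) m)
      (State (CStmt E # k) (Stmt (Goto l) s) m)"
| cstep_switch_in: "(\<And>e. E \<noteq> CSwitch e) \<Longrightarrow> mx \<in> cases_of s \<Longrightarrow>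
    cstep \<Gamma> \<delta> \<rho> (State k (Stmt (Switch mx) (sctx_item_subst E s)) m)
      (State (CStmt E # k) (Stmt (Switch mx) s) m)"
| cstep_top_out: "cstep \<Gamma> \<delta> \<rho> (State (CStmt E # k) (Stmt (Top v) s) m)
    (State k (Stmt (Top v) (sctx_item_subst E s)) m)"
| cstep_goto_out: "l \<notin> labels s \<Longrightarrow>
    cstep \<Gamma> \<delta> \<rho> (State (CStmt E # k) (Stmt (Goto l) s) m)
      (State k (Stmt (Goto l) (sctx_item_subst E s)) m)"
| cstep_throw_out: "E \<noteq> CCatch \<Longrightarrow>
    cstep \<Gamma> \<delta> \<rho> (State (CStmt E # k) (Stmt (Throw n) s) m)
      (State k (Stmt (Throw n) (sctx_item_subst E s)) m)"

| cstep_in_block: "direction_in d s \<Longrightarrow> mem_allocable x m \<Longrightarrow>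
    cstep \<Gamma> \<delta> \<rho> (State k (Stmt d (SLocal \<tau> s)) m)
      (State (CLocal x \<tau> # k) (Stmt d s) (mem_alloc \<Gamma> x False perm_full (val_new \<Gamma> \<tau>) m))"
| cstep_out_block: "direction_out d s \<Longrightarrow>
    cstep \<Gamma> \<delta> \<rho> (State (CLocal x \<tau> # k) (Stmt d s) m) (State k (Stmt d (SLocal \<tau> s)) (mem_free x m))"

abbreviation csteps :: "env \<Rightarrow> funenv \<Rightarrow> stack \<Rightarrow> state \<Rightarrow> state \<Rightarrow> bool" where
  "csteps \<Gamma> \<delta> \<rho> \<equiv> (cstep \<Gamma> \<delta> \<rho>)\<^sup>*\<^sup>*"


section \<open>Big-step semantics\<close>

type_synonym store = "int option list"

definition in_range :: "int \<Rightarrow> bool" where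
  "in_range z \<longleftrightarrow> - (2 ^ 31) \<le> z \<and> z \<le> 2 ^ 31 - 1"

abbreviation lit :: "int \<Rightarrow> expr" where "lit z \<equiv> ERVal {} (intV sint_it z)"

fun bs_binop :: "binop \<Rightarrow> int \<Rightarrow> int \<Rightarrow> int option" where
  "bs_binop (ArithOp PlusOp) z1 z2 = Some (z1 + z2)"
| "bs_binop (ArithOp MinusOp) z1 z2 = Some (z1 - z2)"
| "bs_binop (ArithOp DivOp) z1 z2 = (if z2 = 0 then None else Some (z1 sdiv z2))"
| "bs_binop (CompOp c) z1 z2 = Some (of_bool (compop_sem c z1 z2))"
| "bs_binop _ z1 z2 = None"

inductive eval :: "store \<Rightarrow> expr \<Rightarrow> int \<Rightarrow> bool" for \<sigma> where
  eval_lit: "in_range z \<Longrightarrow> eval \<sigma> (lit z) z"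
| eval_var: "i < length \<sigma> \<Longrightarrow> \<sigma> ! i = Some z \<Longrightarrow> eval \<sigma> (ELoad (EVar i)) z"
| eval_not: "eval \<sigma> e z \<Longrightarrow> eval \<sigma> (EUnOp NotOp e) (if z = 0 then 1 else 0)"
| eval_binop: "eval \<sigma> e1 z1 \<Longrightarrow> eval \<sigma> e2 z2 \<Longrightarrow> bs_binop op z1 z2 = Some r \<Longrightarrow> in_range r \<Longrightarrow>
    eval \<sigma> (EBinOp op e1 e2) r"

datatype outcome = ONormal store | OReturn int | OThrow nat store

definition abnormal :: "outcome \<Rightarrow> bool" where
  "abnormal out \<longleftrightarrow> (\<forall>\<sigma>. out \<noteq> ONormal \<sigma>)"

definition nothrown :: "outcome \<Rightarrow> bool" where
  "nothrown out \<longleftrightarrow> (\<forall>n \<sigma>. out \<noteq> OThrow n \<sigma>)"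

inductive exec :: "store \<Rightarrow> stmt \<Rightarrow> outcome \<Rightarrow> bool" where
  exec_skip: "exec \<sigma> SSkip (ONormal \<sigma>)"
| exec_comp: "exec \<sigma> s1 (ONormal \<sigma>') \<Longrightarrow> exec \<sigma>' s2 out \<Longrightarrow> exec \<sigma> (SComp s1 s2) out"
| exec_comp_abnormal: "abnormal out \<Longrightarrow> exec \<sigma> s1 out \<Longrightarrow> exec \<sigma> (SComp s1 s2) out"
| exec_local: "exec (None # \<sigma>) s (ONormal (mv # \<sigma>')) \<Longrightarrow> exec \<sigma> (SLocal sint s) (ONormal \<sigma>')"
| exec_local_return: "exec (None # \<sigma>) s (OReturn z) \<Longrightarrow> exec \<sigma> (SLocal sint s) (OReturn z)"
| exec_local_throw: "exec (None # \<sigma>) s (OThrow n (mv # \<sigma>')) \<Longrightarrow>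
    exec \<sigma> (SLocal sint s) (OThrow n \<sigma>')"
| exec_assign: "i < length \<sigma> \<Longrightarrow> eval \<sigma> e z \<Longrightarrow>
    exec \<sigma> (SDo (EAssign Assign (EVar i) (ECast sint e))) (ONormal (\<sigma>[i := Some z]))"
| exec_assign_void: "i < length \<sigma> \<Longrightarrow> eval \<sigma> e z \<Longrightarrow>
    exec \<sigma> (SDo (ECast voidT (EAssign Assign (EVar i) e))) (ONormal (\<sigma>[i := Some z]))"
| exec_if: "eval \<sigma> e z \<Longrightarrow> exec \<sigma> (if z = 0 then s2 else s1) out \<Longrightarrow> exec \<sigma> (SIf e s1 s2) out"
| exec_throw: "exec \<sigma> (SThrow n) (OThrow n \<sigma>)"
| exec_catch_here: "exec \<sigma> s (OThrow 0 \<sigma>') \<Longrightarrow> exec \<sigma> (SCatch s) (ONormal \<sigma>')"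
| exec_catch_further: "exec \<sigma> s (OThrow (Suc n) \<sigma>') \<Longrightarrow> exec \<sigma> (SCatch s) (OThrow n \<sigma>')"
| exec_catch_nothrown: "nothrown out \<Longrightarrow> exec \<sigma> s out \<Longrightarrow> exec \<sigma> (SCatch s) out"
| exec_loop_abnormal: "abnormal out \<Longrightarrow> exec \<sigma> s out \<Longrightarrow> exec \<sigma> (SLoop s) out"
| exec_loop: "abnormal out \<Longrightarrow> exec \<sigma> s (ONormal \<sigma>') \<Longrightarrow> exec \<sigma>' (SLoop s) out \<Longrightarrow>
    exec \<sigma> (SLoop s) out"
| exec_ret: "eval \<sigma> e z \<Longrightarrow> exec \<sigma> (SReturn (ECast sint e)) (OReturn z)"

coinductive execinf :: "store \<Rightarrow> stmt \<Rightarrow> bool" where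
  execinf_comp1: "execinf \<sigma> s1 \<Longrightarrow> execinf \<sigma> (SComp s1 s2)"
| execinf_comp2: "exec \<sigma> s1 (ONormal \<sigma>') \<Longrightarrow> execinf \<sigma>' s2 \<Longrightarrow> execinf \<sigma> (SComp s1 s2)"
| execinf_local: "execinf (None # \<sigma>) s \<Longrightarrow> execinf \<sigma> (SLocal sint s)"
| execinf_if: "eval \<sigma> e z \<Longrightarrow> execinf \<sigma> (if z = 0 then s2 else s1) \<Longrightarrow> execinf \<sigma> (SIf e s1 s2)"
| execinf_catch: "execinf \<sigma> s \<Longrightarrow> execinf \<sigma> (SCatch s)"
| execinf_loop1: "execinf \<sigma> s \<Longrightarrow> execinf \<sigma> (SLoop s)"
| execinf_loop2: "exec \<sigma> s (ONormal \<sigma>') \<Longrightarrow> execinf \<sigma>' (SLoop s) \<Longrightarrow> execinf \<sigma> (SLoop s)"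


section \<open>Correctness\<close>

definition CHcorrect :: "nat \<Rightarrow> stmt \<Rightarrow> store \<Rightarrow> bool" where
  "CHcorrect n s \<sigma> \<longleftrightarrow>
    (length \<sigma> = n \<and> (\<forall>z. Some z \<in> set \<sigma> \<longrightarrow> in_range z) \<longrightarrow>
      (\<exists>z. exec \<sigma> s (OReturn z)) \<or> execinf \<sigma> s)"

definition SScorrect :: "env \<Rightarrow> funenv \<Rightarrow> funname \<Rightarrow> stmt \<Rightarrow> bool" where
  "SScorrect \<Gamma> \<delta> f s \<longleftrightarrow>
    (\<forall>S. env_valid \<Gamma> \<longrightarrow> funenv_valid \<Gamma> fmempty \<delta> \<longrightarrow>
      stmt_typed \<Gamma> fmempty [] s (True, Some sint) \<longrightarrow>
      csteps \<Gamma> \<delta> [] (State [CParams f []] (Stmt Down s) fmempty) S \<longrightarrow>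
      (\<exists>S'. cstep \<Gamma> \<delta> [] S S') \<or> (\<exists>m z. S = State [] (Return f (intV sint_it z)) m))"

end

theory Submission
  imports Defs
begin

text \<open>
  Reachable states cannot get stuck if the initial state is safe for every number \<open>n\<close> of steps.  A
  terminating big-step execution reduces safety for \<open>n\<close> steps of the state entering a statement
  to safety of the states leaving it, whatever evaluation order and fresh object identifiers are
  chosen; this is an induction on the big-step derivation.  A diverging execution is safe for \<open>n\<close>
  steps by induction on \<open>n\<close>, as each rule of the coinductive divergence predicate spends at
  least one small step before its coinductive premise is used.
\<close>

subsection \<open>Integer cells in memory\<close>

text \<open>Safety therefore quantifies over all successors, and an invariant on partially evaluated
  expressions takes the place of a chosen evaluation order; the step bound stands in for a
  termination measure of expression evaluation. The two inductions meet where a terminating part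
  precedes divergence, in sequences and loops. They fit because bounded safety is monotone in the
  bound: the steps of a terminating part are not charged, so it is traversed at a fixed bound, and
  only the step that enters the compound statement lowers it. The other obstacle is locking. An
  assignment leaves its target locked until the end of the full expression, so from the write to
  that point the memory is out of step with the big-step store. The invariant for assignments names
  this locked memory explicitly, and releasing the lock set restores the correspondence.\<close>

definition cell :: "int option \<Rightarrow> mtree" where
  "cell mv = MBase (TInt sint_it) (map (PBit perm_full)
    (case mv of None \<Rightarrow> replicate 32 BIndet | Some z \<Rightarrow> map BBit (int_to_bits sint_it z)))"

text \<open>Only the objects of visible locals are constrained; the memory may hold others, such as
  freed ones. Distinct identifiers keep a write to one local away from the rest, and the range
  condition makes the 32 stored bits decode to the stored integer. A \<open>cell\<close> has full,
  hence unlocked, permission on every bit.\<close>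

definition models :: "mem \<Rightarrow> stack \<Rightarrow> store \<Rightarrow> bool" where
  "models m ls \<sigma> \<longleftrightarrow> distinct (map fst ls) \<and>
    list_all2 (\<lambda>(x, \<tau>) mv. \<tau> = sint \<and> fmlookup m x = Some (Obj (cell mv) False)) ls \<sigma> \<and>
    (\<forall>z. Some z \<in> set \<sigma> \<longrightarrow> in_range z)"

lemma int_typed_sint [simp]: "int_typed z sint_it \<longleftrightarrow> in_range z"
  by (auto simp: int_typed_def in_range_def int_lower_def int_upper_def int_width_def char_bits_def)

lemma int_width_sint [simp]: "int_width sint_it = 32"
  by (simp add: int_width_def char_bits_def)

lemma length_int_to_bits_sint [simp]: "length (int_to_bits sint_it z) = 32"
  by (simp add: int_to_bits_def)

lemma size_of_sint [simp]: "size_of \<Gamma> sint = 4" "bit_size_of \<Gamma> sint = 32"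
  by (simp_all add: size_of_def bit_size_of_def char_bits_def)

lemma signed_take_bit_31:
  assumes "in_range z"
  shows "signed_take_bit 31 z = z"
  using assms by (intro signed_take_bit_int_eq_self) (auto simp: in_range_def)

text \<open>The stored bits are the low 32 bits of \<open>z\<close>. Sign extension from bit 31
  looks at no higher bit, so the truncation is invisible to it, and on integers in range it is the
  identity.\<close>

lemma int_of_bits_to_bits_sint:
  assumes "in_range z"
  shows "int_of_bits sint_it (int_to_bits sint_it z) = z"
proof -
  have "signed_take_bit 31 (take_bit 32 z) = signed_take_bit 31 z"
    by (simp add: signed_take_bit_take_bit)
  then show ?thesis
    using signed_take_bit_31[OF assms]
    by (simp add: int_of_bits_def int_to_bits_def horner_sum_bit_eq_take_bit del: upt_rec_numeral)
qed

lemma mtree_flatten_cell: "length (mtree_flatten (cell mv)) = 32"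
  "xb \<in> set (mtree_flatten (cell mv)) \<Longrightarrow> pbit_perm xb = perm_full"
  by (auto simp: cell_def split: option.splits)

lemma to_val_cell:
  assumes "in_range z"
  shows "to_val \<Gamma> (cell (Some z)) = intV sint_it z"
proof -
  have "map ((\<lambda>b. b = BBit True) \<circ> BBit) (int_to_bits sint_it z) = int_to_bits sint_it z"
    by (simp add: comp_def)
  then show ?thesis
    using int_of_bits_to_bits_sint[OF assms]
    by (simp add: cell_def list_all_length is_BBit_def comp_def)
qed

lemma map2_replicate_left: "length ys = n \<Longrightarrow> map2 g (replicate n x) ys = map (g x) ys"
  by (induction ys arbitrary: n) auto

lemma of_val_int: "of_val \<Gamma> (replicate 32 perm_full) (intV sint_it z) = cell (Some z)"
  by (simp add: cell_def map2_replicate_left)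

lemma of_val_new: "of_val \<Gamma> (replicate 32 perm_full) (val_new \<Gamma> sint) = cell None"
  by (simp add: cell_def val_new_def map2_replicate_left)

lemma val_type_new_sint: "val_type (val_new \<Gamma> sint) = sint"
  by (simp add: val_new_def)

text \<open>\<open>mem_insert\<close> keeps the permissions found in the old object. As these are
  all full, overwriting a cell gives a cell again.\<close>

lemma perms_cell: "map pbit_perm (mtree_flatten (cell mv)) = replicate 32 perm_full"
  by (intro replicate_eqI) (auto simp: mtree_flatten_cell)

section \<open>Access through addresses of whole objects\<close>

lemma addr_top_simps [simp]:
  "addr_index (addr_top x \<tau>) = x" "addr_type (addr_top x \<tau>) = TType \<tau>"
  "addr_is_obj (addr_top x \<tau>)" "addr_ref \<Gamma> (addr_top x \<tau>) = []"
  "addr_strict \<Gamma> (addr_top x sint)"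
  "addr_object_offset \<Gamma> (addr_top x \<tau>) = 0"
  by (simp_all add: addr_top_def addr_is_obj_def addr_ref_def addr_strict_def
      addr_object_offset_def ref_object_offset_def)

lemma mem_lookup_cell:
  assumes "fmlookup m x = Some (Obj (cell (Some z)) \<mu>)" "in_range z"
  shows "mem_lookup \<Gamma> (addr_top x sint) m = Some (intV sint_it z)"
proof -
  have "mtree_forall pbit_readable (cell (Some z))"
    using mtree_flatten_cell(2)
    by (fastforce simp: mtree_forall_def list_all_iff pbit_readable_def perm_full_def)
  then show ?thesis
    using assms by (simp add: mem_lookup_def cmap_lookup_def to_val_cell)
qed

text \<open>A load also applies \<open>mem_force\<close>, which can only switch union variants along
  the reference of the address. Here the reference is empty, so loads leave the memory
  unchanged.\<close>

lemma mem_force_top: "mem_force \<Gamma> (addr_top x \<tau>) m = m"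
proof (cases "fmlookup m x")
  case (Some obj)
  then have "fmupd x obj m = m"
    by (intro fmap_ext) auto
  then show ?thesis
    using Some by (cases obj) (simp_all add: mem_force_def cmap_alter_def)
qed (simp add: mem_force_def cmap_alter_def)

lemma mem_writable_cell:
  assumes "fmlookup m x = Some (Obj (cell mv) \<mu>)"
  shows "mem_writable \<Gamma> (addr_top x sint) m"
proof -
  have "mtree_forall pbit_writable (cell mv)"
    using mtree_flatten_cell(2)
    by (fastforce simp: mtree_forall_def list_all_iff pbit_writable_def perm_full_def)
  then show ?thesis
    using assms by (simp add: mem_writable_def cmap_lookup_def)
qed

lemma mem_insert_cell:
  assumes "fmlookup m x = Some (Obj (cell mv) \<mu>)"
  shows "mem_insert \<Gamma> (addr_top x sint) (intV sint_it z) m = fmupd x (Obj (cell (Some z)) \<mu>) m"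
  using assms by (simp add: mem_insert_def cmap_alter_def perms_cell of_val_int del: of_val.simps)

section \<open>Locks taken by an assignment and their release\<close>

lemma unlock_lock_perm_full:
  "pbit_unlock (pbit_lock (PBit perm_full b)) = PBit perm_full b"
  by (simp add: pbit_unlock_def pbit_lock_def perm_full_def)

lemma mtree_imap_inverse:
  assumes "\<And>i. i < length xs \<Longrightarrow> f i (g i (xs ! i)) = xs ! i"
  shows "mtree_imap f 0 (mtree_imap g 0 (MBase \<tau>b xs)) = MBase \<tau>b xs"
  using assms by (auto intro: nth_equalityI)

text \<open>Locking keeps the counter and the fraction of a permission, so unlocking inverts it on
  unlocked bits. \<open>P\<close> stands for membership in a lock set, which must cover all 32
  bits.\<close>

lemma unlock_lock_cell:
  assumes "\<And>i. i < 32 \<Longrightarrow> P i"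
  shows "mtree_imap (\<lambda>i xb. if P i then pbit_unlock xb else xb) 0 (mtree_imap (\<lambda>_. pbit_lock) 0 (cell mv))
    = cell mv"
proof -
  define bs where "bs = (case mv of None \<Rightarrow> replicate 32 BIndet | Some z \<Rightarrow> map BBit (int_to_bits sint_it z))"
  have "length bs = 32"
    by (auto simp: bs_def split: option.split)
  then show ?thesis
    unfolding cell_def bs_def[symmetric]
    using assms by (intro mtree_imap_inverse) (simp add: unlock_lock_perm_full)
qed

lemma map2_upt_id: "(\<And>i x. g i x = x) \<Longrightarrow> map2 g [i..<i + length xs] xs = xs"
  by (auto intro: nth_equalityI)

lemma mtree_imap_id:
  "(\<And>i xb. g i xb = xb) \<Longrightarrow> mtree_imap g j w = w"
  "(\<And>i xb. g i xb = xb) \<Longrightarrow> mtrees_imap g j ws = ws"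
  "(\<And>i xb. g i xb = xb) \<Longrightarrow> mfields_imap g j wxs = wxs"
  by (induction g j w and g j ws and g j wxs rule: mtree_imap_mtrees_imap_mfields_imap.induct)
    (simp_all only: mtree_imap.simps mtrees_imap.simps mfields_imap.simps Let_def map2_upt_id)

lemma mem_unlock_other:
  assumes "\<And>i. (x, i) \<notin> \<Omega>"
  shows "fmlookup (mem_unlock \<Omega> m) x = fmlookup m x"
proof (cases "fmlookup m x")
  case (Some obj)
  then show ?thesis
    using assms by (cases obj) (simp_all add: mem_unlock_def mtree_imap_id)
qed (simp add: mem_unlock_def)

lemma mem_unlock_empty: "mem_unlock {} m = m"
  by (intro fmap_ext mem_unlock_other) simp

lemma lock_singleton_top:
  "lock_singleton \<Gamma> (addr_top x sint) = {x} \<times> {0..<32}"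
  by (simp add: lock_singleton_def ptr_size_of_def char_bits_def)

lemma mem_lock_top:
  "mem_lock \<Gamma> (addr_top x \<tau>) (fmupd x (Obj w \<mu>) m) = fmupd x (Obj (mtree_imap (\<lambda>_. pbit_lock) 0 w) \<mu>) m"
  by (simp add: mem_lock_def cmap_alter_def)

text \<open>The lock set of an assignment consists of exactly the 32 bits of the target, so its
  release undoes the locking there and touches no other object.\<close>

lemma mem_unlock_lock:
  "mem_unlock (lock_singleton \<Gamma> (addr_top x sint)) (mem_lock \<Gamma> (addr_top x sint)
    (fmupd x (Obj (cell mv) \<mu>) m)) = fmupd x (Obj (cell mv) \<mu>) m" (is "?l = ?r")
proof (rule fmap_ext)
  fix y
  show "fmlookup ?l y = fmlookup ?r y"
  proof (cases "y = x")
    case True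
    have "mtree_imap (\<lambda>i xb. if (x, i) \<in> {x} \<times> {0..<32} then pbit_unlock xb else xb) 0
        (mtree_imap (\<lambda>_. pbit_lock) 0 (cell mv)) = cell mv"
      by (rule unlock_lock_cell) simp
    then show ?thesis
      unfolding True lock_singleton_top mem_lock_top mem_unlock_def fmlookup_fmmap_keys fmupd_lookup
      by (simp only: if_True option.map mobj.case simp_thms)
  next
    case False
    then have "fmlookup ?l y = fmlookup (fmupd x (Obj (mtree_imap (\<lambda>_. pbit_lock) 0 (cell mv)) \<mu>) m) y"
      unfolding lock_singleton_top mem_lock_top by (intro mem_unlock_other) simp
    then show ?thesis
      using False by simp
  qed
qed

section \<open>Stores under assignment, allocation and freeing\<close>

lemma models_iff:
  "models m ls \<sigma> \<longleftrightarrow> distinct (map fst ls) \<and> length ls = length \<sigma> \<and>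
    (\<forall>i < length \<sigma>. snd (ls ! i) = sint \<and> fmlookup m (fst (ls ! i)) = Some (Obj (cell (\<sigma> ! i)) False)) \<and>
    (\<forall>z. Some z \<in> set \<sigma> \<longrightarrow> in_range z)"
  by (auto simp: models_def list_all2_conv_all_nth split_beta)

lemma models_nthD:
  assumes "models m ls \<sigma>" "i < length \<sigma>"
  obtains x where "i < length ls" "ls ! i = (x, sint)" "fmlookup m x = Some (Obj (cell (\<sigma> ! i)) False)"
  using assms by (cases "ls ! i") (auto simp: models_iff)

lemma models_update:
  assumes "models m ls \<sigma>" "i < length \<sigma>" "ls ! i = (x, \<tau>)" "in_range z"
  shows "models (fmupd x (Obj (cell (Some z)) False) m) ls (\<sigma>[i := Some z])"
proof -
  have "fst (ls ! j) \<noteq> x" if "j < length \<sigma>" "j \<noteq> i" for j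
  proof -
    have "map fst ls ! j \<noteq> map fst ls ! i"
      using assms(1,2) that nth_eq_iff_index_eq[of "map fst ls" j i] by (simp add: models_iff)
    then show ?thesis
      using assms(1-3) that by (simp add: models_iff)
  qed
  moreover have "in_range z'" if "Some z' \<in> set (\<sigma>[i := Some z])" for z'
    using assms(1,4) set_update_subset_insert[of \<sigma> i "Some z"] that by (auto simp: models_iff)
  ultimately show ?thesis
    using assms by (auto simp: models_iff nth_list_update)
qed

lemma models_alloc:
  assumes "models m ls \<sigma>" "mem_allocable x m"
  shows "models (mem_alloc \<Gamma> x False perm_full (val_new \<Gamma> sint) m) ((x, sint) # ls) (None # \<sigma>)"
proof -
  \<comment> \<open>Every local has an entry in \<open>m\<close> and the fresh \<open>x\<close> has
    none; this yields both distinctness and the survival of the old cells.\<close>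
  have *: "fst (ls ! i) \<noteq> x" if "i < length \<sigma>" for i
    using assms that by (auto simp: models_iff mem_allocable_def)
  then have "x \<notin> set (map fst ls)"
    using assms(1) by (auto simp: models_iff in_set_conv_nth simp del: set_map)
  moreover have "mem_alloc \<Gamma> x False perm_full (val_new \<Gamma> sint) m = fmupd x (Obj (cell None) False) m"
    by (simp only: mem_alloc_def val_type_new_sint size_of_sint of_val_new)
  ultimately show ?thesis
    using assms(1) * by (simp add: models_iff nth_Cons less_Suc_eq_0_disj split: nat.split) auto
qed

lemma models_free:
  assumes "models m ((x, \<tau>) # ls) (mv # \<sigma>)"
  shows "models (mem_free x m) ls \<sigma>"
proof -
  have free: "fmlookup (mem_free x m) y = fmlookup m y" if "y \<noteq> x" for y
    using that by (simp add: mem_free_def split: option.split mobj.split)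
  have nth: "snd (ls ! i) = sint \<and> fmlookup m (fst (ls ! i)) = Some (Obj (cell (\<sigma> ! i)) False)"
    if "i < length \<sigma>" for i
    using assms that unfolding models_iff by (auto dest: spec[of _ "Suc i"])
  have "fst (ls ! i) \<noteq> x" if "i < length \<sigma>" for i
    using assms that nth_mem[of i ls] by (auto simp: models_iff)
  then show ?thesis
    using assms free nth by (simp add: models_iff)
qed

subsection \<open>Expression contexts\<close>

lemma ectx_subst_Nil [simp]: "ectx_subst [] e = e"
  by (simp add: ectx_subst_def)

lemma ectx_subst_snoc [simp]: "ectx_subst (E @ [i]) e = ectx_item_subst i (ectx_subst E e)"
  by (simp add: ectx_subst_def)

text \<open>Contexts list the innermost item first, so splitting off the last item exposes the root
  constructor of the expression.\<close>

lemma ectx_subst_cases: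
  assumes "ectx_subst E e' = e"
  obtains "E = []" "e' = e"
  | E' i where "E = E' @ [i]" "ectx_item_subst i (ectx_subst E' e') = e"
  using assms by (cases E rule: rev_cases) auto

lemma ehstep_redex: "ehstep \<Gamma> \<rho> e m e' m' \<Longrightarrow> is_redex e"
  by (induction rule: ehstep.induct) (auto simp: is_nf_def)

lemma is_redex_call_expr: "is_redex (call_expr \<Omega> f \<tau>s \<tau> \<Omega>vs)"
  by (auto simp: call_expr_def is_nf_def list_all_iff)

text \<open>Quantifying over all decompositions covers every evaluation order.\<close>

definition steps_within :: "env \<Rightarrow> stack \<Rightarrow> (expr \<Rightarrow> mem \<Rightarrow> bool) \<Rightarrow> expr \<Rightarrow> mem \<Rightarrow> bool" where
  "steps_within \<Gamma> ls Q e m \<longleftrightarrow>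
    (\<exists>E e1. ectx_subst E e1 = e \<and> is_redex e1) \<and>
    (\<forall>E e1. ectx_subst E e1 = e \<longrightarrow> is_redex e1 \<longrightarrow>
      (\<forall>\<Omega> f \<tau>s \<tau> \<Omega>vs. e1 \<noteq> call_expr \<Omega> f \<tau>s \<tau> \<Omega>vs) \<and> (\<exists>e2 m'. ehstep \<Gamma> ls e1 m e2 m') \<and>
      (\<forall>e2 m'. ehstep \<Gamma> ls e1 m e2 m' \<longrightarrow> Q (ectx_subst E e2) m'))"

text \<open>With no redex strictly below the root, the trivial decomposition is the only one, and
  the claim reduces to head steps of the whole expression. Function calls are excluded, as they
  leave the expression focus.\<close>

lemma steps_within_redex:
  assumes "is_redex e" "\<And>E e1 i. ectx_item_subst i (ectx_subst E e1) = e \<Longrightarrow> \<not> is_redex e1"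
    and "\<And>e1 es. e \<noteq> ECall e1 es" "ehstep \<Gamma> ls e m e' m'"
    and "\<And>e' m'. ehstep \<Gamma> ls e m e' m' \<Longrightarrow> Q e' m'"
  shows "steps_within \<Gamma> ls Q e m"
  unfolding steps_within_def
proof (intro conjI allI impI)
  show "\<exists>E e1. ectx_subst E e1 = e \<and> is_redex e1"
    using assms(1) ectx_subst_Nil by blast
  fix E e1
  assume E: "ectx_subst E e1 = e" "is_redex e1"
  from E(1) have "E = []" "e1 = e"
    by (rule ectx_subst_cases; use E(2) assms(2) in blast)+
  then show "e1 \<noteq> call_expr \<Omega> f \<tau>s \<tau> \<Omega>vs" for \<Omega> f \<tau>s \<tau> \<Omega>vs
    using assms(3) by (auto simp: call_expr_def)
  show "\<exists>e2 m'. ehstep \<Gamma> ls e1 m e2 m'"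
    using \<open>e1 = e\<close> assms(4) by blast
  fix e2 m'
  assume "ehstep \<Gamma> ls e1 m e2 m'"
  then show "Q (ectx_subst E e2) m'"
    using \<open>E = []\<close> \<open>e1 = e\<close> assms(5) by simp
qed

text \<open>When the root is no redex, every redex lies in an immediate subexpression, whose
  invariant \<open>Q'\<close> is carried through the context item. The last two premises supply one
  subexpression that does contain a redex, so that some step exists.\<close>

lemma steps_within_congruence:
  assumes "\<not> is_redex e"
    and "\<And>E e1 i. ectx_item_subst i (ectx_subst E e1) = e \<Longrightarrow> is_redex e1 \<Longrightarrow>
      \<exists>Q'. steps_within \<Gamma> ls Q' (ectx_subst E e1) m \<and>
        (\<forall>e' m'. Q' e' m' \<longrightarrow> Q (ectx_item_subst i e') m')"
    and "ectx_item_subst i e' = e" "steps_within \<Gamma> ls Q0 e' m"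
  shows "steps_within \<Gamma> ls Q e m"
  unfolding steps_within_def
proof (intro conjI allI impI)
  obtain E e1 where "ectx_subst E e1 = e'" "is_redex e1"
    using assms(4) by (auto simp: steps_within_def)
  then have "ectx_subst (E @ [i]) e1 = e \<and> is_redex e1"
    using assms(3) by simp
  then show "\<exists>E e1. ectx_subst E e1 = e \<and> is_redex e1"
    by blast
  fix E e1
  assume E: "ectx_subst E e1 = e" "is_redex e1"
  then obtain E' i where E': "E = E' @ [i]" "ectx_item_subst i (ectx_subst E' e1) = e"
    using assms(1) by (metis ectx_subst_cases)
  then obtain Q' where "steps_within \<Gamma> ls Q' (ectx_subst E' e1) m"
    and Q': "\<And>e' m'. Q' e' m' \<Longrightarrow> Q (ectx_item_subst i e') m'"
    using assms(2) E(2) by blast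
  then have *: "(\<forall>\<Omega> f \<tau>s \<tau> \<Omega>vs. e1 \<noteq> call_expr \<Omega> f \<tau>s \<tau> \<Omega>vs) \<and> (\<exists>e2 m'. ehstep \<Gamma> ls e1 m e2 m') \<and>
      (\<forall>e2 m'. ehstep \<Gamma> ls e1 m e2 m' \<longrightarrow> Q' (ectx_subst E' e2) m')"
    using E(2) by (auto simp: steps_within_def)
  then show "e1 \<noteq> call_expr \<Omega> f \<tau>s \<tau> \<Omega>vs" "\<exists>e2 m'. ehstep \<Gamma> ls e1 m e2 m'" for \<Omega> f \<tau>s \<tau> \<Omega>vs
    by blast+
  fix e2 m'
  assume "ehstep \<Gamma> ls e1 m e2 m'"
  then show "Q (ectx_subst E e2) m'"
    using * Q' E'(1) by simp
qed

lemma ectx_item_subst_eq: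
  "ectx_item_subst i e' = EVar j \<longleftrightarrow> False"
  "ectx_item_subst i e' = EVal \<Omega> \<nu> \<longleftrightarrow> False"
  "ectx_item_subst i e' = ELoad e \<longleftrightarrow> i = CLoad \<and> e' = e"
  "ectx_item_subst i e' = EUnOp op e \<longleftrightarrow> i = CUnOp op \<and> e' = e"
  "ectx_item_subst i e' = ECast \<tau> e \<longleftrightarrow> i = CCast \<tau> \<and> e' = e"
  "ectx_item_subst i e' = EBinOp bop ea eb \<longleftrightarrow>
    i = CBinOpL bop eb \<and> e' = ea \<or> i = CBinOpR bop ea \<and> e' = eb"
  "ectx_item_subst i e' = EAssign ass ea eb \<longleftrightarrow>
    i = CAssignL ass eb \<and> e' = ea \<or> i = CAssignR ass ea \<and> e' = eb"
  by (cases i; auto)+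

lemma redex_below_val: "ectx_subst E e1 = EVal \<Omega> \<nu> \<Longrightarrow> \<not> is_redex e1"
  by (auto elim!: ectx_subst_cases simp: ectx_item_subst_eq)

lemma is_nf_steps_within: "steps_within \<Gamma> ls Q e m \<Longrightarrow> \<not> is_nf e"
  by (auto simp: steps_within_def is_nf_def redex_below_val)

lemma steps_within_unop:
  assumes "steps_within \<Gamma> ls Q e m" "\<And>e' m'. Q e' m' \<Longrightarrow> Q' (EUnOp op e') m'"
  shows "steps_within \<Gamma> ls Q' (EUnOp op e) m"
  by (rule steps_within_congruence[where i = "CUnOp op" and e' = e])
    (use assms is_nf_steps_within in \<open>auto simp: ectx_item_subst_eq\<close>)

lemma steps_within_cast:
  assumes "steps_within \<Gamma> ls Q e m" "\<And>e' m'. Q e' m' \<Longrightarrow> Q' (ECast \<tau> e') m'"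
  shows "steps_within \<Gamma> ls Q' (ECast \<tau> e) m"
  by (rule steps_within_congruence[where i = "CCast \<tau>" and e' = e])
    (use assms is_nf_steps_within in \<open>auto simp: ectx_item_subst_eq\<close>)

lemma steps_within_load:
  assumes "steps_within \<Gamma> ls Q e m" "\<And>e' m'. Q e' m' \<Longrightarrow> Q' (ELoad e') m'"
  shows "steps_within \<Gamma> ls Q' (ELoad e) m"
  by (rule steps_within_congruence[where i = CLoad and e' = e])
    (use assms is_nf_steps_within in \<open>auto simp: ectx_item_subst_eq\<close>)

text \<open>Shared by binary operators and assignments. A value contains no redex, so each
  decomposition lies in an operand that can step, while the other operand stays as it is. This is
  where the free order of evaluation enters.\<close>

lemma steps_within_binary:
  assumes e: "\<And>i e'. ectx_item_subst i e' = e \<longleftrightarrow> i = iL \<and> e' = e1 \<or> i = iR \<and> e' = e2"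
    and "\<not> is_redex e" "\<not> (is_nf e1 \<and> is_nf e2)"
    and sw: "is_nf e1 \<or> steps_within \<Gamma> ls Q1 e1 m" "is_nf e2 \<or> steps_within \<Gamma> ls Q2 e2 m"
    and Q: "\<And>e' m'. Q1 e' m' \<Longrightarrow> Q (ectx_item_subst iL e') m'"
      "\<And>e' m'. Q2 e' m' \<Longrightarrow> Q (ectx_item_subst iR e') m'"
  shows "steps_within \<Gamma> ls Q e m"
proof -
  have redex: "\<not> is_nf (ectx_subst E r)" if "is_redex r" for E r
    using that redex_below_val by (auto simp: is_nf_def)
  obtain i e' Q0 where i: "ectx_item_subst i e' = e" "steps_within \<Gamma> ls Q0 e' m"
    using e sw assms(3) by blast
  show ?thesis
  proof (rule steps_within_congruence[OF assms(2) _ i])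
    fix E r j
    assume "ectx_item_subst j (ectx_subst E r) = e" and r: "is_redex r"
    then consider "j = iL" "ectx_subst E r = e1" | "j = iR" "ectx_subst E r = e2"
      using e[of j "ectx_subst E r"] by blast
    then show "\<exists>Q'. steps_within \<Gamma> ls Q' (ectx_subst E r) m \<and>
        (\<forall>e' m'. Q' e' m' \<longrightarrow> Q (ectx_item_subst j e') m')"
    proof cases
      case 1
      then show ?thesis
        using sw(1) redex[OF r, of E] Q(1) by (intro exI[of _ Q1]) simp
    next
      case 2
      then show ?thesis
        using sw(2) redex[OF r, of E] Q(2) by (intro exI[of _ Q2]) simp
    qed
  qed
qed

lemma steps_within_binop:
  assumes "is_nf e1 \<or> steps_within \<Gamma> ls Q1 e1 m" "is_nf e2 \<or> steps_within \<Gamma> ls Q2 e2 m"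
    and "\<not> (is_nf e1 \<and> is_nf e2)"
    and "\<And>e' m'. Q1 e' m' \<Longrightarrow> Q (EBinOp op e' e2) m'" "\<And>e' m'. Q2 e' m' \<Longrightarrow> Q (EBinOp op e1 e') m'"
  shows "steps_within \<Gamma> ls Q (EBinOp op e1 e2) m"
  by (rule steps_within_binary[where iL = "CBinOpL op e2" and iR = "CBinOpR op e1", OF _ _ assms(3,1,2)])
    (use assms(3-5) in \<open>auto simp: ectx_item_subst_eq\<close>)

lemma steps_within_assign:
  assumes "is_nf e1 \<or> steps_within \<Gamma> ls Q1 e1 m" "is_nf e2 \<or> steps_within \<Gamma> ls Q2 e2 m"
    and "\<not> (is_nf e1 \<and> is_nf e2)"
    and "\<And>e' m'. Q1 e' m' \<Longrightarrow> Q (EAssign op e' e2) m'" "\<And>e' m'. Q2 e' m' \<Longrightarrow> Q (EAssign op e1 e') m'"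
  shows "steps_within \<Gamma> ls Q (EAssign op e1 e2) m"
  by (rule steps_within_binary[where iL = "CAssignL op e2" and iR = "CAssignR op e1", OF _ _ assms(3,1,2)])
    (use assms(3-5) in \<open>auto simp: ectx_item_subst_eq\<close>)

inductive_cases ehstep_varE: "ehstep \<Gamma> ls (EVar i) m e' m'"
inductive_cases ehstep_loadE: "ehstep \<Gamma> ls (ELoad e) m e' m'"
inductive_cases ehstep_unopE: "ehstep \<Gamma> ls (EUnOp op e) m e' m'"
inductive_cases ehstep_binopE: "ehstep \<Gamma> ls (EBinOp op e1 e2) m e' m'"
inductive_cases ehstep_castE: "ehstep \<Gamma> ls (ECast \<tau> e) m e' m'"
inductive_cases ehstep_assignE: "ehstep \<Gamma> ls (EAssign ass e1 e2) m e' m'"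

subsection \<open>Partially evaluated expressions\<close>

lemma int_cast_sint [simp]: "int_cast sint_it z = z"
  by (simp add: int_cast_def)

lemma int_arith_type_sint [simp]: "int_arith_type sint_it sint_it = sint_it"
  "int_union (int_promote sint_it) (int_promote sint_it) = sint_it"
  by (simp_all add: int_arith_type_def int_union_def int_promote_def rank_le_def Let_def)

text \<open>The usual arithmetic conversions do nothing on two operands of type
  \<open>sint_it\<close>, and for arithmetic the range condition on \<open>r\<close> is the absence
  of overflow. For division it rules out the least integer divided by -1.\<close>

lemma val_binop_sint:
  assumes "bs_binop op z1 z2 = Some r" "in_range r"
  shows "val_binop_ok \<Gamma> m op (intV sint_it z1) (intV sint_it z2)"
    and "val_binop \<Gamma> op (intV sint_it z1) (intV sint_it z2) = intV sint_it r"
  using assms by (induction op z1 z2 rule: bs_binop.induct)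
    (auto simp: val_binop_ok_def val_binop_def int_arithop_ok_def int_arithop_def
      int_pre_arithop_ok_def int_pre_arithop_def Let_def split: if_splits)

lemma val_cast_sint:
  assumes "in_range z"
  shows "val_cast_ok \<Gamma> m (TType sint) (intV sint_it z)"
    and "val_cast (TType sint) (intV sint_it z) = intV sint_it z"
  using assms by (simp_all add: val_cast_ok_def base_val_cast_ok_def int_cast_ok_def val_cast_def
      base_val_cast_def)

text \<open>\<open>eval\<close> closed under small steps: variables may already have become
  addresses and subexpressions literals, while the value stays fixed. The cast rule is there because
  assigned and returned expressions are wrapped in \<open>ECast sint\<close>. Lock sets are empty,
  as no assignment occurs inside.\<close>

inductive evaluates :: "stack \<Rightarrow> store \<Rightarrow> expr \<Rightarrow> int \<Rightarrow> bool" for ls \<sigma> where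
  evaluates_lit: "in_range z \<Longrightarrow> evaluates ls \<sigma> (lit z) z"
| evaluates_var: "i < length \<sigma> \<Longrightarrow> \<sigma> ! i = Some z \<Longrightarrow> evaluates ls \<sigma> (ELoad (EVar i)) z"
| evaluates_addr: "i < length \<sigma> \<Longrightarrow> \<sigma> ! i = Some z \<Longrightarrow> ls ! i = (x, sint) \<Longrightarrow>
    evaluates ls \<sigma> (ELoad (ELVal {} (Ptr (addr_top x sint)))) z"
| evaluates_not: "evaluates ls \<sigma> e z \<Longrightarrow> evaluates ls \<sigma> (EUnOp NotOp e) (if z = 0 then 1 else 0)"
| evaluates_binop: "evaluates ls \<sigma> e1 z1 \<Longrightarrow> evaluates ls \<sigma> e2 z2 \<Longrightarrow> bs_binop op z1 z2 = Some r \<Longrightarrow>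
    in_range r \<Longrightarrow> evaluates ls \<sigma> (EBinOp op e1 e2) r"
| evaluates_cast: "evaluates ls \<sigma> e z \<Longrightarrow> evaluates ls \<sigma> (ECast sint e) z"

lemma eval_evaluates: "eval \<sigma> e z \<Longrightarrow> evaluates ls \<sigma> e z"
  by (induction rule: eval.induct) (blast intro: evaluates.intros)+

lemma evaluates_in_range:
  assumes "evaluates ls \<sigma> e z" "\<And>z. Some z \<in> set \<sigma> \<Longrightarrow> in_range z"
  shows "in_range z"
  using assms(1)
proof induction
  case (evaluates_var i z)
  then show ?case
    using assms(2) nth_mem by metis
next
  case (evaluates_addr i z x)
  then show ?case
    using assms(2) nth_mem by metis
qed (auto simp: in_range_def)

lemma evaluates_nf: "evaluates ls \<sigma> e z \<Longrightarrow> is_nf e \<Longrightarrow> e = lit z"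
  by (auto simp: is_nf_def elim: evaluates.cases)

lemma steps_within_var:
  assumes "i < length ls" "ls ! i = (x, \<tau>)" "Q (ELVal {} (Ptr (addr_top x \<tau>))) m"
  shows "steps_within \<Gamma> ls Q (EVar i) m"
  by (rule steps_within_redex[where e' = "ELVal {} (Ptr (addr_top x \<tau>))" and m' = m])
    (use assms in \<open>auto simp: ectx_item_subst_eq elim!: ehstep_varE intro: ehstep.intros\<close>)

text \<open>Progress and preservation in one statement, by induction on \<open>evaluates\<close>:
  operands in normal form are literals, so the operation is a redex with a defined result; otherwise
  the steps of the operands are lifted.\<close>

lemma steps_within_evaluates:
  assumes "models m ls \<sigma>" "evaluates ls \<sigma> e z"
  shows "is_nf e \<or> steps_within \<Gamma> ls (\<lambda>e' m'. m' = m \<and> evaluates ls \<sigma> e' z) e m"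
  using assms(2)
proof induction
  case (evaluates_var i z)
  then obtain x where "i < length ls" "ls ! i = (x, sint)"
    using assms(1) by (metis models_nthD)
  then have "steps_within \<Gamma> ls (\<lambda>e' m'. m' = m \<and> e' = ELVal {} (Ptr (addr_top x sint))) (EVar i) m"
    by (rule steps_within_var) simp
  then show ?case
    using evaluates_var \<open>ls ! i = _\<close>
    by (intro disjI2) (erule steps_within_load, auto intro: evaluates.intros)
next
  case (evaluates_addr i z x)
  have z: "in_range z" and x: "fmlookup m x = Some (Obj (cell (Some z)) False)"
    using assms(1) evaluates_addr nth_mem[of i \<sigma>] by (auto elim!: models_nthD simp: models_iff)
  note lookup = mem_lookup_cell[OF x z, of \<Gamma>]
  have "ehstep \<Gamma> ls (ELoad (ELVal {} (Ptr (addr_top x sint)))) m (lit z) m"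
    using estep_load[OF lookup] by (simp add: mem_force_top)
  then show ?case
    using z lookup
    by (intro disjI2 steps_within_redex)
      (auto simp: ectx_item_subst_eq is_nf_def redex_below_val mem_force_top elim!: ehstep_loadE
        intro: evaluates.intros)
next
  case (evaluates_not e z)
  show ?case
  proof (cases "is_nf e")
    case True
    then have e: "e = lit z"
      using evaluates_not evaluates_nf by blast
    have ok: "val_unop_ok m NotOp (intV sint_it z)"
      and val: "val_unop NotOp (intV sint_it z) = intV sint_it (if z = 0 then 1 else 0)"
      by (simp_all add: val_unop_ok_def val_unop_def)
    have range: "in_range (if z = 0 then 1 else 0)"
      by (simp add: in_range_def)
    have "ehstep \<Gamma> ls (EUnOp NotOp e) m (lit (if z = 0 then 1 else 0)) m"
      unfolding e val[symmetric] using ok by (rule estep_unop)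
    then show ?thesis
      unfolding e using val range
      by (intro disjI2 steps_within_redex)
        (auto simp: ectx_item_subst_eq is_nf_def redex_below_val elim!: ehstep_unopE
          intro: evaluates.intros)
  next
    case False
    then show ?thesis
      using evaluates_not.IH evaluates.evaluates_not
      by (intro disjI2) (erule disjE, blast, erule steps_within_unop, blast)
  qed
next
  case (evaluates_binop e1 z1 e2 z2 op r)
  show ?case
  proof (cases "is_nf e1 \<and> is_nf e2")
    case True
    then have e: "e1 = lit z1" "e2 = lit z2"
      using evaluates_binop evaluates_nf by blast+
    note op = val_binop_sint[OF evaluates_binop.hyps(3,4), of \<Gamma>]
    have "ehstep \<Gamma> ls (EBinOp op e1 e2) m (lit r) m"
      unfolding e using estep_binop[OF op(1), of ls "{}" "{}"] op(2) by simp
    then show ?thesis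
      unfolding e using evaluates_binop.hyps(4)
      by (intro disjI2 steps_within_redex)
        (auto simp: op(2) ectx_item_subst_eq is_nf_def redex_below_val elim!: ehstep_binopE
          intro: evaluates.intros)
  next
    case False
    have "steps_within \<Gamma> ls (\<lambda>e' m'. m' = m \<and> evaluates ls \<sigma> e' r) (EBinOp op e1 e2) m"
      using evaluates_binop.IH False
      by (rule steps_within_binop) (use evaluates_binop.hyps in \<open>auto intro: evaluates.intros\<close>)
    then show ?thesis ..
  qed
next
  case (evaluates_cast e z)
  have range: "in_range z"
    using evaluates_cast assms(1) by (auto intro: evaluates_in_range simp: models_iff)
  show ?case
  proof (cases "is_nf e")
    case True
    then have e: "e = lit z"
      using evaluates_cast evaluates_nf by blast
    note cast = val_cast_sint(1)[OF range, of \<Gamma> m] val_cast_sint(2)[OF range]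
    have "ehstep \<Gamma> ls (ECast sint e) m (lit z) m"
      unfolding e using estep_cast[OF cast(1), of ls "{}"] cast(2) by simp
    then show ?thesis
      unfolding e using cast(2) range
      by (intro disjI2 steps_within_redex)
        (auto simp: ectx_item_subst_eq is_nf_def redex_below_val elim!: ehstep_castE
          intro: evaluates.intros)
  next
    case False
    then show ?thesis
      using evaluates_cast.IH evaluates.evaluates_cast
      by (intro disjI2) (erule disjE, blast, erule steps_within_cast, blast)
  qed
qed (simp add: is_nf_def)

text \<open>The memory between the write and the release of its lock. The target is locked here, so
  it is not a \<open>cell\<close>.\<close>

definition assigned :: "env \<Rightarrow> mem \<Rightarrow> index \<Rightarrow> int \<Rightarrow> mem" where
  "assigned \<Gamma> m x z = mem_lock \<Gamma> (addr_top x sint) (fmupd x (Obj (cell (Some z)) False) m)"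

definition assigning :: "env \<Rightarrow> mem \<Rightarrow> stack \<Rightarrow> store \<Rightarrow> nat \<Rightarrow> index \<Rightarrow> int \<Rightarrow> expr \<Rightarrow> mem \<Rightarrow> bool" where
  "assigning \<Gamma> m ls \<sigma> i x z e m' \<longleftrightarrow>
    m' = m \<and> (\<exists>l r. e = EAssign Assign l r \<and> l \<in> {EVar i, ELVal {} (Ptr (addr_top x sint))} \<and>
      evaluates ls \<sigma> r z) \<or>
    m' = assigned \<Gamma> m x z \<and> e = ERVal (lock_singleton \<Gamma> (addr_top x sint)) (intV sint_it z)"

text \<open>The write fires only once both sides are values, so the right-hand side is evaluated
  entirely in the original \<open>m\<close> and never meets the locked target.\<close>

lemma steps_within_assigning:
  assumes m: "models m ls \<sigma>" and i: "i < length \<sigma>" "ls ! i = (x, sint)"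
    and "assigning \<Gamma> m ls \<sigma> i x z e m'"
  shows "is_nf e \<or> steps_within \<Gamma> ls (assigning \<Gamma> m ls \<sigma> i x z) e m'"
  using assms(4)[unfolded assigning_def]
proof (elim disjE conjE exE)
  fix l r
  assume m': "m' = m" and e: "e = EAssign Assign l r"
    and l: "l \<in> {EVar i, ELVal {} (Ptr (addr_top x sint))}" and r: "evaluates ls \<sigma> r z"
  have range: "in_range z"
    using r m by (auto intro: evaluates_in_range simp: models_iff)
  have x: "fmlookup m x = Some (Obj (cell (\<sigma> ! i)) False)"
    using m i by (auto elim: models_nthD)
  show ?thesis
  proof (cases "is_nf l \<and> is_nf r")
    case True
    then have l': "l = ELVal {} (Ptr (addr_top x sint))" and r': "r = lit z"
      using l r evaluates_nf by (auto simp: is_nf_def)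
    let ?a = "addr_top x sint"
    have sem: "assign_sem \<Gamma> m ?a (intV sint_it z) Assign v w \<longleftrightarrow> v = intV sint_it z \<and> w = intV sint_it z" for v w
      using val_cast_sint[OF range] by (auto simp: assign_sem.simps)
    have m2: "mem_lock \<Gamma> ?a (mem_insert \<Gamma> ?a (intV sint_it z) m) = assigned \<Gamma> m x z"
      by (simp add: assigned_def mem_insert_cell[OF x])
    have "ehstep \<Gamma> ls e m (ERVal (lock_singleton \<Gamma> ?a) (intV sint_it z)) (assigned \<Gamma> m x z)"
      unfolding e l' r' m2[symmetric]
      using estep_assign[OF mem_writable_cell[OF x], where v = "intV sint_it z" and ass = Assign
          and ?\<Omega>1.0 = "{}" and ?\<Omega>2.0 = "{}"]
      by (simp add: sem)
    moreover have "assigning \<Gamma> m ls \<sigma> i x z e2 m2" if "ehstep \<Gamma> ls e m e2 m2" for e2 m2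
      using that unfolding e l' r' by (auto elim!: ehstep_assignE simp: sem assigning_def m2)
    ultimately show ?thesis
      unfolding m'
      by (intro disjI2 steps_within_redex)
        (auto simp: e l' r' ectx_item_subst_eq is_nf_def redex_below_val)
  next
    case False
    have "is_nf l \<or> steps_within \<Gamma> ls (\<lambda>e' m'. m' = m \<and> e' = ELVal {} (Ptr (addr_top x sint))) l m"
      using l i m by (auto simp: is_nf_def models_iff intro: steps_within_var)
    then have "steps_within \<Gamma> ls (assigning \<Gamma> m ls \<sigma> i x z) e m"
      unfolding e using steps_within_evaluates[OF m r] False
      by (rule steps_within_assign) (use l r in \<open>auto simp: assigning_def\<close>)
    then show ?thesis
      by (simp add: m')
  qed
qed (simp add: is_nf_def)

lemma assigning_nf:
  "assigning \<Gamma> m ls \<sigma> i x z e m' \<Longrightarrow> is_nf e \<Longrightarrow>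
    m' = assigned \<Gamma> m x z \<and> e = ERVal (lock_singleton \<Gamma> (addr_top x sint)) (intV sint_it z)"
  by (auto simp: assigning_def is_nf_def)

text \<open>The void cast around an assignment keeps the locks, which are released by the enclosing statement.\<close>

definition assigning_void :: "env \<Rightarrow> mem \<Rightarrow> stack \<Rightarrow> store \<Rightarrow> nat \<Rightarrow> index \<Rightarrow> int \<Rightarrow> expr \<Rightarrow> mem \<Rightarrow> bool" where
  "assigning_void \<Gamma> m ls \<sigma> i x z e m' \<longleftrightarrow>
    (\<exists>e'. e = ECast voidT e' \<and> assigning \<Gamma> m ls \<sigma> i x z e' m') \<or>
    m' = assigned \<Gamma> m x z \<and> e = ERVal (lock_singleton \<Gamma> (addr_top x sint)) voidV"

lemma steps_within_assigning_void:
  assumes m: "models m ls \<sigma>" and i: "i < length \<sigma>" "ls ! i = (x, sint)"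
    and "assigning_void \<Gamma> m ls \<sigma> i x z e m'"
  shows "is_nf e \<or> steps_within \<Gamma> ls (assigning_void \<Gamma> m ls \<sigma> i x z) e m'"
  using assms(4)[unfolded assigning_void_def]
proof (elim disjE conjE exE)
  fix e'
  assume e: "e = ECast voidT e'" and e': "assigning \<Gamma> m ls \<sigma> i x z e' m'"
  show ?thesis
  proof (cases "is_nf e'")
    case True
    let ?\<Omega> = "lock_singleton \<Gamma> (addr_top x sint)"
    have v: "m' = assigned \<Gamma> m x z" "e' = ERVal ?\<Omega> (intV sint_it z)"
      using assigning_nf[OF e' True] by auto
    have cast: "val_cast_ok \<Gamma> m' (TType voidT) (intV sint_it z)"
      "val_cast (TType voidT) (intV sint_it z) = voidV"
      by (simp_all add: val_cast_ok_def base_val_cast_ok_def val_cast_def base_val_cast_def)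
    have "ehstep \<Gamma> ls e m' (ERVal ?\<Omega> voidV) m'"
      unfolding e v(2) using estep_cast[OF cast(1), of ls ?\<Omega>] cast(2) by simp
    moreover have "assigning_void \<Gamma> m ls \<sigma> i x z e2 m2" if "ehstep \<Gamma> ls e m' e2 m2" for e2 m2
      using that cast(2) v(1) unfolding e v(2) by (auto elim!: ehstep_castE simp: assigning_void_def)
    ultimately show ?thesis
      by (intro disjI2 steps_within_redex)
        (auto simp: e v(2) ectx_item_subst_eq is_nf_def redex_below_val)
  next
    case False
    then have "steps_within \<Gamma> ls (assigning \<Gamma> m ls \<sigma> i x z) e' m'"
      using steps_within_assigning[OF m i e'] by blast
    then show ?thesis
      unfolding e by (intro disjI2) (erule steps_within_cast, auto simp: assigning_void_def)
  qed
qed (simp add: is_nf_def)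

subsection \<open>Safety for a bounded number of steps\<close>

text \<open>\<open>F\<close> marks the states that may lack a successor. A state reached after
  \<open>j\<close> steps is itself inspected once the bound exceeds \<open>j\<close>;
  \<open>Undef\<close> states do not step and so fail unless \<open>F\<close> admits them.\<close>

primrec safe :: "env \<Rightarrow> funenv \<Rightarrow> (state \<Rightarrow> bool) \<Rightarrow> nat \<Rightarrow> state \<Rightarrow> bool" where
  "safe \<Gamma> \<delta> F 0 S \<longleftrightarrow> True"
| "safe \<Gamma> \<delta> F (Suc n) S \<longleftrightarrow> (F S \<or> (\<exists>S'. cstep \<Gamma> \<delta> [] S S')) \<and>
    (\<forall>S'. cstep \<Gamma> \<delta> [] S S' \<longrightarrow> safe \<Gamma> \<delta> F n S')"

lemma safe_csteps:
  assumes "csteps \<Gamma> \<delta> [] S S'" "\<And>n. safe \<Gamma> \<delta> F n S"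
  shows "F S' \<or> (\<exists>S''. cstep \<Gamma> \<delta> [] S' S'')"
proof -
  have "\<forall>n. safe \<Gamma> \<delta> F n S'"
    using assms
  proof (induction rule: rtranclp_induct)
    case (step S' S'')
    then show ?case
      using safe.simps(2) by blast
  qed simp
  then show ?thesis
    using safe.simps(2) by blast
qed

lemma safe_mono: "safe \<Gamma> \<delta> F n S \<Longrightarrow> n' \<le> n \<Longrightarrow> safe \<Gamma> \<delta> F n' S"
proof (induction n arbitrary: n' S)
  case (Suc n)
  then show ?case
    by (cases n') auto
qed simp

section \<open>Small steps of statements\<close>

inductive_cases cstep_stmtE: "cstep \<Gamma> \<delta> \<rho> (State k (Stmt d s) m) S"
inductive_cases cstep_exprE: "cstep \<Gamma> \<delta> \<rho> (State k (Expr e) m) S"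

text \<open>The rule \<open>cstep_in_expr\<close> matches statements against
  \<open>esctx_item_subst E e\<close>, which is not a constructor pattern. These equations decide
  which contexts fit when a step is inverted.\<close>

lemma esctx_item_subst_eq:
  "esctx_item_subst E e \<noteq> SSkip" "esctx_item_subst E e \<noteq> SThrow n"
  "esctx_item_subst E e \<noteq> SLocal \<tau> s" "esctx_item_subst E e \<noteq> SComp s1 s2"
  "esctx_item_subst E e \<noteq> SCatch s" "esctx_item_subst E e \<noteq> SLoop s"
  "esctx_item_subst E e = SDo e' \<longleftrightarrow> E = CDoE \<and> e = e'"
  "esctx_item_subst E e = SReturn e' \<longleftrightarrow> E = CReturnE \<and> e = e'"
  "esctx_item_subst E e = SIf e' s1 s2 \<longleftrightarrow> E = CIfE s1 s2 \<and> e = e'"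
  by (cases E; auto)+

lemmas esctx_item_subst_eq' = esctx_item_subst_eq(1-6)[symmetric] esctx_item_subst_eq(7-9)[THEN eq_iff_swap]

context
  fixes \<Gamma> :: env and \<delta> :: funenv
begin

text \<open>The equivalence gives existence and uniqueness of the successor at once, matching the
  two conjuncts of \<open>safe\<close>.\<close>

abbreviation steps_only_to :: "state \<Rightarrow> state \<Rightarrow> bool" where
  "steps_only_to S S1 \<equiv> \<forall>S'. cstep \<Gamma> \<delta> [] S S' \<longleftrightarrow> S' = S1"

lemma step_down:
  "steps_only_to (State k (Stmt Down SSkip) m) (State k (Stmt Up SSkip) m)"
  "steps_only_to (State k (Stmt Down (SThrow n)) m) (State k (Stmt (Throw n) (SThrow n)) m)"
  "steps_only_to (State k (Stmt Down (SComp s1 s2)) m) (State (CStmt (CCompL s2) # k) (Stmt Down s1) m)"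
  "steps_only_to (State k (Stmt Down (SCatch s)) m) (State (CStmt CCatch # k) (Stmt Down s) m)"
  "steps_only_to (State k (Stmt Down (SLoop s)) m) (State (CStmt CLoop # k) (Stmt Down s) m)"
  "steps_only_to (State k (Stmt Down (SDo e)) m) (State (CExpr e CDoE # k) (Expr e) m)"
  "steps_only_to (State k (Stmt Down (SReturn e)) m) (State (CExpr e CReturnE # k) (Expr e) m)"
  "steps_only_to (State k (Stmt Down (SIf e s1 s2)) m) (State (CExpr e (CIfE s1 s2) # k) (Expr e) m)"
  by (auto elim!: cstep_stmtE simp: esctx_item_subst_eq esctx_item_subst_eq'
      intro: cstep.intros cstep_in_expr[where E = CDoE, simplified]
        cstep_in_expr[where E = CReturnE, simplified]
        cstep_in_expr[where E = "CIfE s1 s2" for s1 s2, simplified])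

lemma step_out:
  "steps_only_to (State (CStmt (CCompL s2) # k) (Stmt Up s1) m) (State (CStmt (CCompR s1) # k) (Stmt Down s2) m)"
  "steps_only_to (State (CStmt (CCompR s1) # k) (Stmt Up s2) m) (State k (Stmt Up (SComp s1 s2)) m)"
  "steps_only_to (State (CStmt CCatch # k) (Stmt Up s) m) (State k (Stmt Up (SCatch s)) m)"
  "steps_only_to (State (CStmt CLoop # k) (Stmt Up s) m) (State k (Stmt Down (SLoop s)) m)"
  "steps_only_to (State (CStmt (CIfL e s2) # k) (Stmt Up s1) m) (State k (Stmt Up (SIf e s1 s2)) m)"
  "steps_only_to (State (CStmt (CIfR e s1) # k) (Stmt Up s2) m) (State k (Stmt Up (SIf e s1 s2)) m)"
  "steps_only_to (State (CStmt CCatch # k) (Stmt (Throw 0) s) m) (State k (Stmt Up (SCatch s)) m)"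
  "steps_only_to (State (CStmt CCatch # k) (Stmt (Throw (Suc n)) s) m) (State k (Stmt (Throw n) (SCatch s)) m)"
  "E \<noteq> CCatch \<Longrightarrow> steps_only_to (State (CStmt E # k) (Stmt (Throw n) s) m)
    (State k (Stmt (Throw n) (sctx_item_subst E s)) m)"
  "steps_only_to (State (CStmt E # k) (Stmt (Top v) s) m) (State k (Stmt (Top v) (sctx_item_subst E s)) m)"
  "d \<in> {Up, Throw n, Top v} \<Longrightarrow>
    steps_only_to (State (CLocal x \<tau> # k) (Stmt d s) m) (State k (Stmt d (SLocal \<tau> s)) (mem_free x m))"
  "steps_only_to (State (CParams f x\<tau>s # k) (Stmt (Top v) s) m)
    (State k (Return f v) (foldr mem_free (map fst x\<tau>s) m))"
  by (auto elim!: cstep_stmtE intro: cstep.intros)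

lemma step_local:
  "cstep \<Gamma> \<delta> [] (State k (Stmt Down (SLocal \<tau> s)) m) S \<longleftrightarrow> (\<exists>x. mem_allocable x m \<and>
    S = State (CLocal x \<tau> # k) (Stmt Down s) (mem_alloc \<Gamma> x False perm_full (val_new \<Gamma> \<tau>) m))"
  by (auto elim!: cstep_stmtE simp: esctx_item_subst_eq' intro: cstep.intros)

text \<open>A value contains no redex, so head reductions, calls and undefined expressions are
  impossible and only the enclosing statement acts. Integer literals can always be branched
  on.\<close>

lemma step_val:
  "steps_only_to (State (CExpr e CDoE # k) (Expr (EVal \<Omega> \<nu>)) m) (State k (Stmt Up (SDo e)) (mem_unlock \<Omega> m))"
  "steps_only_to (State (CExpr e CReturnE # k) (Expr (ERVal \<Omega> v)) m)
    (State k (Stmt (Top v) (SReturn e)) (mem_unlock \<Omega> m))"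
  "z \<noteq> 0 \<Longrightarrow> steps_only_to (State (CExpr e (CIfE s1 s2) # k) (Expr (lit z)) m)
    (State (CStmt (CIfL e s2) # k) (Stmt Down s1) (mem_unlock {} m))"
  "steps_only_to (State (CExpr e (CIfE s1 s2) # k) (Expr (lit 0)) m)
    (State (CStmt (CIfR e s1) # k) (Stmt Down s2) (mem_unlock {} m))"
  by (auto elim!: cstep_exprE dest!: redex_below_val[OF sym] ehstep_redex
      simp: is_redex_call_expr val_branchable_def val_true_def val_false_def intro: cstep.intros)

end

subsection \<open>Big-step executions are safe\<close>

lemma safe_only_Suc: "steps_only_to \<Gamma> \<delta> S S1 \<Longrightarrow> safe \<Gamma> \<delta> F n S1 \<Longrightarrow> safe \<Gamma> \<delta> F (Suc n) S"
  by simp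

text \<open>Gives away the step just gained, so that one bound serves throughout a terminating
  execution. \<open>safe_only_Suc\<close> keeps it, for divergence.\<close>

lemma safe_only: "steps_only_to \<Gamma> \<delta> S S1 \<Longrightarrow> safe \<Gamma> \<delta> F n S1 \<Longrightarrow> safe \<Gamma> \<delta> F n S"
  using safe_only_Suc safe_mono le_SucI order_refl by metis

text \<open>\<open>R\<close> is an invariant of all reductions and \<open>nf\<close> takes over at
  values. Induction on the bound suffices: a run that does not reach a value within \<open>n\<close>
  steps has nothing left to prove.\<close>

lemma safe_expr:
  assumes inv: "\<And>e m. R e m \<Longrightarrow> is_nf e \<or> steps_within \<Gamma> (locals k) R e m"
    and nf: "\<And>\<Omega> \<nu> m. R (EVal \<Omega> \<nu>) m \<Longrightarrow> safe \<Gamma> \<delta> F n (State k (Expr (EVal \<Omega> \<nu>)) m)"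
    and "R e m"
  shows "safe \<Gamma> \<delta> F n (State k (Expr e) m)"
proof -
  have "safe \<Gamma> \<delta> F n' (State k (Expr e) m)" if "R e m" "n' \<le> n" for n'
    using that
  proof (induction n' arbitrary: e m)
    case (Suc n')
    show ?case
    proof (cases "is_nf e")
      case True
      then show ?thesis
        using nf Suc.prems safe_mono unfolding is_nf_def by blast
    next
      case False
      then have sw: "steps_within \<Gamma> (locals k @ []) R e m"
        using inv Suc.prems(1) by auto
      have head: "safe \<Gamma> \<delta> F n' (State k (Expr (ectx_subst E e2)) m2)"
        if "e = ectx_subst E e1" "ehstep \<Gamma> (locals k @ []) e1 m e2 m2" for E e1 e2 m2
        using sw that Suc.IH Suc.prems(2) ehstep_redex[OF that(2)] unfolding steps_within_def by auto
      have no_call: "e \<noteq> ectx_subst E (call_expr \<Omega> f \<tau>s \<tau> \<Omega>vs)" for E \<Omega> f \<tau>s \<tau> \<Omega>vs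
        using sw is_redex_call_expr unfolding steps_within_def by blast
      have no_undef: "ehsafe \<Gamma> (locals k @ []) e1 m" if "e = ectx_subst E e1" "is_redex e1" for E e1
        using sw that ehsafe_step unfolding steps_within_def by metis
      have "e \<noteq> EVal \<Omega> \<nu>" for \<Omega> \<nu>
        using False by (simp add: is_nf_def)
      then have "safe \<Gamma> \<delta> F n' S'" if "cstep \<Gamma> \<delta> [] (State k (Expr e) m) S'" for S'
        using that head no_call no_undef by (elim cstep_exprE) blast+
      moreover have "\<exists>S'. cstep \<Gamma> \<delta> [] (State k (Expr e) m) S'"
      proof -
        obtain E e1 e2 m2 where "ectx_subst E e1 = e" "ehstep \<Gamma> (locals k @ []) e1 m e2 m2"
          using sw unfolding steps_within_def by blast
        then show ?thesis
          using cstep_expr_head by blast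
      qed
      ultimately show ?thesis
        by simp
    qed
  qed simp
  then show ?thesis
    using assms(3) by simp
qed

lemma safe_evaluates:
  assumes "models m (locals k) \<sigma>" "evaluates (locals k) \<sigma> e z"
    and "safe \<Gamma> \<delta> F n (State k (Expr (lit z)) m)"
  shows "safe \<Gamma> \<delta> F n (State k (Expr e) m)"
proof (rule safe_expr[where R = "\<lambda>e' m'. m' = m \<and> evaluates (locals k) \<sigma> e' z"])
  show "safe \<Gamma> \<delta> F n (State k (Expr (EVal \<Omega> \<nu>)) m')"
    if "m' = m \<and> evaluates (locals k) \<sigma> (EVal \<Omega> \<nu>) z" for \<Omega> \<nu> m'
    using that evaluates_nf[of "locals k" \<sigma> "EVal \<Omega> \<nu>" z] assms(3) by (simp add: is_nf_def)
qed (use assms steps_within_evaluates in auto)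

lemma models_assigned:
  assumes "models m ls \<sigma>" "i < length \<sigma>" "ls ! i = (x, sint)" "in_range z"
  shows "models (mem_unlock (lock_singleton \<Gamma> (addr_top x sint)) (assigned \<Gamma> m x z)) ls (\<sigma>[i := Some z])"
  using models_update[OF assms] by (simp add: assigned_def mem_unlock_lock)

text \<open>Both statement forms at once. \<open>r\<close> satisfies \<open>evaluates\<close> rather
  than \<open>eval\<close> because it includes the cast in the form without void.\<close>

lemma safe_assign:
  assumes m: "models m (locals k) \<sigma>" and i: "i < length \<sigma>" and r: "evaluates (locals k) \<sigma> r z"
    and s: "s \<in> {SDo (EAssign Assign (EVar i) r), SDo (ECast voidT (EAssign Assign (EVar i) r))}"
    and post: "\<And>m'. models m' (locals k) (\<sigma>[i := Some z]) \<Longrightarrow> safe \<Gamma> \<delta> F n (State k (Stmt Up s) m')"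
  shows "safe \<Gamma> \<delta> F n (State k (Stmt Down s) m)"
proof -
  obtain e where e: "s = SDo e"
    "e \<in> {EAssign Assign (EVar i) r, ECast voidT (EAssign Assign (EVar i) r)}"
    using s by auto
  obtain x where x: "locals k ! i = (x, sint)"
    using models_nthD[OF m i] by blast
  have range: "in_range z"
    using r m by (auto intro: evaluates_in_range simp: models_iff)
  let ?k = "CExpr e CDoE # k"
  have nf: "safe \<Gamma> \<delta> F n (State ?k (Expr (EVal \<Omega> \<nu>)) m')"
    if "m' = assigned \<Gamma> m x z" "\<Omega> = lock_singleton \<Gamma> (addr_top x sint)" for \<Omega> \<nu> m'
    unfolding e(1) that
    by (intro safe_only[OF step_val(1)] post[unfolded e(1)] models_assigned m i x range)
  have "safe \<Gamma> \<delta> F n (State ?k (Expr e) m)"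
    using e(2)
  proof (elim insertE emptyE)
    assume "e = EAssign Assign (EVar i) r"
    then have start: "assigning \<Gamma> m (locals k) \<sigma> i x z e m"
      using r by (simp add: assigning_def)
    show ?thesis
    proof (rule safe_expr[where R = "assigning \<Gamma> m (locals k) \<sigma> i x z"])
      show "is_nf e' \<or> steps_within \<Gamma> (locals ?k) (assigning \<Gamma> m (locals k) \<sigma> i x z) e' m'"
        if "assigning \<Gamma> m (locals k) \<sigma> i x z e' m'" for e' m'
        using steps_within_assigning[OF m i x that] by simp
      show "safe \<Gamma> \<delta> F n (State ?k (Expr (EVal \<Omega> \<nu>)) m')"
        if "assigning \<Gamma> m (locals k) \<sigma> i x z (EVal \<Omega> \<nu>) m'" for \<Omega> \<nu> m'
        using that by (intro nf) (auto simp: assigning_def)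
    qed (rule start)
  next
    assume "e = ECast voidT (EAssign Assign (EVar i) r)"
    then have start: "assigning_void \<Gamma> m (locals k) \<sigma> i x z e m"
      using r by (simp add: assigning_void_def assigning_def)
    show ?thesis
    proof (rule safe_expr[where R = "assigning_void \<Gamma> m (locals k) \<sigma> i x z"])
      show "is_nf e' \<or> steps_within \<Gamma> (locals ?k) (assigning_void \<Gamma> m (locals k) \<sigma> i x z) e' m'"
        if "assigning_void \<Gamma> m (locals k) \<sigma> i x z e' m'" for e' m'
        using steps_within_assigning_void[OF m i x that] by simp
      show "safe \<Gamma> \<delta> F n (State ?k (Expr (EVal \<Omega> \<nu>)) m')"
        if "assigning_void \<Gamma> m (locals k) \<sigma> i x z (EVal \<Omega> \<nu>) m'" for \<Omega> \<nu> m'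
        using that by (intro nf) (auto simp: assigning_void_def)
    qed (rule start)
  qed
  then show ?thesis
    unfolding e(1) by (rule safe_only[OF step_down(6)])
qed

text \<open>The step into the condition is charged, as divergence through a branch needs the lower
  bound; terminating executions drop it by \<open>safe_mono\<close>. The same holds for
  \<open>safe_local\<close>.\<close>

lemma safe_if:
  assumes m: "models m (locals k) \<sigma>" and e: "eval \<sigma> e z"
    and branch: "safe \<Gamma> \<delta> F n (State (CStmt (if z = 0 then CIfR e s1 else CIfL e s2) # k)
      (Stmt Down (if z = 0 then s2 else s1)) m)"
  shows "safe \<Gamma> \<delta> F (Suc n) (State k (Stmt Down (SIf e s1 s2)) m)"
proof (rule safe_only_Suc[OF step_down(8)], rule safe_evaluates)
  show "models m (locals (CExpr e (CIfE s1 s2) # k)) \<sigma>"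
    using m by simp
  show "evaluates (locals (CExpr e (CIfE s1 s2) # k)) \<sigma> e z"
    using e by (rule eval_evaluates)
  show "safe \<Gamma> \<delta> F n (State (CExpr e (CIfE s1 s2) # k) (Expr (lit z)) m)"
  proof (cases "z = 0")
    case True
    then show ?thesis
      using branch safe_only[OF step_val(4)] by (simp add: mem_unlock_empty)
  next
    case False
    then show ?thesis
      using branch safe_only[OF step_val(3)[OF False]] by (simp add: mem_unlock_empty)
  qed
qed

lemma safe_return:
  assumes m: "models m (locals k) \<sigma>" and e: "eval \<sigma> e z"
    and post: "safe \<Gamma> \<delta> F n (State k (Stmt (Top (intV sint_it z)) (SReturn (ECast sint e))) m)"
  shows "safe \<Gamma> \<delta> F n (State k (Stmt Down (SReturn (ECast sint e))) m)"
proof (rule safe_only[OF step_down(7)], rule safe_evaluates)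
  let ?k = "CExpr (ECast sint e) CReturnE # k"
  show "models m (locals ?k) \<sigma>"
    using m by simp
  show "evaluates (locals ?k) \<sigma> (ECast sint e) z"
    using e by (intro evaluates_cast eval_evaluates)
  show "safe \<Gamma> \<delta> F n (State ?k (Expr (lit z)) m)"
    using post by (intro safe_only[OF step_val(2)]) (simp add: mem_unlock_empty)
qed

lemma safe_local:
  assumes m: "models m (locals k) \<sigma>"
    and body: "\<And>x m'. models m' (locals (CLocal x sint # k)) (None # \<sigma>) \<Longrightarrow>
      safe \<Gamma> \<delta> F n (State (CLocal x sint # k) (Stmt Down s) m')"
  shows "safe \<Gamma> \<delta> F (Suc n) (State k (Stmt Down (SLocal sint s)) m)"
proof -
  \<comment> \<open>Memories are finite, so a fresh identifier exists and the declaration cannot get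
    stuck.\<close>
  obtain x where "x \<notin> fmdom' m"
    using ex_new_if_finite[OF infinite_UNIV_nat] finite_fmdom' by blast
  then have "mem_allocable x m"
    by (simp add: mem_allocable_def fmdom'_notD)
  then show ?thesis
    using body models_alloc[OF m] unfolding safe.simps step_local by auto
qed

text \<open>The continuation of \<open>s\<close> in context \<open>k\<close>. A return places no
  condition on the memory: from there the machine only unwinds the context towards the caller, and
  the big-step outcome carries no store.\<close>

definition safe_after :: "env \<Rightarrow> funenv \<Rightarrow> (state \<Rightarrow> bool) \<Rightarrow> nat \<Rightarrow> ctx \<Rightarrow> stmt \<Rightarrow> outcome \<Rightarrow> bool" where
  "safe_after \<Gamma> \<delta> F n k s out \<longleftrightarrow> (\<forall>m. case out of
      ONormal \<sigma> \<Rightarrow> models m (locals k) \<sigma> \<longrightarrow> safe \<Gamma> \<delta> F n (State k (Stmt Up s) m)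
    | OReturn z \<Rightarrow> safe \<Gamma> \<delta> F n (State k (Stmt (Top (intV sint_it z)) s) m)
    | OThrow j \<sigma> \<Rightarrow> models m (locals k) \<sigma> \<longrightarrow> safe \<Gamma> \<delta> F n (State k (Stmt (Throw j) s) m))"

text \<open>Most items pass an outcome outwards unchanged. \<open>CCatch\<close> intercepts throws,
  and after a normal outcome \<open>CCompL\<close> and \<open>CLoop\<close> enter a further
  statement; the premises leave these cases out.\<close>

lemma safe_after_sctx:
  assumes "safe_after \<Gamma> \<delta> F n k (sctx_item_subst E s) out" "E \<noteq> CCatch"
    and "abnormal out \<or> (\<exists>s1. E = CCompR s1) \<or> (\<exists>e s'. E = CIfL e s') \<or> (\<exists>e s'. E = CIfR e s')"
  shows "safe_after \<Gamma> \<delta> F n (CStmt E # k) s out"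
proof (cases out)
  case (ONormal \<sigma>)
  then show ?thesis
    using assms by (auto simp: safe_after_def abnormal_def intro: safe_only[OF step_out(2)]
        safe_only[OF step_out(5)] safe_only[OF step_out(6)])
next
  case (OReturn z)
  then show ?thesis
    using assms(1) by (auto simp: safe_after_def intro: safe_only[OF step_out(10)])
next
  case (OThrow j \<sigma>)
  then show ?thesis
    using assms(1) by (auto simp: safe_after_def intro: safe_only[OF step_out(9)[OF assms(2)]])
qed

lemma safe_exec:
  assumes "exec \<sigma> s out" "models m (locals k) \<sigma>" "safe_after \<Gamma> \<delta> F n k s out"
  shows "safe \<Gamma> \<delta> F n (State k (Stmt Down s) m)"
  using assms
proof (induction arbitrary: k m)
  case (exec_skip \<sigma>)
  then show ?case
    by (intro safe_only[OF step_down(1)]) (simp add: safe_after_def)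
next
  case (exec_comp \<sigma> s1 \<sigma>' s2 out)
  \<comment> \<open>Leaving \<open>s1\<close> normally enters \<open>s2\<close>, so the second
    induction hypothesis is the continuation for the first.\<close>
  have "safe_after \<Gamma> \<delta> F n (CStmt (CCompL s2) # k) s1 (ONormal \<sigma>')"
    using exec_comp.prems(2)
    by (auto simp: safe_after_def[of _ _ _ _ _ _ "ONormal _"]
        intro!: safe_only[OF step_out(1)] exec_comp.IH(2) safe_after_sctx)
  then show ?case
    using exec_comp.prems(1) by (intro safe_only[OF step_down(3)] exec_comp.IH(1)) auto
next
  case (exec_comp_abnormal out \<sigma> s1 s2)
  then show ?case
    by (intro safe_only[OF step_down(3)] exec_comp_abnormal.IH safe_after_sctx) auto
next
  case (exec_local \<sigma> s mv \<sigma>')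
  have "safe_after \<Gamma> \<delta> F n (CLocal x sint # k) s (ONormal (mv # \<sigma>'))" for x
    using exec_local.prems(2) models_free
    by (auto simp: safe_after_def intro!: safe_only[OF step_out(11)])
  then show ?case
    using safe_mono[OF safe_local[OF exec_local.prems(1) exec_local.IH], of n] by simp
next
  case (exec_local_return \<sigma> s z)
  have "safe_after \<Gamma> \<delta> F n (CLocal x sint # k) s (OReturn z)" for x
    using exec_local_return.prems(2)
    by (auto simp: safe_after_def intro!: safe_only[OF step_out(11)])
  then show ?case
    using safe_mono[OF safe_local[OF exec_local_return.prems(1) exec_local_return.IH], of n] by simp
next
  case (exec_local_throw \<sigma> s j mv \<sigma>')
  have "safe_after \<Gamma> \<delta> F n (CLocal x sint # k) s (OThrow j (mv # \<sigma>'))" for x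
    using exec_local_throw.prems(2) models_free
    by (auto simp: safe_after_def intro!: safe_only[OF step_out(11)])
  then show ?case
    using safe_mono[OF safe_local[OF exec_local_throw.prems(1) exec_local_throw.IH], of n] by simp
next
  case (exec_assign i \<sigma> e z)
  then show ?case
    by (intro safe_assign[where r = "ECast sint e"] evaluates_cast eval_evaluates)
      (auto simp: safe_after_def)
next
  case (exec_assign_void i \<sigma> e z)
  then show ?case
    by (intro safe_assign[where r = e] eval_evaluates) (auto simp: safe_after_def)
next
  case (exec_if \<sigma> e z s2 s1 out)
  let ?E = "if z = 0 then CIfR e s1 else CIfL e s2" and ?s = "if z = 0 then s2 else s1"
  have "safe_after \<Gamma> \<delta> F n (CStmt ?E # k) ?s out"
    using exec_if.prems(2) by (intro safe_after_sctx) auto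
  then have "safe \<Gamma> \<delta> F n (State (CStmt ?E # k) (Stmt Down ?s) m)"
    using exec_if.prems(1) by (intro exec_if.IH) auto
  from safe_if[OF exec_if.prems(1) exec_if.hyps(1) this] show ?case
    by (rule safe_mono) simp
next
  case (exec_throw \<sigma> j)
  then show ?case
    by (intro safe_only[OF step_down(2)]) (simp add: safe_after_def)
next
  case (exec_catch_here \<sigma> s \<sigma>')
  then show ?case
    by (intro safe_only[OF step_down(4)] exec_catch_here.IH)
      (auto simp: safe_after_def intro!: safe_only[OF step_out(7)])
next
  case (exec_catch_further \<sigma> s j \<sigma>')
  then show ?case
    by (intro safe_only[OF step_down(4)] exec_catch_further.IH)
      (auto simp: safe_after_def intro!: safe_only[OF step_out(8)])
next
  case (exec_catch_nothrown out \<sigma> s)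
  then have "safe_after \<Gamma> \<delta> F n (CStmt CCatch # k) s out"
    using safe_only[OF step_out(3)] safe_only[OF step_out(10)[of _ _ CCatch]]
    by (cases out) (auto simp: safe_after_def nothrown_def)
  then show ?case
    using exec_catch_nothrown.prems by (intro safe_only[OF step_down(4)] exec_catch_nothrown.IH) auto
next
  case (exec_loop_abnormal out \<sigma> s)
  then show ?case
    by (intro safe_only[OF step_down(5)] exec_loop_abnormal.IH safe_after_sctx) auto
next
  case (exec_loop out \<sigma> s \<sigma>')
  then show ?case
    by (intro safe_only[OF step_down(5)] exec_loop.IH(1))
      (auto simp: safe_after_def[of _ _ _ _ _ _ "ONormal _"]
        intro!: safe_only[OF step_out(4)] exec_loop.IH(2))
next
  case (exec_ret \<sigma> e z)
  then show ?case
    by (intro safe_return) (auto simp: safe_after_def)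
qed

lemma safe_execinf:
  assumes "execinf \<sigma> s" "models m (locals k) \<sigma>"
  shows "safe \<Gamma> \<delta> F n (State k (Stmt Down s) m)"
  using assms
proof (induction n arbitrary: \<sigma> s k m)
  case (Suc n)
  from Suc.prems(1) show ?case
  proof cases
    case (execinf_comp1 s1 s2)
    then show ?thesis
      using Suc by (auto intro!: safe_only_Suc[OF step_down(3)] Suc.IH simp del: safe.simps)
  next
    case (execinf_comp2 s1 \<sigma>' s2)
    \<comment> \<open>Entering the sequence has already lowered the bound to \<open>n\<close>. The
      terminating \<open>s1\<close> costs nothing, so the induction hypothesis applies to the
      divergent \<open>s2\<close> at the same \<open>n\<close>.\<close>
    have "safe_after \<Gamma> \<delta> F n (CStmt (CCompL s2) # k) s1 (ONormal \<sigma>')"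
      using execinf_comp2(3)
      by (auto simp: safe_after_def intro!: safe_only[OF step_out(1)] Suc.IH)
    then show ?thesis
      using Suc.prems(2) unfolding execinf_comp2(1)
      by (intro safe_only_Suc[OF step_down(3)] safe_exec[OF execinf_comp2(2)]) auto
  next
    case (execinf_local s')
    then show ?thesis
      using Suc by (auto intro!: safe_local Suc.IH simp del: safe.simps)
  next
    case (execinf_if e z s2 s1)
    then show ?thesis
      using Suc.prems(2) unfolding execinf_if(1) by (intro safe_if Suc.IH) auto
  next
    case (execinf_catch s')
    then show ?thesis
      using Suc by (auto intro!: safe_only_Suc[OF step_down(4)] Suc.IH simp del: safe.simps)
  next
    case (execinf_loop1 s')
    then show ?thesis
      using Suc by (auto intro!: safe_only_Suc[OF step_down(5)] Suc.IH simp del: safe.simps)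
  next
    case (execinf_loop2 s' \<sigma>')
    have "safe_after \<Gamma> \<delta> F n (CStmt CLoop # k) s' (ONormal \<sigma>')"
      using execinf_loop2(3)
      by (auto simp: safe_after_def intro!: safe_only[OF step_out(4)] Suc.IH)
    then show ?thesis
      using Suc.prems(2) unfolding execinf_loop2(1)
      by (intro safe_only_Suc[OF step_down(5)] safe_exec[OF execinf_loop2(2)]) auto
  qed
qed simp

theorem theorem4p13:
  fixes \<Gamma> :: env and \<delta> :: funenv and f :: funname and s :: stmt
  assumes "\<And>\<sigma>\<^sub>h :: store. CHcorrect 0 s \<sigma>\<^sub>h"
  shows "SScorrect \<Gamma> \<delta> f s"
  unfolding SScorrect_def
proof (intro allI impI)
  fix S
  assume steps: "csteps \<Gamma> \<delta> [] (State [CParams f []] (Stmt Down s) fmempty) S"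
  let ?F = "\<lambda>S. \<exists>m z. S = State [] (Return f (intV sint_it z)) m"
  have m: "models fmempty (locals [CParams f []]) []"
    by (simp add: models_def)
  \<comment> \<open>\<open>Return\<close> in the empty context is accepted by \<open>?F\<close> and
    has no successor, so it is safe at every bound.\<close>
  have "safe \<Gamma> \<delta> ?F n (State [] (Return f (intV sint_it z)) m)" for n z m
  proof -
    have "\<not> cstep \<Gamma> \<delta> [] (State [] (Return f (intV sint_it z)) m) S'" for S'
      by (auto elim: cstep.cases)
    then show ?thesis
      by (cases n) auto
  qed
  then have after: "safe_after \<Gamma> \<delta> ?F n [CParams f []] s (OReturn z)" for n z
    by (auto simp: safe_after_def intro!: safe_only[OF step_out(12)])
  \<comment> \<open>The empty store has length 0 and contains no integer, so it meets the guard of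
    \<open>CHcorrect\<close>.\<close>
  have "(\<exists>z. exec [] s (OReturn z)) \<or> execinf [] s"
    using assms[of "[]"] by (simp add: CHcorrect_def)
  then have "safe \<Gamma> \<delta> ?F n (State [CParams f []] (Stmt Down s) fmempty)" for n
    using safe_exec[OF _ m after] safe_execinf[OF _ m] by blast
  from safe_csteps[OF steps this]
  show "(\<exists>S'. cstep \<Gamma> \<delta> [] S S') \<or> (\<exists>m z. S = State [] (Return f (intV sint_it z)) m)"
    by blast
qed

end
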